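(* \textsc{Gap LS Vertex Cover} can be solved in $\mathcal{O}(k!\cdot(\Delta-1)^{\frac{k+d}{2}}\cdot n)$ time, where $\Delta$ is the maximum degree and $n$ the number of vertices of the input graph.
   Context: For sets $A,B$, $A\oplus B=(A\setminus B)\cup(B\setminus A)$. A $k$-swap for a vertex cover $S$ of $G=(V,E)$ is $W\subseteq V$ with $|W|\le k$; it is valid if $S\oplus W$ is a vertex cover of $G$; it is $d$-improving if $|W\cap S|-|W\setminus S|\ge d$. \textsc{Gap LS Vertex Cover}: given a graph $G$, a vertex cover $S$ of $G$, $k\in\mathbb{N}$ and $d\in[1,k]$, decide whether there is a valid $d$-improving $k$-swap for $S$ in $G$.
   Formalization: In the time bound, Δ−1 is read as max(1, Δ−1) and n as max(1, n), since the literal bound is 0 or undefined when Δ ≤ 1 or n = 0; for Δ ≥ 2 and n ≥ 1 the bound is as stated. *)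

theory Defs
  imports Complex_Main "HOL-Library.More_List"
begin

definition simple_graph :: "'v set \<Rightarrow> 'v set set \<Rightarrow> bool" where
  "simple_graph V E \<longleftrightarrow> finite V \<and> (\<forall>e\<in>E. e \<subseteq> V \<and> card e = 2)"

definition neighbours :: "'v set set \<Rightarrow> 'v \<Rightarrow> 'v set" where
  "neighbours E v = {u. {u, v} \<in> E}"

(* 0 is inserted only to give the empty graph maximum degree 0. *)
definition max_degree :: "'v set \<Rightarrow> 'v set set \<Rightarrow> nat" where
  "max_degree V E = Max (insert 0 ((\<lambda>v. card (neighbours E v)) ` V))"

definition vertex_cover :: "'v set \<Rightarrow> 'v set set \<Rightarrow> 'v set \<Rightarrow> bool" where
  "vertex_cover V E S \<longleftrightarrow> S \<subseteq> V \<and> (\<forall>e\<in>E. e \<inter> S \<noteq> {})"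

definition is_swap :: "'v set \<Rightarrow> nat \<Rightarrow> 'v set \<Rightarrow> bool" where
  "is_swap V k W \<longleftrightarrow> W \<subseteq> V \<and> card W \<le> k"

definition valid_swap :: "'v set \<Rightarrow> 'v set set \<Rightarrow> 'v set \<Rightarrow> 'v set \<Rightarrow> bool" where
  "valid_swap V E S W \<longleftrightarrow> vertex_cover V E (sym_diff S W)"

definition improving_swap :: "nat \<Rightarrow> 'v set \<Rightarrow> 'v set \<Rightarrow> bool" where
  "improving_swap d S W \<longleftrightarrow> int (card (W \<inter> S)) - int (card (W - S)) \<ge> int d"

definition gap_ls_vc_instance ::
    "'v set \<Rightarrow> 'v set set \<Rightarrow> 'v set \<Rightarrow> nat \<Rightarrow> nat \<Rightarrow> bool" where
  "gap_ls_vc_instance V E S k d \<longleftrightarrow>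
     simple_graph V E \<and> vertex_cover V E S \<and> 1 \<le> d \<and> d \<le> k"

definition gap_ls_vc :: "'v set \<Rightarrow> 'v set set \<Rightarrow> 'v set \<Rightarrow> nat \<Rightarrow> nat \<Rightarrow> bool" where
  "gap_ls_vc V E S k d \<longleftrightarrow>
     (\<exists>W. is_swap V k W \<and> valid_swap V E S W \<and> improving_swap d S W)"

text \<open>
  A unit-cost random access machine over the natural numbers.  It has scalar registers
  and arrays, both addressed by natural numbers; a program mentions only finitely many of
  them by name, and array cells are accessed indirectly, through an index held in a
  register.  The only arithmetic is addition and truncated subtraction, so that unit cost
  is not a way to hide expensive computations in large numbers.  Keeping finitely many
  arrays apart rather than interleaving them in one memory changes running times by a
  constant factor only.
\<close>

datatype instr =
    Const nat nat
  | Copy nat nat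
  | Add nat nat nat
  | Sub nat nat nat
  | Load nat nat nat
  | Store nat nat nat
  | Jump nat
  | JumpZero nat nat

type_synonym config = "nat \<times> (nat \<Rightarrow> nat) \<times> (nat \<Rightarrow> nat \<Rightarrow> nat)"

fun exec_instr :: "instr \<Rightarrow> config \<Rightarrow> config" where
  "exec_instr (Const r c) (pc, R, M) = (pc + 1, R(r := c), M)"
| "exec_instr (Copy r s) (pc, R, M) = (pc + 1, R(r := R s), M)"
| "exec_instr (Add r s t) (pc, R, M) = (pc + 1, R(r := R s + R t), M)"
| "exec_instr (Sub r s t) (pc, R, M) = (pc + 1, R(r := R s - R t), M)"
| "exec_instr (Load r a s) (pc, R, M) = (pc + 1, R(r := M a (R s)), M)"
| "exec_instr (Store a s t) (pc, R, M) = (pc + 1, R, M(a := (M a)(R s := R t)))"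
| "exec_instr (Jump l) (pc, R, M) = (l, R, M)"
| "exec_instr (JumpZero r l) (pc, R, M) = (if R r = 0 then l else pc + 1, R, M)"

(* A machine whose program counter has left the program has halted and stays put. *)
definition step :: "instr list \<Rightarrow> config \<Rightarrow> config" where
  "step P cf = (if fst cf < length P then exec_instr (P ! fst cf) cf else cf)"

(* Halted configurations are fixed points of step, so this says: after at most t instructions. *)
definition decides_within ::
    "instr list \<Rightarrow> (nat \<Rightarrow> nat) \<Rightarrow> (nat \<Rightarrow> nat \<Rightarrow> nat) \<Rightarrow> nat \<Rightarrow> bool \<Rightarrow> bool" where
  "decides_within P R M t b \<longleftrightarrow>
     (case (step P ^^ t) (0, R, M) of
        (pc, R', M') \<Rightarrow> length P \<le> pc \<and> R' 0 = of_bool b)"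

text \<open>
  The vertices are \<open>0, \<dots>, n - 1\<close>, and the graph is given by adjacency lists in arbitrary
  order.
\<close>
definition adjacency_lists :: "nat set \<Rightarrow> nat set set \<Rightarrow> nat list list \<Rightarrow> bool" where
  "adjacency_lists V E adj \<longleftrightarrow>
     V = {..<length adj} \<and>
     (\<forall>v\<in>V. distinct (adj ! v) \<and> set (adj ! v) = neighbours E v)"

text \<open>
  Registers \<open>0\<close>, \<open>1\<close>, \<open>2\<close> hold \<open>n\<close>, \<open>k\<close>, \<open>d\<close>.  Array \<open>1\<close> is the concatenation of the
  adjacency lists; in it, the list of \<open>v\<close> occupies the positions from \<open>M 0 v\<close> up to, but not
  including, \<open>M 0 (v + 1)\<close>.  Array \<open>2\<close> is the characteristic vector of \<open>S\<close>.  All other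
  registers and cells are \<open>0\<close>.
\<close>
definition input_registers :: "nat \<Rightarrow> nat \<Rightarrow> nat \<Rightarrow> nat \<Rightarrow> nat" where
  "input_registers n k d = nth_default 0 [n, k, d]"

definition input_arrays :: "nat list list \<Rightarrow> nat set \<Rightarrow> nat \<Rightarrow> nat \<Rightarrow> nat" where
  "input_arrays adj S a = nth_default 0 (nth_default []
     [map (\<lambda>v. length (concat (take v adj))) [0..<length adj + 1],
      concat adj,
      map (\<lambda>v. of_bool (v \<in> S)) [0..<length adj]] a)"

end

theory Submission
  imports Defs
begin

text \<open>
  Write \<open>gap J = card J - card (Nout J)\<close>, where \<open>Nout J\<close> is the set of neighbours of \<open>J\<close> outside
  \<open>S\<close>. With \<open>B = (k - d) div 2\<close> and \<open>A = B + d\<close>, a valid \<open>d\<close>-improving \<open>k\<close>-swap exists iff some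
  independent \<open>J \<subseteq> S\<close> with at most \<open>A\<close> vertices has gap at least \<open>d\<close>; such a \<open>J\<close> is built one
  vertex at a time by a search tree of depth \<open>A\<close>. A partial set \<open>P\<close> is extended either by a
  neighbour of a vertex of \<open>Nout P\<close> (at most \<open>B \<Delta>\<close> choices), or, when \<open>P\<close> is a union of
  components of \<open>J\<close>, by the first vertex of a new component. For the latter, let \<open>g\<close> be the smallest
  gap of a remaining component and let \<open>X\<close> be a smallest set, grown connectedly, that increases the
  gap of \<open>P\<close> by \<open>g\<close>. Either \<open>J\<close> meets the closed neighbourhood of \<open>X\<close>, or a component of \<open>J\<close> can be
  exchanged for \<open>X\<close>; so the new vertex may be sought among the \<open>(g + B) (\<Delta> + 1)\<close> vertices close to
  \<open>X\<close>, and the factor \<open>n\<close> is paid only for finding \<open>X\<close>. The values \<open>g\<close> guessed along a branch add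
  up to at most \<open>d\<close>, so they contribute only a factor exponential in \<open>d\<close>. The total is
  \<open>c ^ k (B + 1) ^ A \<Delta> ^ A n\<close> up to constants, and \<open>c ^ k (B + 1) ^ A = O(k!)\<close> for every constant
  \<open>c\<close> because \<open>A + B \<le> k\<close> and
  \<open>B \<le> A\<close>; this also absorbs the difference between \<open>\<Delta>\<close> and \<open>\<Delta> - 1\<close>.
\<close>

text \<open>The obstacle is that trying every vertex as the start of each component costs a factor
  \<open>n\<close> per component. Searching for X at every node nevertheless costs \<open>n\<close>
  only once. With \<open>K = (B + 1) * D\<close>, a node holding i vertices leaves
  \<open>m = A - i - 1\<close> places beyond the start of X, so its search costs
  \<open>n * K ^ (m + 1)\<close> up to small factors, and about \<open>K ^ i\<close> nodes have that
  depth. Depth used by the tree is missing from the search, hence each level contributes about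
  \<open>n * K ^ A\<close>, and levels add instead of multiplying. A guess g creates at most
  \<open>(g + B) * D\<close> children, which is at most \<open>g * K\<close>. The products of the
  guesses along a branch, summed over all ways to write numbers up to \<open>d\<close> as ordered
  sums, are exponential in \<open>d\<close> only. The algorithm cannot tell whether \<open>P\<close>
  is a union of components, so every node tries both kinds of extension and all values of g. Wrong
  guesses do no harm: the answer is positive only at a node whose own gap reaches \<open>d\<close>,
  and labels serve completeness and the time bound.\<close>

section \<open>Structured programs with time bounds\<close>

text \<open>\<open>Cond is r a b\<close> and \<open>While is r a\<close> run the straight-line code \<open>is\<close> and then test whether
  register \<open>r\<close> is nonzero.\<close>
datatype com =
    Blk "instr list"
  | Seq com com (infixr ";;" 60)
  | Cond "instr list" nat com com
  | While "instr list" nat com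

fun basic :: "instr \<Rightarrow> bool" where
  "basic (Jump l) = False"
| "basic (JumpZero r l) = False"
| "basic _ = True"

fun csize :: "com \<Rightarrow> nat" where
  "csize (Blk is) = length is"
| "csize (a ;; b) = csize a + csize b"
| "csize (Cond is r a b) = length is + csize a + csize b + 2"
| "csize (While is r a) = length is + csize a + 2"

fun compile :: "nat \<Rightarrow> com \<Rightarrow> instr list" where
  "compile p (Blk is) = is"
| "compile p (a ;; b) = compile p a @ compile (p + csize a) b"
| "compile p (Cond is r a b) =
     is @ JumpZero r (p + length is + csize a + 2) # compile (p + length is + 1) a @
     Jump (p + length is + csize a + 2 + csize b) # compile (p + length is + csize a + 2) b"
| "compile p (While is r a) =
     is @ JumpZero r (p + length is + csize a + 2) # compile (p + length is + 1) a @ [Jump p]"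

lemma length_compile [simp]: "length (compile p c) = csize c"
  by (induction c arbitrary: p) auto

definition code_at :: "instr list \<Rightarrow> nat \<Rightarrow> instr list \<Rightarrow> bool" where
  "code_at P p is \<longleftrightarrow> (\<exists>us vs. P = us @ is @ vs \<and> length us = p)"

lemma code_at_append:
  "code_at P p (is @ js) \<longleftrightarrow> code_at P p is \<and> code_at P (p + length is) js"
proof
  assume "code_at P p (is @ js)"
  then obtain us vs where "P = us @ (is @ js) @ vs" "length us = p"
    by (auto simp: code_at_def)
  then have "P = us @ is @ (js @ vs)" "P = (us @ is) @ js @ vs" "length (us @ is) = p + length is"
    by auto
  with \<open>length us = p\<close> show "code_at P p is \<and> code_at P (p + length is) js"
    unfolding code_at_def by blast
next
  assume *: "code_at P p is \<and> code_at P (p + length is) js"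
  then obtain us vs where 1: "P = us @ is @ vs" "length us = p"
    by (auto simp: code_at_def)
  from * obtain us' vs' where 2: "P = us' @ js @ vs'" "length us' = p + length is"
    by (auto simp: code_at_def)
  have "us' = us @ is"
    using 1 2 by (metis append_eq_append_conv_if append_eq_conv_conj length_append append.assoc)
  with 1 2 show "code_at P p (is @ js)"
    unfolding code_at_def by auto
qed

lemma code_at_Cons:
  "code_at P p (i # is) \<longleftrightarrow> code_at P p [i] \<and> code_at P (p + 1) is"
  using code_at_append[of P p "[i]" "is"] by simp

lemma code_at_step:
  "code_at P p [i] \<Longrightarrow> step P (p, s) = exec_instr i (p, s)"
  by (auto simp: code_at_def step_def nth_append)

type_synonym state = "(nat \<Rightarrow> nat) \<times> (nat \<Rightarrow> nat \<Rightarrow> nat)"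

fun run :: "instr list \<Rightarrow> state \<Rightarrow> state" where
  "run [] s = s"
| "run (i # is) s = run is (snd (exec_instr i (0, s)))"

lemma exec_basic: "basic i \<Longrightarrow> exec_instr i (p, s) = (p + 1, snd (exec_instr i (0, s)))"
  by (cases i; cases s) auto

text \<open>Jump targets are absolute, so compiled code depends on its position. Quantifying over
  all programs that contain it at \<open>p\<close> makes executions composable.\<close>

definition runs :: "com \<Rightarrow> state \<Rightarrow> nat \<Rightarrow> state \<Rightarrow> bool" where
  "runs c s t s' \<longleftrightarrow>
     (\<forall>P p. code_at P p (compile p c) \<longrightarrow> (step P ^^ t) (p, s) = (p + csize c, s'))"

lemma step_block:
  "code_at P p is \<Longrightarrow> list_all basic is \<Longrightarrow>
     (step P ^^ length is) (p, s) = (p + length is, run is s)"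
proof (induction "is" arbitrary: p s)
  case (Cons i "is")
  from Cons.prems have "code_at P p [i]" "code_at P (p + 1) is" "basic i" "list_all basic is"
    using code_at_Cons[of P p i "is"] by auto
  then have "step P (p, s) = (p + 1, snd (exec_instr i (0, s)))"
    by (metis code_at_step exec_basic)
  moreover have "(step P ^^ length is) (p + 1, snd (exec_instr i (0, s)))
      = (p + 1 + length is, run is (snd (exec_instr i (0, s))))"
    using Cons.IH \<open>code_at P (p + 1) is\<close> \<open>list_all basic is\<close> by blast
  ultimately show ?case
    by (simp del: funpow.simps add: funpow_Suc_right)
qed simp

lemma runs_Blk: "list_all basic is \<Longrightarrow> runs (Blk is) s (length is) (run is s)"
  by (simp add: runs_def step_block)

lemma runs_Seq: "runs a s t s' \<Longrightarrow> runs b s' u s'' \<Longrightarrow> runs (a ;; b) s (t + u) s''"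
  by (subst add.commute) (simp add: runs_def code_at_append funpow_add add.assoc)

text \<open>The 2 counts the test and the jump over \<open>b\<close>; the zero branch pays for the
  test alone.\<close>

lemma runs_Cond_True:
  assumes "list_all basic is" "fst (run is s) r \<noteq> 0" "runs a (run is s) t s'"
  shows "runs (Cond is r a b) s (length is + t + 2) s'"
  unfolding runs_def
proof (intro allI impI)
  fix P p
  assume "code_at P p (compile p (Cond is r a b))"
  then have c: "code_at P p is"
    "code_at P (p + length is) [JumpZero r (p + length is + csize a + 2)]"
    "code_at P (p + length is + 1) (compile (p + length is + 1) a)"
    "code_at P (p + length is + 1 + csize a) [Jump (p + length is + csize a + 2 + csize b)]"
    by (simp_all only: compile.simps code_at_append code_at_Cons[of _ _ _ "_ @ _"]
        code_at_Cons[of _ _ _ "compile _ _"] length_compile)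
  have 1: "(step P ^^ length is) (p, s) = (p + length is, run is s)"
    using c assms by (simp add: step_block)
  have 2: "step P (p + length is, run is s) = (p + length is + 1, run is s)"
    using code_at_step[OF c(2)] assms(2) by (cases "run is s") auto
  have 3: "(step P ^^ t) (p + length is + 1, run is s) = (p + length is + 1 + csize a, s')"
    using assms(3) c(3) unfolding runs_def by blast
  have 4: "step P (p + length is + 1 + csize a, s') = (p + length is + csize a + 2 + csize b, s')"
    using code_at_step[OF c(4)] by (cases s') auto
  have "(step P ^^ (length is + t + 2)) (p, s)
        = (step P ^^ Suc (t + Suc (length is))) (p, s)"
    by (simp add: ac_simps)
  also have "\<dots> = (p + length is + csize a + 2 + csize b, s')"
    by (simp only: funpow_add funpow.simps o_apply 1 2 3 4)
  finally show "(step P ^^ (length is + t + 2)) (p, s) = (p + csize (Cond is r a b), s')"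
    by (simp add: ac_simps)
qed

lemma runs_Cond_False:
  assumes "list_all basic is" "fst (run is s) r = 0" "runs b (run is s) t s'"
  shows "runs (Cond is r a b) s (length is + t + 1) s'"
  unfolding runs_def
proof (intro allI impI)
  fix P p
  assume "code_at P p (compile p (Cond is r a b))"
  then have c: "code_at P p is"
    "code_at P (p + length is) [JumpZero r (p + length is + csize a + 2)]"
    "code_at P (p + length is + 1 + csize a + 1) (compile (p + length is + csize a + 2) b)"
    by (simp_all only: compile.simps code_at_append code_at_Cons[of _ _ _ "_ @ _"]
        code_at_Cons[of _ _ _ "compile _ _"] length_compile)
  have 1: "(step P ^^ length is) (p, s) = (p + length is, run is s)"
    using c assms by (simp add: step_block)
  have 2: "step P (p + length is, run is s) = (p + length is + csize a + 2, run is s)"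
    using code_at_step[OF c(2)] assms(2) by (cases "run is s") auto
  have 3: "(step P ^^ t) (p + length is + csize a + 2, run is s) = (p + length is + csize a + 2 + csize b, s')"
    using assms(3) c(3) unfolding runs_def by (simp add: ac_simps)
  have "(step P ^^ (length is + t + 1)) (p, s) = (step P ^^ (t + Suc (length is))) (p, s)"
    by (simp add: ac_simps)
  also have "\<dots> = (p + length is + csize a + 2 + csize b, s')"
    by (simp only: funpow_add funpow.simps o_apply 1 2 3)
  finally show "(step P ^^ (length is + t + 1)) (p, s) = (p + csize (Cond is r a b), s')"
    by (simp add: ac_simps)
qed

lemma runs_While_exit:
  assumes "list_all basic is" "fst (run is s) r = 0"
  shows "runs (While is r a) s (length is + 1) (run is s)"
  unfolding runs_def
proof (intro allI impI)
  fix P p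
  assume "code_at P p (compile p (While is r a))"
  then have c: "code_at P p is"
    "code_at P (p + length is) [JumpZero r (p + length is + csize a + 2)]"
    by (simp_all only: compile.simps code_at_append code_at_Cons[of _ _ _ "_ @ _"]
        code_at_Cons[of _ _ _ "compile _ _"] length_compile)
  have 1: "(step P ^^ length is) (p, s) = (p + length is, run is s)"
    using c assms by (simp add: step_block)
  have 2: "step P (p + length is, run is s) = (p + length is + csize a + 2, run is s)"
    using code_at_step[OF c(2)] assms(2) by (cases "run is s") auto
  show "(step P ^^ (length is + 1)) (p, s) = (p + csize (While is r a), run is s)"
    by (simp add: 1 2)
qed

lemma runs_While_step:
  assumes "list_all basic is" "fst (run is s) r \<noteq> 0" "runs a (run is s) t s'"
    "runs (While is r a) s' u s''"
  shows "runs (While is r a) s (length is + 2 + t + u) s''"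
  unfolding runs_def
proof (intro allI impI)
  fix P p
  assume w: "code_at P p (compile p (While is r a))"
  then have c: "code_at P p is"
    "code_at P (p + length is) [JumpZero r (p + length is + csize a + 2)]"
    "code_at P (p + length is + 1) (compile (p + length is + 1) a)"
    "code_at P (p + length is + 1 + csize a) [Jump p]"
    by (simp_all only: compile.simps code_at_append code_at_Cons[of _ _ _ "_ @ _"]
        code_at_Cons[of _ _ _ "compile _ _"] length_compile)
  have 1: "(step P ^^ length is) (p, s) = (p + length is, run is s)"
    using c assms by (simp add: step_block)
  have 2: "step P (p + length is, run is s) = (p + length is + 1, run is s)"
    using code_at_step[OF c(2)] assms(2) by (cases "run is s") auto
  have 3: "(step P ^^ t) (p + length is + 1, run is s) = (p + length is + 1 + csize a, s')"
    using assms(3) c(3) unfolding runs_def by blast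
  have 4: "step P (p + length is + 1 + csize a, s') = (p, s')"
    using code_at_step[OF c(4)] by (cases s') auto
  have 5: "(step P ^^ u) (p, s') = (p + csize (While is r a), s'')"
    using assms(4) w unfolding runs_def by blast
  have "(step P ^^ (length is + 2 + t + u)) (p, s)
        = (step P ^^ (u + Suc (t + Suc (length is)))) (p, s)"
    by (simp add: ac_simps)
  also have "\<dots> = (p + csize (While is r a), s'')"
    by (simp only: funpow_add funpow.simps o_apply 1 2 3 4 5)
  finally show "(step P ^^ (length is + 2 + t + u)) (p, s) = (p + csize (While is r a), s'')" .
qed

text \<open>The start is a concrete state instead of a precondition: straight-line code is executed
  by rewriting with \<open>run\<close>, and facts about the state stay in the proof context.\<close>

definition hoare :: "com \<Rightarrow> state \<Rightarrow> nat \<Rightarrow> ((nat \<Rightarrow> nat) \<Rightarrow> (nat \<Rightarrow> nat \<Rightarrow> nat) \<Rightarrow> bool) \<Rightarrow> bool" where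
  "hoare c s T Q \<longleftrightarrow> (\<exists>t R M. runs c s t (R, M) \<and> t \<le> T \<and> Q R M)"

lemma hoare_mono:
  "hoare c s T Q \<Longrightarrow> T \<le> T' \<Longrightarrow> (\<And>R M. Q R M \<Longrightarrow> Q' R M) \<Longrightarrow> hoare c s T' Q'"
  unfolding hoare_def by (meson order_trans)

lemma hoare_Blk:
  assumes "list_all basic is" "\<And>R M. run is s = (R, M) \<Longrightarrow> Q R M" "length is \<le> T"
  shows "hoare (Blk is) s T Q"
  unfolding hoare_def using runs_Blk assms by (metis prod.collapse)

lemma hoare_Seq:
  assumes "hoare a s T Q" "\<And>R M. Q R M \<Longrightarrow> hoare b (R, M) T' Q'" "T + T' \<le> T''"
  shows "hoare (a ;; b) s T'' Q'"
proof -
  obtain t R M where 1: "runs a s t (R, M)" "t \<le> T" "Q R M"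
    using assms(1) by (auto simp: hoare_def)
  obtain u R' M' where 2: "runs b (R, M) u (R', M')" "u \<le> T'" "Q' R' M'"
    using assms(2)[OF 1(3)] by (auto simp: hoare_def)
  show ?thesis
    unfolding hoare_def using runs_Seq[OF 1(1) 2(1)] 1 2 assms(3)
    by (intro exI[of _ "t + u"] exI[of _ R'] exI[of _ M']) auto
qed

lemma hoare_Blk_Seq:
  assumes "list_all basic is" "\<And>R M. run is s = (R, M) \<Longrightarrow> hoare b (R, M) T Q" "length is + T \<le> T'"
  shows "hoare (Blk is ;; b) s T' Q"
  by (rule hoare_Seq[where Q = "\<lambda>R M. run is s = (R, M)" and T = "length is" and T' = T])
     (use assms in \<open>auto intro!: hoare_Blk\<close>)

lemma hoare_Cond:
  assumes "list_all basic is"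
    and "\<And>R M. run is s = (R, M) \<Longrightarrow> R r \<noteq> 0 \<Longrightarrow> hoare a (R, M) T Q"
    and "\<And>R M. run is s = (R, M) \<Longrightarrow> R r = 0 \<Longrightarrow> hoare b (R, M) T Q"
    and "length is + T + 2 \<le> T'"
  shows "hoare (Cond is r a b) s T' Q"
proof (cases "fst (run is s) r = 0")
  case True
  then obtain t R M where "runs b (run is s) t (R, M)" "t \<le> T" "Q R M"
    using assms(3)[of "fst (run is s)" "snd (run is s)"] by (auto simp: hoare_def)
  with runs_Cond_False[OF assms(1) True this(1)] assms(4) show ?thesis
    unfolding hoare_def
    by (intro exI[of _ "length is + t + 1"] exI[of _ R] exI[of _ M]) auto
next
  case False
  then obtain t R M where "runs a (run is s) t (R, M)" "t \<le> T" "Q R M"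
    using assms(2)[of "fst (run is s)" "snd (run is s)"] by (auto simp: hoare_def)
  with runs_Cond_True[OF assms(1) False this(1)] assms(4) show ?thesis
    unfolding hoare_def
    by (intro exI[of _ "length is + t + 2"] exI[of _ R] exI[of _ M]) auto
qed

text \<open>The ghost value \<open>x\<close> describes the state at the loop head, and \<open>pot x\<close> is an upper bound
  on the number of instructions still to be executed.\<close>
lemma hoare_While:
  fixes pot :: "'g \<Rightarrow> nat"
  assumes basic: "list_all basic is"
    and inv: "Inv x R M"
    and exit: "\<And>x R M. Inv x R M \<Longrightarrow> fst (run is (R, M)) r = 0 \<Longrightarrow>
      length is + 1 \<le> pot x \<and> Q (fst (run is (R, M))) (snd (run is (R, M)))"
    and step: "\<And>x R M. Inv x R M \<Longrightarrow> fst (run is (R, M)) r \<noteq> 0 \<Longrightarrow>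
      \<exists>T. hoare b (run is (R, M)) T (\<lambda>R' M'. \<exists>y. Inv y R' M' \<and> length is + 2 + T + pot y \<le> pot x)"
    and T: "pot x \<le> T"
  shows "hoare (While is r b) (R, M) T Q"
proof -
  have "hoare (While is r b) (R, M) (pot x) Q" using inv
  \<comment> \<open>The two jumps of an iteration already make \<open>pot\<close> decrease strictly,
    so the time bound doubles as termination measure.\<close>
  proof (induction "pot x" arbitrary: x R M rule: less_induct)
    case less
    show ?case
    proof (cases "fst (run is (R, M)) r = 0")
      case True
      with exit[OF less.prems] runs_While_exit[OF basic True] show ?thesis
        unfolding hoare_def by (metis prod.collapse)
    next
      case False
      obtain U where "hoare b (run is (R, M)) U
          (\<lambda>R' M'. \<exists>y. Inv y R' M' \<and> length is + 2 + U + pot y \<le> pot x)"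
        using step[OF less.prems False] by blast
      then obtain t R' M' y where 1: "runs b (run is (R, M)) t (R', M')" "t \<le> U"
          "Inv y R' M'" "length is + 2 + U + pot y \<le> pot x"
        by (auto simp: hoare_def)
      have "hoare (While is r b) (R', M') (pot y) Q"
        by (rule less.hyps) (use 1 in auto)
      then obtain u R'' M'' where 2: "runs (While is r b) (R', M') u (R'', M'')" "u \<le> pot y" "Q R'' M''"
        by (auto simp: hoare_def)
      show ?thesis
        unfolding hoare_def using runs_While_step[OF basic False 1(1) 2(1)] 1 2
        by (intro exI[of _ "length is + 2 + t + u"] exI[of _ R''] exI[of _ M'']) auto
    qed
  qed
  then show ?thesis
    using T hoare_mono by blast
qed

lemma hoare_decides:
  assumes "hoare c (R, M) T Q" "\<And>R' M'. Q R' M' \<Longrightarrow> R' 0 = of_bool b"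
  shows "\<exists>t\<le>T. decides_within (compile 0 c) R M t b"
proof -
  obtain t R' M' where 1: "runs c (R, M) t (R', M')" "t \<le> T" "Q R' M'"
    using assms(1) by (auto simp: hoare_def)
  have "code_at (compile 0 c) 0 (compile 0 c)"
    by (auto simp: code_at_def)
  then have "(step (compile 0 c) ^^ t) (0, R, M) = (0 + csize c, R', M')"
    using 1(1) unfolding runs_def by blast
  with 1 assms(2) show ?thesis
    by (intro exI[of _ t]) (simp add: decides_within_def)
qed

section \<open>The exchange argument\<close>

locale vc_instance =
  fixes V :: "nat set" and E :: "nat set set" and S :: "nat set" and k d :: nat
    and adj :: "nat list list"
  assumes inst: "gap_ls_vc_instance V E S k d"
    and adj: "adjacency_lists V E adj"
begin

abbreviation n :: nat where "n \<equiv> length adj"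

abbreviation nb :: "nat \<Rightarrow> nat set" where "nb \<equiv> neighbours E"

definition B :: nat where "B = (k - d) div 2"

definition A :: nat where "A = B + d"

text \<open>Bounds the size of a closed neighbourhood and stays positive on edgeless graphs.\<close>

definition D :: nat where "D = max_degree V E + 1"

definition Nout :: "nat set \<Rightarrow> nat set" where
  "Nout X = (\<Union>x\<in>X. nb x) - S"

definition indep :: "nat set \<Rightarrow> bool" where
  "indep X \<longleftrightarrow> (\<forall>x\<in>X. \<forall>y\<in>X. y \<notin> nb x)"

definition gap :: "nat set \<Rightarrow> int" where
  "gap X = int (card X) - int (card (Nout X))"

definition solution :: "nat set \<Rightarrow> bool" where
  "solution J \<longleftrightarrow> J \<subseteq> S \<and> indep J \<and> card J \<le> A \<and> int d \<le> gap J"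

lemma V_eq: "V = {..<n}" and card_V: "card V = n" and finite_V: "finite V"
  using adj by (auto simp: adjacency_lists_def)

lemma d_bounds: "1 \<le> d" "d \<le> k"
  using inst by (auto simp: gap_ls_vc_instance_def)

lemma set_adj: "v < n \<Longrightarrow> set (adj ! v) = nb v"
  and distinct_adj: "v < n \<Longrightarrow> distinct (adj ! v)"
  using adj by (auto simp: adjacency_lists_def)

lemma S_subset: "S \<subseteq> {..<n}" and finite_S: "finite S"
  using inst V_eq by (auto simp: gap_ls_vc_instance_def vertex_cover_def intro: finite_subset)

lemma nb_sym: "u \<in> nb v \<longleftrightarrow> v \<in> nb u"
  by (simp add: neighbours_def insert_commute)

lemma edgeD: "{u, v} \<in> E \<Longrightarrow> u < n \<and> v < n \<and> u \<noteq> v"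
proof -
  assume "{u, v} \<in> E"
  then have "{u, v} \<subseteq> V" "card {u, v} = 2"
    using inst unfolding gap_ls_vc_instance_def simple_graph_def by auto
  then show ?thesis
    by (auto simp: V_eq card_insert_if split: if_splits)
qed

lemma nb_lt: "u \<in> nb v \<Longrightarrow> u < n \<and> v < n \<and> u \<noteq> v"
  using edgeD by (auto simp: neighbours_def)

lemma cover: "u \<in> nb v \<Longrightarrow> u \<in> S \<or> v \<in> S"
  using inst unfolding gap_ls_vc_instance_def vertex_cover_def neighbours_def by fastforce

lemma length_adj_less: "v < n \<Longrightarrow> length (adj ! v) < D"
proof -
  assume v: "v < n"
  then have "length (adj ! v) = card (nb v)"
    by (metis distinct_adj distinct_card set_adj)
  also have "\<dots> \<le> max_degree V E"
    unfolding max_degree_def using v finite_V by (intro Max_ge) (auto simp: V_eq)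
  finally show ?thesis
    by (simp add: D_def)
qed

lemma adj_lt: "v < n \<Longrightarrow> u \<in> set (adj ! v) \<Longrightarrow> u < n"
  using set_adj nb_lt by auto

lemma D_pos: "1 \<le> D"
  by (simp add: D_def)

text \<open>Lets the factor \<open>D\<close> in the cost of a single leaf be charged to
  \<open>n\<close>; otherwise the exponent of \<Delta> would exceed \<open>A\<close>.\<close>

lemma D_le: "D \<le> max 1 n"
proof -
  have "card (nb v) \<le> n - 1" if "v < n" for v
  proof -
    have "card (nb v) \<le> card ({..<n} - {v})"
      by (rule card_mono) (use nb_lt in auto)
    then show ?thesis
      using that by simp
  qed
  then have "max_degree V E \<le> n - 1"
    unfolding max_degree_def using finite_V by (subst Max_le_iff) (auto simp: V_eq)
  then show ?thesis
    by (auto simp: D_def)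
qed

lemma A_B: "A + B \<le> k" "k \<le> A + B + 1" "B \<le> A" "d \<le> A" "1 \<le> A" "2 * A \<le> k + d"
  using d_bounds by (auto simp: A_def B_def)

section \<open>Outer neighbours, the gap, and the reformulation as independent sets\<close>

lemma Nout_mono: "X \<subseteq> Y \<Longrightarrow> Nout X \<subseteq> Nout Y"
  by (auto simp: Nout_def)

lemma finite_Nout: "finite (Nout X)"
  by (rule finite_subset[of _ "{..<n}"]) (use nb_lt in \<open>auto simp: Nout_def\<close>)

lemma Nout_Un: "Nout (X \<union> Y) = Nout X \<union> Nout Y"
  by (auto simp: Nout_def)

lemma Nout_lt: "u \<in> Nout X \<Longrightarrow> u < n"
  using nb_lt by (auto simp: Nout_def)

lemma finite_sub_S: "X \<subseteq> S \<Longrightarrow> finite X"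
  using finite_S finite_subset by blast

text \<open>Outer neighbours of \<open>I\<close> are already paid for, so adding \<open>X\<close>
  costs only the new ones.\<close>

lemma gap_Un:
  assumes "finite I" "finite X" "I \<inter> X = {}"
  shows "gap (I \<union> X) = gap I + int (card X) - int (card (Nout X - Nout I))"
proof -
  have "Nout (I \<union> X) = Nout I \<union> (Nout X - Nout I)"
    by (auto simp: Nout_Un)
  then have "card (Nout (I \<union> X)) = card (Nout I) + card (Nout X - Nout I)"
    using card_Un_disjoint[of "Nout I" "Nout X - Nout I"] by (simp add: finite_Nout)
  then show ?thesis
    using assms by (simp add: gap_def card_Un_disjoint)
qed

text \<open>Dropping vertices from the swap until it is exactly \<open>d\<close>-improving bounds
  \<open>card (W \<inter> S)\<close> by \<open>(k + d) div 2\<close>, and this bound in turn implies \<open>card W \<le> k\<close>.\<close>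
lemma gap_ls_vc_iff_solution: "gap_ls_vc V E S k d \<longleftrightarrow> (\<exists>J. solution J)"
proof
  assume "gap_ls_vc V E S k d"
  then obtain W where W: "W \<subseteq> V" "card W \<le> k" "vertex_cover V E (sym_diff S W)"
      "int (card (W \<inter> S)) - int (card (W - S)) \<ge> int d"
    by (auto simp: gap_ls_vc_def is_swap_def valid_swap_def improving_swap_def)
  define b where "b = card (W - S)"
  have fW: "finite W"
    using W(1) finite_V finite_subset by blast
  have "d + b \<le> card (W \<inter> S)"
    using W(4) by (simp add: b_def)
  then obtain J where J: "J \<subseteq> W \<inter> S" "card J = d + b"
    by (meson obtain_subset_with_card_n)
  have cov: "u \<in> sym_diff S W \<or> v \<in> sym_diff S W" if "u \<in> nb v" for u v
    using W(3) that unfolding vertex_cover_def neighbours_def by fastforce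
  \<comment> \<open>An edge at a vertex removed from the cover stays covered only if its other end
    is in the new cover; this gives both the inclusion and independence.\<close>
  have "Nout J \<subseteq> W - S"
  proof
    fix u assume "u \<in> Nout J"
    then obtain x where "x \<in> J" "u \<in> nb x" "u \<notin> S"
      by (auto simp: Nout_def)
    then show "u \<in> W - S"
      using cov[of u x] J(1) by auto
  qed
  then have "card (Nout J) \<le> b"
    unfolding b_def using fW by (intro card_mono) auto
  moreover have "indep J"
    unfolding indep_def using cov J(1) by blast
  moreover have "card W = card (W \<inter> S) + card (W - S)"
    using card_Un_disjoint[of "W \<inter> S" "W - S"] fW by (auto simp: Int_Diff_Un)
  then have "d + 2 * b \<le> k"
    using W(2) \<open>d + b \<le> card (W \<inter> S)\<close> by (simp add: b_def)
  then have "card J \<le> A"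
    using J(2) by (auto simp: A_def B_def)
  ultimately have "solution J"
    using J by (auto simp: solution_def gap_def)
  then show "\<exists>J. solution J" ..
next
  assume "\<exists>J. solution J"
  then obtain J where J: "J \<subseteq> S" "indep J" "card J \<le> A" "int d \<le> gap J"
    by (auto simp: solution_def)
  define W where "W = J \<union> Nout J"
  have WS: "W \<inter> S = J" "W - S = Nout J"
    using J(1) by (auto simp: W_def Nout_def)
  have "W \<subseteq> V"
    using J(1) S_subset Nout_lt by (auto simp: W_def V_eq)
  moreover have "card W \<le> card J + card (Nout J)"
    unfolding W_def by (rule card_Un_le)
  then have "card W \<le> k"
    using J(3,4) A_B(6) by (simp add: gap_def)
  moreover have "vertex_cover V E (sym_diff S W)"
    unfolding vertex_cover_def
  proof (intro conjI ballI)
    show "sym_diff S W \<subseteq> V"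
      using \<open>W \<subseteq> V\<close> S_subset V_eq by blast
    fix e assume e: "e \<in> E"
    then have "card e = 2"
      using inst by (auto simp: gap_ls_vc_instance_def simple_graph_def)
    then obtain u v where uv: "e = {u, v}"
      by (meson card_2_iff)
    have nuv: "u \<in> nb v" "v \<in> nb u"
      using e uv by (auto simp: neighbours_def insert_commute)
    have *: "y \<in> sym_diff S W" if "x \<in> J" "y \<in> nb x" for x y
      using that J(2) unfolding W_def indep_def Nout_def by auto
    have "u \<in> S \<or> v \<in> S"
      using cover nuv by blast
    then have "u \<in> sym_diff S W \<or> v \<in> sym_diff S W"
      using * nuv WS by blast
    then show "e \<inter> sym_diff S W \<noteq> {}"
      using uv by auto
  qed
  moreover have "improving_swap d S W"
    using J(4) by (simp add: improving_swap_def WS gap_def)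
  ultimately show "gap_ls_vc V E S k d"
    by (auto simp: gap_ls_vc_def is_swap_def valid_swap_def)
qed

section \<open>Feasible lists, growth and labels\<close>

text \<open>Nodes of the search tree are lists of vertices, the most recently added vertex first.\<close>
definition feasible :: "nat list \<Rightarrow> bool" where
  "feasible P \<longleftrightarrow> distinct P \<and> set P \<subseteq> S \<and> indep (set P) \<and> card (Nout (set P)) \<le> B"

text \<open>Serves both extensions: applied to \<open>X\<close> it lists the candidates for a new
  start, applied to the outer neighbours of \<open>P\<close> it lists the ways to grow.\<close>

definition closed_nbs :: "nat list \<Rightarrow> nat list" where
  "closed_nbs L = concat (map (\<lambda>u. u # adj ! u) L)"

lemma set_closed_nbs: "set L \<subseteq> {..<n} \<Longrightarrow> set (closed_nbs L) = set L \<union> (\<Union>u\<in>set L. nb u)"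
  using set_adj by (auto simp: closed_nbs_def)

lemma closed_nbs_lt: "set L \<subseteq> {..<n} \<Longrightarrow> set (closed_nbs L) \<subseteq> {..<n}"
  using nb_lt by (auto simp: set_closed_nbs)

lemma length_closed_nbs: "set L \<subseteq> {..<n} \<Longrightarrow> length (closed_nbs L) \<le> length L * D"
proof (induction L)
  case (Cons u L)
  then show ?case
    using length_adj_less[of u] by (simp add: closed_nbs_def)
qed (simp add: closed_nbs_def)

text \<open>The new vertex shares the outer neighbour \<open>u\<close> with \<open>P\<close>. As
  \<open>u\<close> is outside the cover, \<open>v\<close> is in \<open>S\<close>
  automatically.\<close>

definition grow1 :: "nat list \<Rightarrow> nat list \<Rightarrow> bool" where
  "grow1 P Q \<longleftrightarrow> (\<exists>v u. Q = v # P \<and> v \<notin> set P \<and> u \<in> Nout (set P) \<and> v \<in> nb u)"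

abbreviation grow :: "nat list \<Rightarrow> nat list \<Rightarrow> bool" where
  "grow \<equiv> grow1\<^sup>*\<^sup>*"

lemma grow_append: "grow P Q \<Longrightarrow> \<exists>Z. Q = Z @ P"
proof (induction rule: rtranclp_induct)
  case (step y z)
  then show ?case
    by (auto simp: grow1_def intro: exI[of _ "_ # _"])
qed simp

text \<open>All conditions pass to subsets, so an infeasible node can be cut off with everything
  below it.\<close>

lemma feasible_suffix: "feasible (Z @ P) \<Longrightarrow> feasible P"
proof -
  assume a: "feasible (Z @ P)"
  have "card (Nout (set P)) \<le> card (Nout (set (Z @ P)))"
    by (intro card_mono finite_Nout Nout_mono) auto
  with a show ?thesis
    by (auto simp: feasible_def indep_def)
qed

text \<open>At most \<open>A = B + d\<close> vertices with gap at least \<open>d\<close> leave room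
  for at most \<open>B\<close> outer neighbours.\<close>

lemma solution_feasible:
  assumes "solution J" "distinct P" "set P \<subseteq> J"
  shows "feasible P" "length P \<le> A"
proof -
  have "card (Nout (set P)) \<le> card (Nout J)"
    by (intro card_mono finite_Nout Nout_mono assms)
  also have "\<dots> \<le> B"
    using assms(1) by (auto simp: solution_def gap_def A_def)
  finally show "feasible P"
    using assms by (auto simp: feasible_def solution_def indep_def subset_iff)
  have "finite J"
    using assms(1) finite_sub_S by (auto simp: solution_def)
  then have "card (set P) \<le> card J"
    using assms by (intro card_mono) auto
  then show "length P \<le> A"
    using assms by (simp add: solution_def distinct_card)
qed

text \<open>A node of the search tree is a list \<open>P\<close> labelled with the sum \<open>h\<close> of the gaps guessed so far:
  \<open>K\<close> completes the components of \<open>J\<close> that \<open>P\<close> has begun, and these must have paid for the guesses.\<close>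
definition good :: "nat list \<Rightarrow> nat \<Rightarrow> bool" where
  "good P h \<longleftrightarrow> (\<exists>K J. grow P K \<and> distinct K \<and> set K \<subseteq> J \<and> solution J \<and> int h \<le> gap (set K))"

lemma good_feasible: "good P h \<Longrightarrow> feasible P"
  unfolding good_def by (metis grow_append solution_feasible(1) feasible_suffix)

lemma gap_empty: "gap {} = 0"
  by (simp add: gap_def Nout_def)

lemma good_Nil: "good [] 0 \<longleftrightarrow> (\<exists>J. solution J)"
proof
  assume "\<exists>J. solution J"
  then show "good [] 0"
    unfolding good_def by (auto intro!: exI[of _ "[]"] simp: gap_empty)
qed (auto simp: good_def)

text \<open>\<open>reach P thr\<close> describes the lists that the breadth-first search for \<open>X\<close> can generate, and
  \<open>target P thr\<close> those that it must not miss. The search also generates the vertices \<open>v = u\<close>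
  outside \<open>S\<close>, which are discarded because they are not feasible.\<close>
inductive reach :: "nat list \<Rightarrow> int \<Rightarrow> nat list \<Rightarrow> bool" for P thr where
  reach_start: "w < n \<Longrightarrow> reach P thr (w # P)"
| reach_step: "reach P thr p \<Longrightarrow> feasible p \<Longrightarrow> gap (set p) < thr \<Longrightarrow> u \<in> Nout (set p) \<Longrightarrow>
    v = u \<or> v \<in> nb u \<Longrightarrow> reach P thr (v # p)"

definition target :: "nat list \<Rightarrow> int \<Rightarrow> nat list \<Rightarrow> bool" where
  "target P thr Q \<longleftrightarrow> (\<exists>w<n. grow (w # P) Q) \<and> feasible Q \<and> length Q \<le> A \<and> thr \<le> gap (set Q)"

lemma reach_append: "reach P thr p \<Longrightarrow> \<exists>X. p = X @ P \<and> X \<noteq> []"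
  by (induction rule: reach.induct) auto

lemma reach_lt: "reach P thr p \<Longrightarrow> set P \<subseteq> {..<n} \<Longrightarrow> set p \<subseteq> {..<n}"
  by (induction rule: reach.induct) (auto dest: Nout_lt nb_lt)

lemma reach_grow: "reach P thr p \<Longrightarrow> feasible p \<Longrightarrow> \<exists>X w. p = X @ w # P \<and> grow (w # P) p"
proof (induction rule: reach.induct)
  case (reach_start w)
  then show ?case by (auto intro: exI[of _ "[]"])
next
  case (reach_step p u v)
  then obtain X w where p: "p = X @ w # P" "grow (w # P) p"
    by auto
  have "v \<in> S" "v \<notin> set p"
    using reach_step.prems by (auto simp: feasible_def)
  moreover have "u \<notin> S"
    using reach_step.hyps by (auto simp: Nout_def)
  ultimately have "grow1 p (v # p)"
    using reach_step.hyps unfolding grow1_def by auto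
  with p have "v # p = (v # X) @ w # P \<and> grow (w # P) (v # p)"
    by auto
  then show ?case by blast
qed

lemma gap_Cons_le: "gap (set (v # p)) \<le> gap (set p) + 1"
proof -
  have "card (Nout (set p)) \<le> card (Nout (set (v # p)))"
    by (intro card_mono finite_Nout Nout_mono) auto
  moreover have "card (set (v # p)) \<le> card (set p) + 1"
    by (simp add: card_insert_if)
  ultimately show ?thesis
    by (simp add: gap_def)
qed

lemma reach_gap_le: "reach P thr p \<Longrightarrow> gap (set P) < thr \<Longrightarrow> gap (set p) \<le> thr"
proof (induction rule: reach.induct)
  case (reach_start w)
  then show ?case
    using gap_Cons_le[of w P] by linarith
next
  case (reach_step p u v)
  then show ?case
    using gap_Cons_le[of v p] by linarith
qed

text \<open>Adding one vertex increases the gap by at most one, so the search stops at gap exactly \<open>thr\<close>.\<close>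
lemma reach_length_le:
  assumes "reach P (gap (set P) + int g) (X @ P)" "feasible (X @ P)" "1 \<le> g"
  shows "length X \<le> g + B"
proof -
  have "gap (set (X @ P)) \<le> gap (set P) + int g"
    using reach_gap_le[OF assms(1)] assms(3) by simp
  moreover have "card (set (X @ P)) = length X + length P" "card (set P) = length P"
    using assms(2) by (auto simp: feasible_def distinct_card simp flip: set_append)
  moreover have "card (Nout (set (X @ P))) \<le> B"
    using assms(2) by (auto simp: feasible_def)
  ultimately show ?thesis
    by (simp add: gap_def)
qed

lemma grow_step:
  assumes "grow p Q" "p \<noteq> Q"
  obtains u v where "u \<in> Nout (set p)" "v \<in> nb u" "v \<notin> set p" "grow (v # p) Q" "length p < length Q"
proof -
  obtain y where y: "grow1 p y" "grow y Q"
    using assms by (metis converse_rtranclpE)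
  then obtain u v where "y = v # p" "v \<notin> set p" "u \<in> Nout (set p)" "v \<in> nb u"
    by (auto simp: grow1_def)
  with y grow_append[OF y(2)] show thesis
    by (intro that[of u v]) auto
qed

text \<open>Either \<open>P\<close> still falls short of the witness \<open>K\<close>, or it equals
  \<open>K\<close>, and then the gap of \<open>P\<close> itself has paid for the label.\<close>

lemma good_cases:
  assumes "good P h"
  obtains (grow) u v where "u \<in> Nout (set P)" "v \<in> nb u" "good (v # P) h"
  | (start) J where "distinct P" "set P \<subseteq> J" "solution J" "int h \<le> gap (set P)"
proof -
  obtain K J where K: "grow P K" "distinct K" "set K \<subseteq> J" "solution J" "int h \<le> gap (set K)"
    using assms by (auto simp: good_def)
  show thesis
  proof (cases "P = K")
    case True
    with K show ?thesis
      using start by blast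
  next
    case False
    with K grow_step[OF K(1) False] show ?thesis
      using grow unfolding good_def by metis
  qed
qed

lemma good_length_less:
  assumes "good P h" "gap (set P) < int d"
  shows "length P < A"
proof -
  obtain K J where K: "grow P K" "distinct K" "set K \<subseteq> J" "solution J"
    using assms by (auto simp: good_def)
  obtain Z where Z: "K = Z @ P"
    using grow_append[OF K(1)] by blast
  have fJ: "finite J"
    using K(4) finite_sub_S by (auto simp: solution_def)
  have "set P \<subset> J"
    using K Z assms(2) by (auto simp: solution_def)
  then have "card (set P) < card J"
    using fJ psubset_card_mono by blast
  then show ?thesis
    using K Z by (simp add: distinct_card solution_def)
qed

text \<open>\<open>Q\<close> spells out \<open>P\<close> and a component of smallest gain. A set X
  missing the closed neighbourhood condition can replace that component: it gains as much, and being
  no longer than \<open>Q\<close> allows it keeps the size bound.\<close>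

lemma exchange:
  assumes P: "distinct P" "set P \<subseteq> J0" and J0: "solution J0"
    and h: "int h \<le> gap (set P)" and less: "gap (set P) < int d"
  obtains g Q where "1 \<le> g" "h + g \<le> d" "target P (gap (set P) + int g) Q"
    "\<And>X. reach P (gap (set P) + int g) (X @ P) \<Longrightarrow> feasible (X @ P) \<Longrightarrow>
       gap (set P) + int g \<le> gap (set (X @ P)) \<Longrightarrow> length (X @ P) \<le> length Q \<Longrightarrow>
       \<exists>v\<in>set (closed_nbs X). good (v # P) (h + g)"
proof -
  define I where "I = set P"
  \<comment> \<open>Least size forces every remaining component to have positive gain.\<close>
  obtain J where J: "solution J" "I \<subseteq> J"
    and Jmin: "\<And>J'. solution J' \<Longrightarrow> I \<subseteq> J' \<Longrightarrow> card J \<le> card J'"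
    using ex_has_least_nat[of "\<lambda>J. solution J \<and> I \<subseteq> J" J0 card] J0 P(2) unfolding I_def by blast
  have JS: "J \<subseteq> S" and iJ: "indep J" and cJ: "card J \<le> A" and gJ: "int d \<le> gap J"
    using J(1) by (auto simp: solution_def)
  have fJ: "finite J" and fI: "finite I"
    using JS finite_sub_S I_def by auto
  \<comment> \<open>Sharing an outer neighbour of \<open>I\<close> creates no link: such vertices
    are free once \<open>I\<close> is chosen, so gains over \<open>I\<close> are additive over
    components.\<close>
  define rel where "rel x y \<longleftrightarrow> x \<in> J - I \<and> y \<in> J - I \<and> (\<exists>u. u \<in> nb x \<and> u \<in> nb y \<and> u \<notin> S \<and> u \<notin> Nout I)"
    for x y
  define comp where "comp x = {y. rel\<^sup>*\<^sup>* x y}" for x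
  have comp_sub: "comp x \<subseteq> J - I" if "x \<in> J - I" for x
  proof
    fix y assume "y \<in> comp x"
    then have "rel\<^sup>*\<^sup>* x y" by (simp add: comp_def)
    then show "y \<in> J - I"
      by (induction rule: rtranclp_induct) (use that in \<open>auto simp: rel_def\<close>)
  qed
  have comp_self: "x \<in> comp x" for x
    by (simp add: comp_def)
  have comp_closed: "z \<in> comp x" if "y \<in> comp x" "rel y z" for x y z
    using that by (auto simp: comp_def intro: rtranclp.rtrancl_into_rtrancl)
  \<comment> \<open>Distinct components have no outer neighbour in common outside
    \<open>Nout I\<close>.\<close>
  have gap_drop: "gap J = gap (J - comp x) + (gap (I \<union> comp x) - gap I)" if x: "x \<in> J - I" for x
  proof -
    let ?W = "comp x"
    have W: "?W \<subseteq> J - I"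
      using comp_sub[OF x] .
    have fW: "finite ?W"
      using W fJ finite_subset by blast
    have "Nout ?W - Nout (J - ?W) = Nout ?W - Nout I"
    proof
      show "Nout ?W - Nout (J - ?W) \<subseteq> Nout ?W - Nout I"
        using Nout_mono[of I "J - ?W"] W J(2) by blast
      show "Nout ?W - Nout I \<subseteq> Nout ?W - Nout (J - ?W)"
      proof
        fix u assume u: "u \<in> Nout ?W - Nout I"
        then obtain w where w: "w \<in> ?W" "u \<in> nb w" "u \<notin> S"
          by (auto simp: Nout_def)
        have "u \<notin> Nout (J - ?W)"
        proof
          assume "u \<in> Nout (J - ?W)"
          then obtain y where y: "y \<in> J" "y \<notin> ?W" "u \<in> nb y"
            by (auto simp: Nout_def)
          moreover have "y \<notin> I"
            using u y(3) w(3) by (auto simp: Nout_def)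
          ultimately have "rel w y"
            using w W u by (auto simp: rel_def)
          then show False
            using comp_closed w(1) y(2) by blast
        qed
        then show "u \<in> Nout ?W - Nout (J - ?W)"
          using u by blast
      qed
    qed
    moreover have "gap ((J - ?W) \<union> ?W) = gap (J - ?W) + int (card ?W) - int (card (Nout ?W - Nout (J - ?W)))"
      by (rule gap_Un) (use fJ fW in auto)
    moreover have "(J - ?W) \<union> ?W = J"
      using W by blast
    moreover have "gap (I \<union> ?W) = gap I + int (card ?W) - int (card (Nout ?W - Nout I))"
      by (rule gap_Un) (use fI fW W in auto)
    ultimately show ?thesis
      by simp
  qed
  have indep_sub: "indep Y" if "Y \<subseteq> J" for Y
    using that iJ by (auto simp: indep_def)
  \<comment> \<open>Otherwise deleting the component would give a smaller solution containing
    \<open>I\<close>.\<close>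
  have comp_pos: "gap I < gap (I \<union> comp x)" if x: "x \<in> J - I" for x
  proof (rule ccontr)
    assume "\<not> ?thesis"
    then have "int d \<le> gap (J - comp x)"
      using gap_drop[OF x] gJ by simp
    moreover have "card (J - comp x) < card J"
      using x comp_self fJ by (intro psubset_card_mono) auto
    ultimately have "solution (J - comp x)"
      using JS cJ indep_sub by (auto simp: solution_def)
    moreover have "I \<subseteq> J - comp x"
      using comp_sub[OF x] J(2) by blast
    ultimately show False
      using Jmin \<open>card (J - comp x) < card J\<close> by fastforce
  qed
  \<comment> \<open>A longest growth inside \<open>I \<union> comp v\<close> exhausts it: the first
    link leading out of the list would supply another vertex to append.\<close>
  have grow_comp: "\<exists>K. grow (v # P) K \<and> distinct K \<and> set K = I \<union> comp v" if v: "v \<in> J - I" for v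
  proof -
    let ?G = "\<lambda>K. grow (v # P) K \<and> distinct K \<and> set K \<subseteq> I \<union> comp v"
    have fin: "finite (I \<union> comp v)"
      using comp_sub[OF v] fJ fI finite_subset by blast
    have "?G (v # P)"
      using v P comp_self by (auto simp: I_def)
    moreover have "\<forall>K. ?G K \<longrightarrow> length K < Suc (card (I \<union> comp v))"
      using fin by (metis card_mono distinct_card le_imp_less_Suc)
    ultimately obtain K where K: "?G K" and Kmax: "\<And>K'. ?G K' \<Longrightarrow> length K' \<le> length K"
      using ex_has_greatest_nat[of ?G "v # P" length "Suc (card (I \<union> comp v))"] by auto
    obtain Z where Z: "K = Z @ v # P"
      using K grow_append by blast
    have "y \<in> set K" if "rel\<^sup>*\<^sup>* v y" for y
      using that
    proof (induction rule: rtranclp_induct)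
      case base
      then show ?case using Z by simp
    next
      case (step y z)
      show ?case
      proof (rule ccontr)
        assume z: "z \<notin> set K"
        obtain u where u: "u \<in> nb y" "u \<in> nb z" "u \<notin> S"
          using step.hyps(2) by (auto simp: rel_def)
        have "u \<in> Nout (set K)"
          using u step.IH by (auto simp: Nout_def)
        then have "grow1 K (z # K)"
          using z u(2) nb_sym unfolding grow1_def by blast
        moreover have "z \<in> comp v"
          using step.hyps by (auto simp: comp_def)
        ultimately have "?G (z # K)"
          using K z by auto
        then show False
          using Kmax by fastforce
      qed
    qed
    then have "set K = I \<union> comp v"
      using K Z by (auto simp: I_def comp_def)
    with K show ?thesis by blast
  qed
  have "J - I \<noteq> {}"
  proof
    assume "J - I = {}"
    with J(2) have "J = I" by blast
    with gJ less show False by (simp add: I_def)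
  qed
  then obtain x0 where "x0 \<in> J - I" by blast
  then obtain x where x: "x \<in> J - I"
    and xmin: "\<And>y. y \<in> J - I \<Longrightarrow> nat (gap (I \<union> comp x) - gap I) \<le> nat (gap (I \<union> comp y) - gap I)"
    using ex_has_least_nat[of "\<lambda>x. x \<in> J - I" x0 "\<lambda>x. nat (gap (I \<union> comp x) - gap I)"] by blast
  define g0 where "g0 = nat (gap (I \<union> comp x) - gap I)"
  \<comment> \<open>Truncation keeps labels at most \<open>d\<close>, even if a component gains more
    than is still missing.\<close>
  define g where "g = min g0 (d - h)"
  have g0: "int g0 = gap (I \<union> comp x) - gap I" "1 \<le> g0"
    using comp_pos[OF x] by (auto simp: g0_def)
  have hd: "h < d"
    using h less by linarith
  have g: "1 \<le> g" "h + g \<le> d" "g \<le> g0"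
    using g0 hd by (auto simp: g_def)
  obtain Q where Q: "grow (x # P) Q" "distinct Q" "set Q = I \<union> comp x"
    using grow_comp[OF x] by blast
  have QJ: "set Q \<subseteq> J"
    using Q(3) J(2) comp_sub[OF x] by auto
  have xn: "x < n"
    using x JS S_subset by auto
  have tgt: "target P (gap (set P) + int g) Q"
    unfolding target_def using Q xn solution_feasible[OF J(1) Q(2) QJ] g0 g(3)
    by (auto simp: I_def)
  have hit: "\<exists>v\<in>set (closed_nbs X). good (v # P) (h + g)"
    if X: "reach P (gap (set P) + int g) (X @ P)" "feasible (X @ P)"
      "gap (set P) + int g \<le> gap (set (X @ P))" "length (X @ P) \<le> length Q" for X
  proof (cases "\<exists>v\<in>set (closed_nbs X). v \<in> J - I")
    case True
    \<comment> \<open>The component of \<open>v\<close> can be started at \<open>v\<close>, and it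
      gains at least \<open>g\<close> by the minimal choice of \<open>x\<close>.\<close>
    then obtain v where v: "v \<in> set (closed_nbs X)" "v \<in> J - I" by blast
    obtain K where K: "grow (v # P) K" "distinct K" "set K = I \<union> comp v"
      using grow_comp[OF v(2)] by blast
    have "int g0 \<le> gap (set K) - gap I"
      using xmin[OF v(2)] g0 unfolding K(3) g0_def by linarith
    then have "int (h + g) \<le> gap (set K)"
      using g(3) h by (simp add: I_def)
    moreover have "set K \<subseteq> J"
      using K(3) J(2) comp_sub[OF v(2)] by auto
    ultimately have "good (v # P) (h + g)"
      using K(1,2) J(1) unfolding good_def by blast
    with v(1) show ?thesis by blast
  next
    case False
    let ?X = "set X"
    have XS: "?X \<subseteq> S" and dX: "distinct (X @ P)" and iX: "indep (?X \<union> I)"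
      using X(2) by (auto simp: feasible_def I_def)
    have Xn: "?X \<subseteq> {..<n}"
      using XS S_subset by blast
    have disj: "I \<inter> ?X = {}"
      using dX by (auto simp: I_def)
    have noadj: "v \<notin> nb y" if "v \<in> J - I" "y \<in> ?X" for v y
      using False that set_closed_nbs[OF Xn] by auto
    have XJ: "?X \<inter> J = {}"
      using False set_closed_nbs[OF Xn] disj by auto
    obtain X' w where w: "X @ P = X' @ w # P" "grow (w # P) (X @ P)"
      using reach_grow[OF X(1,2)] by blast
    then have Xw: "X = X' @ [w]"
      by simp
    have gX: "gap (I \<union> ?X) = gap I + int (card ?X) - int (card (Nout ?X - Nout I))"
      by (rule gap_Un) (use fI disj in auto)
    have gX': "gap I + int g \<le> gap (I \<union> ?X)"
      using X(3) by (simp add: I_def Un_commute)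
    have cX: "card ?X \<le> card (comp x)"
    proof -
      have "length Q = card (I \<union> comp x)"
        using Q by (metis distinct_card)
      also have "\<dots> = card I + card (comp x)"
        using comp_sub[OF x] fI fJ by (intro card_Un_disjoint) (auto intro: finite_subset)
      also have "card I = length P"
        using P(1) by (simp add: I_def distinct_card)
      finally show ?thesis
        using X(4) dX by (simp add: distinct_card)
    qed
    have cI: "card I + card (comp x) \<le> card J"
      using comp_sub[OF x] fJ fI J(2)
      by (subst card_Un_disjoint[symmetric]) (auto intro!: card_mono intro: finite_subset)
    have "\<exists>J'. I \<union> ?X \<subseteq> J' \<and> solution J'"
    proof (cases "g = g0")
      \<comment> \<open>The component of \<open>x\<close> is replaced by \<open>X\<close>; no vertex
        of \<open>X\<close> is adjacent to one of \<open>J\<close>.\<close>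
      case True
      let ?W = "comp x"
      let ?J = "(J - ?W) \<union> ?X"
      have IW: "I \<subseteq> J - ?W"
        using comp_sub[OF x] J(2) by blast
      have "gap ?J = gap (J - ?W) + int (card ?X) - int (card (Nout ?X - Nout (J - ?W)))"
        by (rule gap_Un) (use fJ XJ in auto)
      moreover have "card (Nout ?X - Nout (J - ?W)) \<le> card (Nout ?X - Nout I)"
        using Nout_mono[OF IW] by (intro card_mono) (auto simp: finite_Nout)
      ultimately have "gap J \<le> gap ?J"
        using gX gX' gap_drop[OF x] g0 True by simp
      moreover have "indep ?J"
      proof -
        have "y \<notin> nb z" if "z \<in> J" "y \<in> ?X" for y z
        proof (cases "z \<in> I")
          case True
          then show ?thesis using iX that(2) by (auto simp: indep_def)
        next
          case False
          then show ?thesis using noadj that nb_sym by blast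
        qed
        then have "\<And>y z. z \<in> J \<Longrightarrow> y \<in> ?X \<Longrightarrow> y \<notin> nb z \<and> z \<notin> nb y"
          using nb_sym by blast
        then show ?thesis
          using iX iJ unfolding indep_def by blast
      qed
      moreover have "card ?J \<le> card J"
      proof -
        have "card ?J \<le> card (J - ?W) + card ?X"
          by (rule card_Un_le)
        also have "\<dots> \<le> card (J - ?W) + card ?W"
          using cX by simp
        also have "\<dots> = card J"
          using comp_sub[OF x] fJ
          by (metis Diff_subset card_Diff_subset card_mono dual_order.trans finite_subset le_add_diff_inverse2)
        finally show ?thesis .
      qed
      ultimately have "solution ?J"
        using JS XS cJ gJ by (auto simp: solution_def)
      then show ?thesis
        using IW by blast
    next
      \<comment> \<open>The guess was truncated, so \<open>I\<close> together with \<open>X\<close>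
        already has gap \<open>d\<close>.\<close>
      case False
      then have "g = d - h"
        by (auto simp: g_def min_def split: if_splits)
      then have "int d \<le> gap (I \<union> ?X)"
        using gX' h hd by (simp add: I_def)
      moreover have "card (I \<union> ?X) \<le> A"
        using card_Un_le[of I ?X] cX cI cJ by linarith
      ultimately have "solution (I \<union> ?X)"
        using iX XS J(2) JS by (auto simp: solution_def Un_commute)
      then show ?thesis by blast
    qed
    then obtain J' where J': "I \<union> ?X \<subseteq> J'" "solution J'" by blast
    have "int (h + g) \<le> gap (set (X @ P))"
      using X(3) h by simp
    \<comment> \<open>The completed set is \<open>X @ P\<close> itself, grown from the first vertex
      \<open>w\<close> of \<open>X\<close>.\<close>
    then have "good (w # P) (h + g)"
      unfolding good_def using w(2) dX J' by (intro exI[of _ "X @ P"] exI[of _ J']) (auto simp: I_def)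
    moreover have "w \<in> set (closed_nbs X)"
      using set_closed_nbs[OF Xn] Xw by auto
    ultimately show ?thesis by blast
  qed
  show thesis
    by (rule that[OF g(1,2) tgt hit])
qed


section \<open>Evaluating a node\<close>

text \<open>The state consists of the marked vertices, the list of distinct vertices of \<open>Nout\<close> found so far
  and a counter that is positive iff an infeasibility has been found.\<close>
fun scan :: "nat \<Rightarrow> nat set \<times> nat list \<times> nat \<Rightarrow> nat set \<times> nat list \<times> nat" where
  "scan u (Mk, L, b) =
     (if u \<notin> Mk \<and> u \<notin> S then (insert u Mk, L @ [u], b)
      else (Mk, L, b + of_bool (u \<in> Mk \<and> u \<in> S)))"

fun visit :: "nat \<Rightarrow> nat set \<times> nat list \<times> nat \<Rightarrow> nat set \<times> nat list \<times> nat" where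
  "visit v (Mk, L, b) =
     fold scan (adj ! v) (insert v Mk, L, b + of_bool (v \<in> Mk) + of_bool (v \<notin> S))"

definition eval_path :: "nat list \<Rightarrow> nat set \<times> nat list \<times> nat" where
  "eval_path P = fold visit P ({}, [], 0)"

lemma fold_scan:
  "fold scan us (Mk, L, b) = (Mk', L', b') \<Longrightarrow>
     Mk' = Mk \<union> (set us - S) \<and>
     (\<exists>L2. L' = L @ L2 \<and> distinct L2 \<and> set L2 = set us - S - Mk) \<and>
     (b' = 0 \<longleftrightarrow> b = 0 \<and> set us \<inter> S \<inter> Mk = {})"
proof (induction us arbitrary: Mk L b)
  case Nil
  then show ?case by auto
next
  case (Cons u us)
  show ?case
  proof (cases "u \<notin> Mk \<and> u \<notin> S")
    case True
    then have "fold scan us (insert u Mk, L @ [u], b) = (Mk', L', b')"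
      using Cons.prems by simp
    from Cons.IH[OF this] obtain L2 where
      "Mk' = insert u Mk \<union> (set us - S)" "L' = L @ u # L2" "distinct L2"
      "set L2 = set us - S - insert u Mk" "b' = 0 \<longleftrightarrow> b = 0 \<and> set us \<inter> S \<inter> insert u Mk = {}"
      by auto
    with True show ?thesis
      by (intro conjI exI[of _ "u # L2"]) auto
  next
    case False
    then have "fold scan us (Mk, L, b + of_bool (u \<in> Mk \<and> u \<in> S)) = (Mk', L', b')"
      using Cons.prems by auto
    from Cons.IH[OF this] False show ?thesis
      by auto
  qed
qed

text \<open>One set of marks has two uses: while the counter is zero, a marked vertex of
  \<open>S\<close> is on the list and a marked vertex outside \<open>S\<close> is a recorded outer
  neighbour. Checking each vertex against earlier ones suffices since adjacency is
  symmetric.\<close>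

lemma eval_path_spec:
  "set P \<subseteq> {..<n} \<Longrightarrow> eval_path P = (Mk, L, b) \<Longrightarrow>
     Mk = set P \<union> Nout (set P) \<and>
     (b = 0 \<longleftrightarrow> distinct P \<and> set P \<subseteq> S \<and> indep (set P)) \<and>
     (b = 0 \<longrightarrow> distinct L \<and> set L = Nout (set P))"
proof (induction P arbitrary: Mk L b rule: rev_induct)
  case Nil
  then show ?case by (auto simp: eval_path_def Nout_def indep_def)
next
  case (snoc v P)
  obtain Mk1 L1 b1 where 1: "eval_path P = (Mk1, L1, b1)"
    by (metis prod_cases3)
  have v: "v < n" "set P \<subseteq> {..<n}"
    using snoc.prems by auto
  note IH = snoc.IH[OF v(2) 1]
  have "fold scan (adj ! v) (insert v Mk1, L1, b1 + of_bool (v \<in> Mk1) + of_bool (v \<notin> S)) = (Mk, L, b)"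
    using snoc.prems(2) 1 by (simp add: eval_path_def)
  from fold_scan[OF this] obtain L2 where 2:
    "Mk = insert v Mk1 \<union> (nb v - S)" "L = L1 @ L2" "distinct L2"
    "set L2 = nb v - S - insert v Mk1"
    "b = 0 \<longleftrightarrow> b1 = 0 \<and> v \<notin> Mk1 \<and> v \<in> S \<and> nb v \<inter> S \<inter> insert v Mk1 = {}"
    using set_adj[OF v(1)] by auto
  have Nv: "Nout (set (P @ [v])) = Nout (set P) \<union> (nb v - S)"
    by (auto simp: Nout_def)
  have "Mk = set (P @ [v]) \<union> Nout (set (P @ [v]))"
    using 2(1) IH Nv by auto
  moreover have b: "b = 0 \<longleftrightarrow> distinct (P @ [v]) \<and> set (P @ [v]) \<subseteq> S \<and> indep (set (P @ [v]))"
  proof -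
    have "indep (set (P @ [v])) \<longleftrightarrow> indep (set P) \<and> nb v \<inter> set P = {}"
      using nb_sym nb_lt unfolding indep_def by auto
    moreover have "v \<notin> Mk1 \<longleftrightarrow> v \<notin> set P" if "v \<in> S"
      using IH that by (auto simp: Nout_def)
    moreover have "nb v \<inter> S \<inter> insert v Mk1 = nb v \<inter> set P" if "set P \<subseteq> S"
      using IH that nb_lt by (auto simp: Nout_def)
    moreover have "b1 = 0 \<longleftrightarrow> distinct P \<and> set P \<subseteq> S \<and> indep (set P)"
      using IH by blast
    ultimately show ?thesis
      unfolding 2(5) by (cases "set P \<subseteq> S"; cases "v \<in> S") auto
  qed
  moreover have "distinct L \<and> set L = Nout (set (P @ [v]))" if "b = 0"
  proof -
    have "b1 = 0" "set P \<subseteq> S" "v \<in> S"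
      using that b 2(5) IH by auto
    then have "distinct L1" "set L1 = Nout (set P)" "set L2 = nb v - S - Nout (set P)"
      using IH 2(4) by auto
    with 2(2,3) Nv show ?thesis by auto
  qed
  ultimately show ?case by blast
qed

definition out_list :: "nat list \<Rightarrow> nat list" where
  "out_list P = fst (snd (eval_path P))"

text \<open>Adding the truncated excess over \<open>B\<close> to the counter reduces feasibility to
  a single test against zero.\<close>

lemma eval_path_feasible:
  assumes "set P \<subseteq> {..<n}"
  shows "feasible P \<longleftrightarrow> snd (snd (eval_path P)) + (length (out_list P) - B) = 0"
    and "feasible P \<Longrightarrow> distinct (out_list P)"
    and "feasible P \<Longrightarrow> set (out_list P) = Nout (set P)"
    and "feasible P \<Longrightarrow> length (out_list P) = card (Nout (set P))"
proof -
  obtain Mk L b where 1: "eval_path P = (Mk, L, b)"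
    by (metis prod_cases3)
  note s = eval_path_spec[OF assms 1]
  then show "feasible P \<longleftrightarrow> snd (snd (eval_path P)) + (length (out_list P) - B) = 0"
    using 1 distinct_card[of L] by (auto simp: feasible_def out_list_def)
  assume "feasible P"
  with s have "b = 0" by (auto simp: feasible_def)
  with s 1 show "distinct (out_list P)" "set (out_list P) = Nout (set P)" "length (out_list P) = card (Nout (set P))"
    by (auto simp: out_list_def distinct_card[symmetric])
qed

lemma feasible_gap: "set P \<subseteq> {..<n} \<Longrightarrow> feasible P \<Longrightarrow> gap (set P) = int (length P) - int (length (out_list P))"
  by (simp add: gap_def eval_path_feasible feasible_def distinct_card)

section \<open>Memory layout and the evaluation code\<close>

definition offset :: "nat \<Rightarrow> nat" where
  "offset v = length (concat (take v adj))"

definition input_ok :: "(nat \<Rightarrow> nat \<Rightarrow> nat) \<Rightarrow> bool" where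
  "input_ok M \<longleftrightarrow> (\<forall>v\<le>n. M 0 v = offset v) \<and>
     (\<forall>v<n. \<forall>i<length (adj ! v). M (Suc 0) (offset v + i) = adj ! v ! i) \<and>
     (\<forall>v<n. M 2 v = of_bool (v \<in> S))"

lemma offset_Suc: "v < n \<Longrightarrow> offset (Suc v) = offset v + length (adj ! v)"
  by (simp add: offset_def take_Suc_conv_app_nth)

lemma input_ok_input_arrays: "input_ok (input_arrays adj S)"
proof -
  have "concat adj ! (offset v + i) = adj ! v ! i \<and> offset v + i < length (concat adj)"
    if "v < n" "i < length (adj ! v)" for v i
  proof -
    have "concat adj = concat (take v adj) @ adj ! v @ concat (drop (Suc v) adj)"
      using that by (metis concat.simps(2) concat_append id_take_nth_drop)
    with that show ?thesis
      by (auto simp: offset_def nth_append)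
  qed
  then show ?thesis
    by (auto simp: input_ok_def input_arrays_def nth_default_def offset_def nth_append)
qed

text \<open>Since no entry exceeds the stamp, the truncated difference \<open>ts - M 6 u\<close>
  vanishes exactly for marked vertices; the machine tests just that.\<close>

definition ev_state :: "nat \<Rightarrow> (nat \<Rightarrow> nat) \<Rightarrow> (nat \<Rightarrow> nat \<Rightarrow> nat) \<Rightarrow> nat set \<times> nat list \<times> nat \<Rightarrow> bool" where
  "ev_state ts R M = (\<lambda>(Mk, L, b).
     (\<forall>u<n. M 6 u = ts \<longleftrightarrow> u \<in> Mk) \<and> (\<forall>u. M 6 u \<le> ts) \<and>
     R 23 = length L \<and> (\<forall>i<length L. M 7 i = L ! i) \<and> R 24 = b \<and> R 9 = ts \<and> R 3 = 1)"

lemma ev_state_upd: "r \<notin> {3, 9, 23, 24} \<Longrightarrow> ev_state ts (R(r := y)) M a = ev_state ts R M a"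
  by (simp add: ev_state_def)

end

text \<open>
  Register usage: 0 \<open>n\<close>, 2 \<open>d\<close>, 3 the constant 1, 4 \<open>A\<close>, 5 \<open>B\<close>, 6 number of tree nodes, 7 current
  node, 8 result, 9 time stamp, 10 label \<open>h\<close> of the current node, 11 and 12 its length and number of
  outer neighbours, 13 label of the nodes to be created, 14 head of the breadth-first queue, 15 saved
  value of register 6, 16 and 17 node and length of the set \<open>X\<close> found, 18 \<open>d + 1\<close>, 19 node to be
  evaluated, 20 and 21 parent and label of new nodes, 22 to 24 length, number of outer neighbours and
  infeasibility counter of the evaluated node; registers from 25 on are scratch.

  Array usage: 3, 4, 5 hold the parent, the last vertex and the label of each tree node, 7 holds a
  list of vertices, and 6 holds marks. A vertex is marked iff its entry equals the time stamp, so
  that increasing the time stamp erases all marks in constant time.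
\<close>
definition scan_com :: com where
  "scan_com = While [Sub 36 34 33] 36
     (Blk [Load 35 1 33, Load 36 6 35, Sub 36 9 36, Load 37 2 35, Sub 38 37 36, Add 24 24 38,
           Sub 38 3 36, Add 38 38 37, Add 33 33 3] ;;
      Cond [] 38 (Blk []) (Blk [Store 6 35 9, Store 7 23 35, Add 23 23 3]))"

definition eval_com :: com where
  "eval_com =
     Blk [Add 9 9 3, Const 22 0, Const 23 0, Const 24 0, Copy 31 19] ;;
     While [] 31
       (Blk [Load 32 4 31, Load 33 6 32, Sub 33 9 33, Sub 33 3 33, Add 24 24 33,
             Load 33 2 32, Sub 33 3 33, Add 24 24 33, Store 6 32 9, Add 22 22 3,
             Load 33 0 32, Add 34 32 3, Load 34 0 34] ;;
        scan_com ;;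
        Blk [Load 31 3 31]) ;;
     Blk [Sub 36 23 5, Add 24 24 36]"

context vc_instance
begin

lemma scan_com:
  assumes input_ok: "input_ok M" and ev: "ev_state ts R M a"
    and us: "R 33 + length us = R 34" "\<forall>i<length us. M 1 (R 33 + i) = us ! i" "set us \<subseteq> {..<n}"
  shows "hoare scan_com (R, M) (20 * length us + 2)
    (\<lambda>R' M'. ev_state ts R' M' (fold scan us a) \<and>
       (\<forall>r. r \<notin> {23, 24, 33, 35, 36, 37, 38} \<longrightarrow> R' r = R r) \<and> (\<forall>i. i \<noteq> 6 \<and> i \<noteq> 7 \<longrightarrow> M' i = M i))"
proof -
  define Inv where "Inv = (\<lambda>(us', a') R' M'.
     fold scan us' a' = fold scan us a \<and> ev_state ts R' M' a' \<and>
     R' 33 + length us' = R' 34 \<and> (\<forall>i<length us'. M' 1 (R' 33 + i) = us' ! i) \<and> set us' \<subseteq> {..<n} \<and>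
     (\<forall>r. r \<notin> {23, 24, 33, 35, 36, 37, 38} \<longrightarrow> R' r = R r) \<and> (\<forall>i. i \<noteq> 6 \<and> i \<noteq> 7 \<longrightarrow> M' i = M i))"
  have S2: "M 2 v = of_bool (v \<in> S)" if "v < n" for v
    using input_ok that by (simp add: input_ok_def)
  show ?thesis
    unfolding scan_com_def
  proof (rule hoare_While[where Inv = Inv and x = "(us, a)" and pot = "\<lambda>(us, a). 20 * length us + 2"],
      goal_cases)
    case 2
    show ?case using ev us by (simp add: Inv_def)
  next
    case (3 x R' M')
    obtain us' a' where x: "x = (us', a')"
      by (cases x)
    have "R' 33 + length us' = R' 34" "R' 34 \<le> R' 33"
      using 3 by (simp_all add: Inv_def x)
    then have "us' = []"
      by (metis add_le_same_cancel1 le_zero_eq length_0_conv)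
    with 3(1) show ?case by (auto simp: Inv_def x ev_state_def)
  next
    case (4 x R' M')
    obtain us' Mk L b where x: "x = (us', Mk, L, b)"
      by (metis prod_cases4)
    have "us' \<noteq> []"
      using 4 by (auto simp: Inv_def x)
    then obtain u us2 where us': "us' = u # us2"
      by (cases us') auto
    have u: "M' (Suc 0) (R' 33) = u" "u < n"
      using 4(1) by (auto simp: Inv_def x us')
    have us2: "\<forall>i<length us2. M' (Suc 0) (Suc (R' 33 + i)) = us2 ! i"
      using 4(1) by (auto simp: Inv_def x us')
    have ev': "ev_state ts R' M' (Mk, L, b)"
      using 4(1) by (auto simp: Inv_def x)
    have M2: "M' 2 u = of_bool (u \<in> S)"
      using 4(1) S2[OF u(2)] by (auto simp: Inv_def x)
    have mk: "M' 6 u = ts \<longleftrightarrow> u \<in> Mk" "M' 6 u \<le> ts" "R' 9 = ts" "R' 3 = 1"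
      using ev' u(2) by (auto simp: ev_state_def)
    have mkz: "ts - M' 6 u = 0 \<longleftrightarrow> u \<in> Mk"
      using mk by auto
    show ?case
    proof (rule exI[of _ 14], rule hoare_Blk_Seq[where T = 5], goal_cases)
      case (2 R1 M1)
      then have R1: "R1 = R'(35 := u, 36 := ts - M' 6 u, 37 := M' 2 u, 24 := b + (M' 2 u - (ts - M' 6 u)),
          38 := 1 - (ts - M' 6 u) + M' 2 u, 33 := Suc (R' 33))" and M1: "M1 = M'"
        using u mk ev' by (auto simp: ev_state_def)
      have next_inv: "Inv (us2, scan u (Mk, L, b)) R2 M2 \<Longrightarrow>
          \<exists>y. Inv y R2 M2 \<and> length [Sub 36 34 33] + 2 + 14 + (case y of (us, a) \<Rightarrow> 20 * length us + 2)
            \<le> (case x of (us, a) \<Rightarrow> 20 * length us + 2)" for R2 M2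
        by (rule exI) (auto simp: x us')
      \<comment> \<open>Truncated subtraction acts as logic: taking the difference, zero iff
        \<open>u\<close> is marked, from the 0/1 entry for \<open>S\<close> yields a
        conjunction.\<close>
      have bad: "M' 2 u - (ts - M' 6 u) = of_bool (u \<in> Mk \<and> u \<in> S)"
        using mkz M2 by (cases "u \<in> Mk"; cases "u \<in> S") auto
      have new: "1 - (ts - M' 6 u) + M' 2 u = 0 \<longleftrightarrow> u \<notin> Mk \<and> u \<notin> S"
        using mkz M2 by (cases "u \<in> Mk"; cases "u \<in> S") auto
      have I: "fold scan us2 (scan u (Mk, L, b)) = fold scan us a" "R' 33 + Suc (length us2) = R' 34"
        "set us2 \<subseteq> {..<n}" "\<forall>r. r \<notin> {23, 24, 33, 35, 36, 37, 38} \<longrightarrow> R' r = R r"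
        "\<forall>i. i \<noteq> 6 \<and> i \<noteq> 7 \<longrightarrow> M' i = M i"
        using 4(1) by (auto simp: Inv_def x us')
      show ?case
      proof (rule hoare_Cond[where T = 3], goal_cases)
        case (2 R2 M3)
        then have R2: "R2 = R1" "M3 = M'" and old: "\<not> (u \<notin> Mk \<and> u \<notin> S)"
          using new by (auto simp: R1 M1)
        have "ev_state ts R2 M3 (scan u (Mk, L, b))"
          using ev' old bad by (simp add: ev_state_def R2 R1)
        then have "Inv (us2, scan u (Mk, L, b)) R2 M3"
          using I us2 by (simp add: Inv_def R2 R1 del: scan.simps)
        then show ?case
          by (intro hoare_Blk next_inv) auto
      next
        case (3 R2 M3)
        then have R2: "R2 = R1" "M3 = M'" and old: "u \<notin> Mk \<and> u \<notin> S"
          using new by (auto simp: R1 M1)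
        show ?case
        proof (intro hoare_Blk next_inv, goal_cases)
          case (2 R4 M4)
          then have R4: "R4 = R1(23 := Suc (length L))" "M4 = M'(6 := (M' 6)(u := ts), 7 := (M' 7)(length L := u))"
            using ev' mk by (auto simp: R2 R1 ev_state_def)
          have "ev_state ts R4 M4 (scan u (Mk, L, b))"
            using ev' old bad by (auto simp: ev_state_def R4 R1 nth_append less_Suc_eq)
          then show ?case
            using I us2 by (simp add: Inv_def R4 R1 del: scan.simps)
        qed auto
      qed auto
    qed auto
  qed auto
qed

text \<open>Parents have smaller numbers, so writing beyond a node leaves its path intact.\<close>

primrec chain :: "(nat \<Rightarrow> nat \<Rightarrow> nat) \<Rightarrow> nat \<Rightarrow> nat list \<Rightarrow> bool" where
  "chain M x [] \<longleftrightarrow> x = 0"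
| "chain M x (v # P) \<longleftrightarrow> x \<noteq> 0 \<and> M 4 x = v \<and> M 3 x < x \<and> chain M (M 3 x) P"

lemma chain_cong:
  "chain M x P \<Longrightarrow> (\<And>i. i \<le> x \<Longrightarrow> M' 3 i = M 3 i \<and> M' 4 i = M 4 i) \<Longrightarrow> chain M' x P"
  by (induction P arbitrary: x) auto

lemma eval_com:
  assumes input_ok: "input_ok M" and R: "R 3 = 1" "R 5 = B" and mk: "\<forall>u. M 6 u \<le> R 9"
    and ch: "chain M (R 19) P" and P: "set P \<subseteq> {..<n}"
  shows "hoare eval_com (R, M) (20 * (length P + 1) * D)
    (\<lambda>R' M'. (\<forall>r<22. r \<noteq> 9 \<longrightarrow> R' r = R r) \<and> (\<forall>i. i \<noteq> 6 \<and> i \<noteq> 7 \<longrightarrow> M' i = M i) \<and>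
       (\<forall>u. M' 6 u \<le> R' 9) \<and> R' 22 = length P \<and> (R' 24 = 0 \<longleftrightarrow> feasible P) \<and>
       R' 23 = length (out_list P) \<and> (\<forall>i<length (out_list P). M' 7 i = out_list P ! i))"
proof -
  define ts where "ts = R 9 + 1"
  define Inv where "Inv = (\<lambda>(P', a) R' M'.
     fold visit P' a = eval_path P \<and> ev_state ts R' M' a \<and> chain M (R' 31) P' \<and> set P' \<subseteq> {..<n} \<and>
     R' 22 + length P' = length P \<and>
     (\<forall>r<22. r \<noteq> 9 \<longrightarrow> R' r = R r) \<and> (\<forall>i. i \<noteq> 6 \<and> i \<noteq> 7 \<longrightarrow> M' i = M i))"
  obtain Mk0 L0 b0 where e0: "eval_path P = (Mk0, L0, b0)"
    by (metis prod_cases3)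
  show ?thesis
    unfolding eval_com_def
  proof (rule hoare_Blk_Seq[where T = "20 * D * length P + 1 + 2"], goal_cases)
    case 1
    show ?case by simp
  next
    case 3
    show ?case using D_pos by (simp add: algebra_simps)
  next
    case (2 R1 M1)
    then have R1: "R1 = R(9 := ts, 22 := 0, 23 := 0, 24 := 0, 31 := R 19)" and M1: "M1 = M"
      using R by (auto simp: ts_def)
    show ?case
    proof (rule hoare_Seq[where Q = "Inv ([], eval_path P)" and T = "20 * D * length P + 1" and T' = 2], goal_cases)
      case 1
      show ?case
      proof (rule hoare_While[where Inv = Inv and x = "(P, {}, [], 0)" and pot = "\<lambda>(P', a). 20 * D * length P' + 1"],
          goal_cases)
        case 2
        \<comment> \<open>All stamps predate the increment, so evaluation starts without
          marks.\<close>
        have "M 6 u \<noteq> Suc (R 9)" "M 6 u \<le> Suc (R 9)" for u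
          using mk by (metis Suc_n_not_le_n, metis le_SucI)
        then show ?case
          using ch P R by (simp add: Inv_def R1 M1 eval_path_def ev_state_def ts_def)
      next
        case (3 x R' M')
        obtain P' a where x: "x = (P', a)" by (cases x)
        have "P' = []"
          using 3 by (cases P') (auto simp: Inv_def x)
        with 3 show ?case by (auto simp: Inv_def x)
      next
        case (4 x R' M')
        obtain P' Mk L b where x: "x = (P', Mk, L, b)"
          by (metis prod_cases4)
        have "P' \<noteq> []"
          using 4 by (auto simp: Inv_def x)
        then obtain v P2 where P': "P' = v # P2"
          by (cases P') auto
        have I: "fold visit P2 (visit v (Mk, L, b)) = eval_path P" "ev_state ts R' M' (Mk, L, b)"
          "chain M (R' 31) (v # P2)" "v < n" "set P2 \<subseteq> {..<n}" "R' 22 + Suc (length P2) = length P"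
          "\<forall>r<22. r \<noteq> 9 \<longrightarrow> R' r = R r" "\<forall>i. i \<noteq> 6 \<and> i \<noteq> 7 \<longrightarrow> M' i = M i"
          using 4(1) by (auto simp: Inv_def x P')
        have v: "M' 4 (R' 31) = v" and par: "chain M (M' 3 (R' 31)) P2"
          using I(3,8) by auto
        have ts: "R' 9 = ts" "R' 3 = 1" "M' 6 v \<le> ts" "M' 6 v = ts \<longleftrightarrow> v \<in> Mk" "R' 24 = b"
          using I(2,4) by (auto simp: ev_state_def)
        have M2: "M' 2 v = of_bool (v \<in> S)" "M' 0 v = offset v" "M' 0 (Suc v) = offset v + length (adj ! v)"
          using input_ok I(4,8) by (auto simp: input_ok_def offset_Suc)
        have bb: "1 - (ts - M' 6 v) = of_bool (v \<in> Mk)"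
          using ts(3,4) by (cases "v \<in> Mk") auto
        let ?a = "(insert v Mk, L, b + of_bool (v \<in> Mk) + of_bool (v \<notin> S))"
        have len: "20 * length (adj ! v) + 20 \<le> 20 * D"
          using length_adj_less[OF I(4)] by simp
        show ?case
        proof (rule exI[of _ "20 * length (adj ! v) + 16"], rule hoare_Blk_Seq[where T = "20 * length (adj ! v) + 3"],
            goal_cases)
          case (2 R1 M1)
          then have R1: "R1 = R'(32 := v, 24 := b + (1 - (ts - M' 6 v)) + (1 - M' 2 v), 22 := Suc (R' 22),
              33 := offset v, 34 := offset v + length (adj ! v))"
            and M1: "M1 = M'(6 := (M' 6)(v := ts))"
            using v ts M2 by (auto simp: fun_eq_iff)
          have ev1: "ev_state ts R1 M1 ?a"
            using I(2) ts(1,2,4,5) M2(1) bb by (auto simp: ev_state_def R1 M1 of_bool_def)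
          have inp1: "input_ok M1"
            using input_ok I(8) by (auto simp: input_ok_def M1)
          show ?case
          proof (rule hoare_Seq[OF scan_com[OF inp1 ev1, where us = "adj ! v"], where T' = 1], goal_cases)
            case (4 R2 M2)
            show ?case
            proof (rule hoare_Blk, goal_cases)
              case (2 R3 M3)
              have R3: "R3 = R2(31 := M' 3 (R' 31))" "M3 = M2"
                using 2 4 by (auto simp: R1 M1)
              have "Inv (P2, visit v (Mk, L, b)) R3 M3"
              proof -
                have "ev_state ts R3 M3 (visit v (Mk, L, b))"
                proof -
                  have "ev_state ts R2 M2 (visit v (Mk, L, b))"
                    using 4 by (simp only: visit.simps)
                  then show ?thesis
                    by (simp add: R3 ev_state_upd del: visit.simps)
                qed
                moreover have "\<forall>r<22. r \<noteq> 9 \<longrightarrow> R3 r = R r"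
                  using 4 I(7) by (auto simp: R3 R1)
                moreover have "R3 22 + length P2 = length P"
                  using 4 I(6) by (simp add: R3 R1)
                moreover have "\<forall>i. i \<noteq> 6 \<and> i \<noteq> 7 \<longrightarrow> M3 i = M i"
                  using 4 I(8) by (simp add: R3 M1)
                moreover have "R3 31 = M' 3 (R' 31)"
                  by (simp add: R3)
                ultimately show ?thesis
                  using I(1,5) par unfolding Inv_def by simp
              qed
              then show ?case
                using len by (intro exI[of _ "(P2, visit v (Mk, L, b))"]) (simp add: x P')
            qed auto
          next
            case 2
            show ?case using inp1 I(4) by (auto simp: R1 input_ok_def)
          qed (use adj_lt I(4) in \<open>auto simp: R1\<close>)
        qed auto
      qed auto
    next
      case (2 R2 M2)
      have L: "out_list P = L0"
        by (simp add: out_list_def e0)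
      show ?case
      proof (rule hoare_Blk, goal_cases)
        case (2 R3 M3)
        then show ?case
          using \<open>Inv ([], eval_path P) R2 M2\<close> R(2) eval_path_feasible(1)[OF P]
          by (auto simp: Inv_def ev_state_def L e0)
      qed auto
    qed auto
  qed
qed

end

section \<open>Extending the search tree\<close>

definition push_adj_com :: com where
  "push_adj_com = While [Sub 28 26 25] 28
     (Blk [Load 27 1 25, Store 3 6 20, Store 4 6 27, Store 5 6 21, Add 6 6 3, Add 25 25 3])"

definition expand_com :: com where
  "expand_com =
     Blk [Const 29 0] ;;
     While [Sub 28 23 29] 28
       (Blk [Load 30 7 29, Store 3 6 20, Store 4 6 30, Store 5 6 21, Add 6 6 3,
             Load 25 0 30, Add 26 30 3, Load 26 0 26] ;;
        push_adj_com ;;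
        Blk [Add 29 29 3])"

definition push_all_com :: com where
  "push_all_com =
     Blk [Const 27 0] ;;
     While [Sub 28 0 27] 28
       (Blk [Store 3 6 20, Store 4 6 27, Store 5 6 21, Add 6 6 3, Add 27 27 3])"

context vc_instance
begin

text \<open>\<open>ns ! x\<close> is the list of vertices and the label of the node with number \<open>x\<close>; node 0 is the
  root, and array entries from \<open>length ns\<close> on are irrelevant.\<close>
definition heap :: "(nat list \<times> nat) list \<Rightarrow> (nat \<Rightarrow> nat \<Rightarrow> nat) \<Rightarrow> bool" where
  "heap ns M \<longleftrightarrow> ns \<noteq> [] \<and> (\<forall>x<length ns. chain M x (fst (ns ! x)) \<and> M 5 x = snd (ns ! x))"

abbreviation kids :: "nat list \<Rightarrow> nat \<Rightarrow> nat list \<Rightarrow> (nat list \<times> nat) list" where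
  "kids P h ws \<equiv> map (\<lambda>w. (w # P, h)) ws"

lemma heap_snoc:
  assumes "heap ns M" "par < length ns" "fst (ns ! par) = P"
    "M' 3 = (M 3)(length ns := par)" "M' 4 = (M 4)(length ns := w)" "M' 5 = (M 5)(length ns := h)"
  shows "heap (ns @ [(w # P, h)]) M'"
proof -
  have old: "chain M' x (fst (ns ! x))" if "x < length ns" for x
    by (rule chain_cong[of M]) (use assms that in \<open>auto simp: heap_def\<close>)
  have "M' 3 (length ns) = par" "M' 4 (length ns) = w" "M' 5 (length ns) = h"
    using assms by auto
  \<comment> \<open>Number 0 terminates a chain, so a new node must not receive it.\<close>
  moreover have "length ns \<noteq> 0"
    using assms by (auto simp: heap_def)
  ultimately have "chain M' (length ns) (w # P)"
    using old[OF assms(2)] assms(2,3) by simp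
  with old assms show ?thesis
    by (auto simp: heap_def nth_append less_Suc_eq)
qed

lemma heap_cong: "heap ns M \<Longrightarrow> M' 3 = M 3 \<Longrightarrow> M' 4 = M 4 \<Longrightarrow> M' 5 = M 5 \<Longrightarrow> heap ns M'"
  unfolding heap_def using chain_cong[of M _ _ M'] by auto

lemma push_adj_com:
  assumes R: "R 3 = 1" "R 6 = length ns" and hp: "heap ns M"
    and par: "R 20 < length ns" "fst (ns ! R 20) = P"
    and us: "R 25 + length us = R 26" "\<forall>i<length us. M 1 (R 25 + i) = us ! i"
  shows "hoare push_adj_com (R, M) (9 * length us + 2)
    (\<lambda>R' M'. heap (ns @ kids P (R 21) us) M' \<and> R' 6 = length ns + length us \<and>
       (\<forall>r. r \<notin> {6, 25, 27, 28} \<longrightarrow> R' r = R r) \<and> (\<forall>i. i \<notin> {3, 4, 5} \<longrightarrow> M' i = M i))"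
proof -
  define Inv where "Inv = (\<lambda>(us', ns') R' M'.
     ns' @ kids P (R 21) us' = ns @ kids P (R 21) us \<and> heap ns' M' \<and> R' 6 = length ns' \<and>
     R 20 < length ns' \<and> fst (ns' ! R 20) = P \<and>
     R' 25 + length us' = R' 26 \<and> (\<forall>i<length us'. M' 1 (R' 25 + i) = us' ! i) \<and>
     (\<forall>r. r \<notin> {6, 25, 27, 28} \<longrightarrow> R' r = R r) \<and> (\<forall>i. i \<notin> {3, 4, 5} \<longrightarrow> M' i = M i))"
  show ?thesis
    unfolding push_adj_com_def
  proof (rule hoare_While[where Inv = Inv and x = "(us, ns)" and pot = "\<lambda>(us', ns'). 9 * length us' + 2"],
      goal_cases)
    case 2
    show ?case using assms by (simp add: Inv_def)
  next
    case (3 x R' M')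
    obtain us' ns' where x: "x = (us', ns')" by (cases x)
    have "R' 25 + length us' = R' 26" "R' 26 \<le> R' 25"
      using 3 by (simp_all add: Inv_def x)
    then have "us' = []"
      by (metis add_le_same_cancel1 le_zero_eq length_0_conv)
    with 3(1) show ?case by (auto simp: Inv_def x)
  next
    case (4 x R' M')
    obtain us' ns' where x: "x = (us', ns')" by (cases x)
    have "us' \<noteq> []"
      using 4 by (auto simp: Inv_def x)
    then obtain u us2 where us': "us' = u # us2"
      by (cases us') auto
    have I: "ns' @ kids P (R 21) us' = ns @ kids P (R 21) us" "heap ns' M'" "R' 6 = length ns'"
      "R 20 < length ns'" "fst (ns' ! R 20) = P" "R' 25 + Suc (length us2) = R' 26"
      "M' (Suc 0) (R' 25) = u" "\<forall>i<length us2. M' (Suc 0) (Suc (R' 25 + i)) = us2 ! i"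
      "\<forall>r. r \<notin> {6, 25, 27, 28} \<longrightarrow> R' r = R r" "\<forall>i. i \<notin> {3, 4, 5} \<longrightarrow> M' i = M i"
      using 4(1) by (auto simp: Inv_def x us')
    show ?case
    proof (rule exI[of _ 6], rule hoare_Blk, goal_cases)
      case (2 R1 M1)
      then have R1: "R1 = R'(28 := R' 26 - R' 25, 27 := u, 6 := Suc (length ns'), 25 := Suc (R' 25))"
        and M1: "M1 = M'(3 := (M' 3)(length ns' := R 20), 4 := (M' 4)(length ns' := u), 5 := (M' 5)(length ns' := R 21))"
        using I R(1) by auto
      have "heap (ns' @ [(u # P, R 21)]) M1"
        by (rule heap_snoc[OF I(2,4,5)]) (simp_all add: M1)
      then have "Inv (us2, ns' @ [(u # P, R 21)]) R1 M1"
        using I by (simp add: Inv_def R1 M1 us' nth_append)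
      then show ?case
        by (intro exI[of _ "(us2, ns' @ [(u # P, R 21)])"]) (simp add: x us')
    qed auto
  qed auto
qed

lemma push_all_com:
  assumes R: "R 0 = n" "R 3 = 1" "R 6 = length ns" and hp: "heap ns M"
    and par: "R 20 < length ns" "fst (ns ! R 20) = P"
  shows "hoare push_all_com (R, M) (8 * n + 3)
    (\<lambda>R' M'. heap (ns @ kids P (R 21) [0..<n]) M' \<and> R' 6 = length ns + n \<and>
       (\<forall>r. r \<notin> {6, 27, 28} \<longrightarrow> R' r = R r) \<and> (\<forall>i. i \<notin> {3, 4, 5} \<longrightarrow> M' i = M i))"
proof -
  define Inv where "Inv = (\<lambda>j R' M'. j \<le> n \<and>
     heap (ns @ kids P (R 21) [0..<j]) M' \<and> R' 6 = length ns + j \<and> R' 27 = j \<and>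
     (\<forall>r. r \<notin> {6, 27, 28} \<longrightarrow> R' r = R r) \<and> (\<forall>i. i \<notin> {3, 4, 5} \<longrightarrow> M' i = M i))"
  show ?thesis
    unfolding push_all_com_def
  proof (rule hoare_Blk_Seq[where T = "8 * n + 2"], goal_cases)
    case (2 R1 M1)
    then have R1: "R1 = R(27 := 0)" and M1: "M1 = M"
      by auto
    show ?case
    proof (rule hoare_While[where Inv = Inv and x = 0 and pot = "\<lambda>j. 8 * (n - j) + 2"], goal_cases)
      case 2
      show ?case using assms by (simp add: Inv_def R1 M1)
    next
      case (3 j R' M')
      then have "j = n" using R(1) by (auto simp: Inv_def)
      with 3 show ?case by (auto simp: Inv_def)
    next
      case (4 j R' M')
      then have I: "j < n" "heap (ns @ kids P (R 21) [0..<j]) M'" "R' 6 = length ns + j" "R' 27 = j"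
        "\<forall>r. r \<notin> {6, 27, 28} \<longrightarrow> R' r = R r" "\<forall>i. i \<notin> {3, 4, 5} \<longrightarrow> M' i = M i"
        using R(1) by (auto simp: Inv_def)
      show ?case
      proof (rule exI[of _ 5], rule hoare_Blk, goal_cases)
        case (2 R1 M1)
        then have R1: "R1 = R'(28 := n - j, 6 := Suc (length ns + j), 27 := Suc j)"
          and M1: "M1 = M'(3 := (M' 3)(length ns + j := R 20), 4 := (M' 4)(length ns + j := j),
            5 := (M' 5)(length ns + j := R 21))"
          using I R by auto
        have "heap ((ns @ kids P (R 21) [0..<j]) @ [(j # P, R 21)]) M1"
          by (rule heap_snoc[OF I(2), of "R 20"]) (use par in \<open>simp_all add: M1 nth_append\<close>)
        then have "Inv (Suc j) R1 M1"
          using I by (simp add: Inv_def R1 M1)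
        then show ?case
          using I(1) by (intro exI[of _ "Suc j"]) simp
      qed auto
    qed auto
  qed auto
qed

lemma expand_com:
  assumes input_ok: "input_ok M" and R: "R 3 = 1" "R 6 = length ns" and hp: "heap ns M"
    and par: "R 20 < length ns" "fst (ns ! R 20) = P"
    and L: "R 23 = length L" "\<forall>i<length L. M 7 i = L ! i" "set L \<subseteq> {..<n}"
  shows "hoare expand_com (R, M) (14 * D * length L + 3)
    (\<lambda>R' M'. heap (ns @ kids P (R 21) (closed_nbs L)) M' \<and> R' 6 = length (ns @ kids P (R 21) (closed_nbs L)) \<and>
       (\<forall>r<25. r \<noteq> 6 \<longrightarrow> R' r = R r) \<and> (\<forall>i. i \<notin> {3, 4, 5} \<longrightarrow> M' i = M i))"
proof -
  define Inv where "Inv = (\<lambda>j R' M'. j \<le> length L \<and>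
     heap (ns @ kids P (R 21) (closed_nbs (take j L))) M' \<and>
     R' 6 = length ns + length (closed_nbs (take j L)) \<and> R' 29 = j \<and>
     (\<forall>r<25. r \<noteq> 6 \<longrightarrow> R' r = R r) \<and> (\<forall>i. i \<notin> {3, 4, 5} \<longrightarrow> M' i = M i))"
  show ?thesis
    unfolding expand_com_def
  proof (rule hoare_Blk_Seq[where T = "14 * D * length L + 2"], goal_cases)
    case (2 R1 M1)
    then have R1: "R1 = R(29 := 0)" and M1: "M1 = M"
      by auto
    show ?case
    proof (rule hoare_While[where Inv = Inv and x = 0 and pot = "\<lambda>j. 14 * D * (length L - j) + 2"], goal_cases)
      case 2
      show ?case using assms by (simp add: Inv_def R1 M1 closed_nbs_def)
    next
      case (3 j R' M')
      then have "j = length L" using L(1) by (auto simp: Inv_def)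
      with 3 show ?case by (auto simp: Inv_def)
    next
      case (4 j R' M')
      then have I: "j < length L" "heap (ns @ kids P (R 21) (closed_nbs (take j L))) M'"
        "R' 6 = length ns + length (closed_nbs (take j L))" "R' 29 = j"
        "\<forall>r<25. r \<noteq> 6 \<longrightarrow> R' r = R r" "\<forall>i. i \<notin> {3, 4, 5} \<longrightarrow> M' i = M i"
        using L(1) by (auto simp: Inv_def)
      define u where "u = L ! j"
      define ns1 where "ns1 = ns @ kids P (R 21) (closed_nbs (take j L))"
      have "u \<in> {..<n}"
        unfolding u_def using nth_mem[OF I(1)] L(3) by blast
      then have u: "u < n" "M' 7 j = u"
        using I(1,6) L(2) by (auto simp: u_def)
      have len1: "R' 6 = length ns1"
        using I(3) by (simp add: ns1_def)
      have closed_nbs: "closed_nbs (take (Suc j) L) = closed_nbs (take j L) @ u # adj ! u"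
        using I(1) by (simp add: closed_nbs_def take_Suc_conv_app_nth u_def)
      have M0: "M' 0 u = offset u" "M' 0 (Suc u) = offset u + length (adj ! u)"
        using input_ok I(6) u(1) by (auto simp: input_ok_def offset_Suc)
      \<comment> \<open>The list is strictly shorter than \<open>D\<close>; the spare unit pays for
        pushing \<open>u\<close> itself.\<close>
      have len: "9 * length (adj ! u) + 14 \<le> 14 * D"
        using length_adj_less[OF u(1)] by simp
      show ?case
      proof (rule exI[of _ "9 * length (adj ! u) + 11"], rule hoare_Blk_Seq[where T = "9 * length (adj ! u) + 3"],
          goal_cases)
        case (2 R1 M1)
        then have R1: "R1 = R'(28 := length L - j, 30 := u, 6 := Suc (length ns1),
            25 := offset u, 26 := offset u + length (adj ! u))"
          and M1: "M1 = M'(3 := (M' 3)(length ns1 := R 20), 4 := (M' 4)(length ns1 := u),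
            5 := (M' 5)(length ns1 := R 21))"
          using I R(1) u M0 len1 L(1) by auto
        define ns2 where "ns2 = ns1 @ [(u # P, R 21)]"
        have hp2: "heap ns2 M1"
          unfolding ns2_def
          by (rule heap_snoc[OF I(2)[folded ns1_def], of "R 20"])
             (use par in \<open>simp_all add: M1 ns1_def nth_append\<close>)
        have adjc: "hoare push_adj_com (R1, M1) (9 * length (adj ! u) + 2)
          (\<lambda>R' M'. heap (ns2 @ kids P (R1 21) (adj ! u)) M' \<and> R' 6 = length ns2 + length (adj ! u) \<and>
            (\<forall>r. r \<notin> {6, 25, 27, 28} \<longrightarrow> R' r = R1 r) \<and> (\<forall>i. i \<notin> {3, 4, 5} \<longrightarrow> M' i = M1 i))"
          by (rule push_adj_com)
             (use hp2 par R(1) I u(1) input_ok in \<open>auto simp: R1 M1 ns2_def ns1_def nth_append input_ok_def\<close>)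
        show ?case
        proof (rule hoare_Seq[OF adjc, where T' = 1], goal_cases)
          case (1 R2 M2)
          show ?case
          proof (rule hoare_Blk, goal_cases)
            case (2 R3 M3)
            then have R3: "R3 = R2(29 := Suc j)" "M3 = M2"
              using 1 I R(1) by (auto simp: R1)
            have "heap (ns @ kids P (R 21) (closed_nbs (take (Suc j) L))) M3"
              using 1 I(5) by (simp add: R3 closed_nbs ns2_def ns1_def R1)
            moreover have "R3 6 = length ns + length (closed_nbs (take (Suc j) L))"
              using 1 by (simp add: R3 closed_nbs ns2_def ns1_def)
            moreover have "\<forall>r<25. r \<noteq> 6 \<longrightarrow> R3 r = R r"
              using 1 I(5) by (auto simp: R3 R1)
            moreover have "\<forall>i. i \<notin> {3, 4, 5} \<longrightarrow> M3 i = M i"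
              using 1 I(6) by (simp add: R3 M1)
            ultimately have "Inv (Suc j) R3 M3"
              using I(1) by (simp add: Inv_def R3)
            moreover have "9 * length (adj ! u) + 14 + 14 * D * (length L - Suc j) \<le> 14 * D * (length L - j)"
            proof -
              have "length L - j = Suc (length L - Suc j)"
                using I(1) by simp
              then show ?thesis
                using len by simp
            qed
            ultimately show ?case
              by (intro exI[of _ "Suc j"]) simp
          qed auto
        qed auto
      qed auto
    qed auto
  qed auto
qed


section \<open>The search for a new component\<close>

text \<open>Sortedness by length makes the first success a shortest one.\<close>
definition queue :: "nat list \<Rightarrow> int \<Rightarrow> nat list list \<Rightarrow> bool" where
  "queue P thr ps \<longleftrightarrow> (\<forall>p\<in>set ps. reach P thr p \<and> length p \<le> A) \<and> sorted (map length ps) \<and>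
     (\<forall>p\<in>set ps. length p \<le> length (hd ps) + 1) \<and>
     (\<forall>Q. target P thr Q \<longrightarrow> (\<exists>p\<in>set ps. grow p Q))"

definition found :: "nat list \<Rightarrow> int \<Rightarrow> nat list \<Rightarrow> bool" where
  "found P thr X \<longleftrightarrow> reach P thr (X @ P) \<and> feasible (X @ P) \<and> thr \<le> gap (set (X @ P)) \<and>
     length (X @ P) \<le> A \<and> (\<forall>Q. target P thr Q \<longrightarrow> length (X @ P) \<le> length Q)"

lemma queue_start:
  assumes "length P < A"
  shows "queue P thr (map (\<lambda>w. w # P) [0..<n])"
proof -
  let ?ps = "map (\<lambda>w. w # P) [0..<n]"
  have len: "\<forall>p\<in>set ?ps. length p = Suc (length P)"
    by auto
  have "length p \<le> length (hd ?ps) + 1" if "p \<in> set ?ps" for p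
  proof -
    have "hd ?ps \<in> set ?ps"
      using that by (intro hd_in_set) auto
    with that len show ?thesis by fastforce
  qed
  moreover have "\<forall>p\<in>set ?ps. reach P thr p \<and> length p \<le> A"
    using assms by (auto intro: reach_start)
  moreover have "sorted (map length ?ps)"
    by (auto simp: sorted_iff_nth_mono)
  moreover have "\<forall>Q. target P thr Q \<longrightarrow> (\<exists>p\<in>set ?ps. grow p Q)"
    by (auto simp: target_def)
  ultimately show ?thesis
    unfolding queue_def by blast
qed

lemma queue_tl:
  assumes "queue P thr (p # ps)" "\<And>Q. target P thr Q \<Longrightarrow> \<not> grow p Q"
  shows "queue P thr ps"
  using assms unfolding queue_def by (cases ps) fastforce+

lemma queue_not_feasible:
  assumes "queue P thr (p # ps)" "\<not> feasible p"
  shows "queue P thr ps"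
proof (rule queue_tl[OF assms(1)])
  fix Q assume "target P thr Q"
  then show "\<not> grow p Q"
    using assms(2) grow_append feasible_suffix by (metis target_def)
qed

text \<open>\<open>p\<close> misses the threshold, and any proper growth of it has more than
  \<open>A\<close> vertices.\<close>

lemma queue_full:
  assumes "queue P thr (p # ps)" "gap (set p) < thr" "\<not> length p < A"
  shows "queue P thr ps"
proof (rule queue_tl[OF assms(1)])
  fix Q assume Q: "target P thr Q"
  show "\<not> grow p Q"
  proof
    assume g: "grow p Q"
    have "p \<noteq> Q"
      using Q assms(2) by (auto simp: target_def)
    then have "length p < length Q"
      using grow_step[OF g] by blast
    then show False
      using Q assms(3) by (auto simp: target_def)
  qed
qed

text \<open>The usual breadth-first invariant: no waiting list exceeds the head by more than one
  vertex, so children can be appended without spoiling the order. A target below \<open>p\<close>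
  passes to the child on its growth path.\<close>

lemma queue_expand:
  assumes q: "queue P thr (p # ps)" and ok: "feasible p" and gap: "gap (set p) < thr" and len: "length p < A"
    and P: "set P \<subseteq> {..<n}"
  shows "queue P thr (ps @ map (\<lambda>w. w # p) (closed_nbs (out_list p)))"
proof -
  have rp: "reach P thr p"
    using q by (simp add: queue_def)
  then have pn: "set p \<subseteq> {..<n}"
    using reach_lt P by blast
  have out: "set (out_list p) = Nout (set p)" "set (out_list p) \<subseteq> {..<n}"
    using eval_path_feasible(3)[OF pn ok] Nout_lt by auto
  have kid: "reach P thr (w # p)" if "w \<in> set (closed_nbs (out_list p))" for w
  proof -
    have "w \<in> Nout (set p) \<union> (\<Union>u\<in>Nout (set p). nb u)"
      using that set_closed_nbs[OF out(2)] out(1) by simp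
    then have "\<exists>u\<in>Nout (set p). w = u \<or> w \<in> nb u"
      by auto
    then show ?thesis
      using reach_step[OF rp ok gap] by blast
  qed
  have sorted: "sorted (map length ps)" "\<forall>r\<in>set ps. length p \<le> length r \<and> length r \<le> Suc (length p)"
    using q by (auto simp: queue_def)
  have sorted_new: "sorted (map length (map (\<lambda>w. w # p) ws))" for ws
    by (induction ws) auto
  have "\<exists>r\<in>set (ps @ map (\<lambda>w. w # p) (closed_nbs (out_list p))). grow r Q" if Q: "target P thr Q" for Q
  proof -
    obtain r where r: "r \<in> set (p # ps)" "grow r Q"
      using q Q unfolding queue_def by blast
    show ?thesis
    proof (cases "r \<in> set ps")
      case True
      with r show ?thesis by auto
    next
      case False
      then have g: "grow p Q" using r by auto
      have "p \<noteq> Q"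
        using Q gap by (auto simp: target_def)
      then obtain u v where "u \<in> Nout (set p)" "v \<in> nb u" "grow (v # p) Q"
        using grow_step[OF g] by blast
      then show ?thesis
        using set_closed_nbs[OF out(2)] out(1) by fastforce
    qed
  qed
  moreover have "\<forall>r\<in>set (ps @ map (\<lambda>w. w # p) (closed_nbs (out_list p))). reach P thr r \<and> length r \<le> A"
    using q kid len by (auto simp: queue_def)
  moreover have "sorted (map length (ps @ map (\<lambda>w. w # p) (closed_nbs (out_list p))))"
    unfolding map_append sorted_append using sorted sorted_new by auto
  moreover have "\<forall>r\<in>set (ps @ map (\<lambda>w. w # p) (closed_nbs (out_list p))).
      length r \<le> length (hd (ps @ map (\<lambda>w. w # p) (closed_nbs (out_list p)))) + 1"
  proof -
    have *: "length p \<le> length (hd (ps @ map (\<lambda>w. w # p) (closed_nbs (out_list p))))"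
      if "ps @ map (\<lambda>w. w # p) (closed_nbs (out_list p)) \<noteq> []"
      using hd_in_set[OF that] sorted(2) by auto
    show ?thesis
    proof
      fix r assume r: "r \<in> set (ps @ map (\<lambda>w. w # p) (closed_nbs (out_list p)))"
      then have "length r \<le> Suc (length p)"
        using sorted(2) by auto
      moreover have "ps @ map (\<lambda>w. w # p) (closed_nbs (out_list p)) \<noteq> []"
        using r by (metis empty_iff empty_set)
      ultimately show "length r \<le> length (hd (ps @ map (\<lambda>w. w # p) (closed_nbs (out_list p)))) + 1"
        using * by linarith
    qed
  qed
  ultimately show ?thesis
    unfolding queue_def by blast
qed

text \<open>Every target extends a waiting list, and none of those is shorter than the head.\<close>

lemma queue_found:
  assumes q: "queue P thr (p # ps)" and ok: "feasible p" and gap: "thr \<le> gap (set p)"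
  shows "\<exists>X. X \<noteq> [] \<and> p = X @ P \<and> found P thr X"
proof -
  have rp: "reach P thr p" "length p \<le> A"
    using q by (auto simp: queue_def)
  then obtain X where X: "p = X @ P" "X \<noteq> []"
    using reach_append by blast
  have "length p \<le> length Q" if Q: "target P thr Q" for Q
  proof -
    obtain r where r: "r \<in> set (p # ps)" "grow r Q"
      using q Q unfolding queue_def by blast
    then have "length p \<le> length r"
      using q by (auto simp: queue_def)
    also have "\<dots> \<le> length Q"
      using grow_append[OF r(2)] by auto
    finally show ?thesis .
  qed
  with X rp ok gap show ?thesis
    by (auto simp: found_def)
qed

lemma queue_empty: "queue P thr [] \<Longrightarrow> \<not> target P thr Q"
  by (auto simp: queue_def)

section \<open>Cost accounting for the breadth-first search\<close>

text \<open>\<open>unit_cost\<close> bounds the work on a single node apart from the searches it starts, \<open>U r\<close> the work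
  of a breadth-first search below a node that may still be extended by \<open>r\<close> vertices.\<close>
definition unit_cost :: nat where "unit_cost = 60 * (A + 1) * D"

text \<open>\<open>B * D\<close> already bounds the number of children; \<open>B + 1\<close> keeps
  \<open>K\<close> at least \<open>D\<close> and makes \<open>(g + B) * D \<le> g * K\<close> for
  positive g.\<close>

definition K :: nat where "K = (B + 1) * D"

primrec U :: "nat \<Rightarrow> nat" where
  "U 0 = unit_cost"
| "U (Suc r) = unit_cost + K * U r"

definition qpot :: "nat list list \<Rightarrow> nat" where
  "qpot ps = (\<Sum>p\<leftarrow>ps. U (A - length p))"

lemma U_ge: "unit_cost \<le> U r"
  by (cases r) auto

lemma qpot_kids: "qpot (map (\<lambda>w. w # p) ws) = length ws * U (A - Suc (length p))"
  unfolding qpot_def by (simp add: o_def sum_list_triv)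

lemma qpot_Cons: "qpot (p # ps) = U (A - length p) + qpot ps"
  by (simp add: qpot_def)

text \<open>By the recursion of \<open>U\<close>, removing \<open>p\<close> releases enough for its
  own evaluation and for all its children.\<close>

lemma qpot_expand:
  assumes "feasible p" "length p < A" "set p \<subseteq> {..<n}"
  shows "unit_cost + qpot (ps @ map (\<lambda>w. w # p) (closed_nbs (out_list p))) \<le> qpot (p # ps)"
proof -
  have out: "set (out_list p) \<subseteq> {..<n}" "length (out_list p) \<le> B"
    using eval_path_feasible[OF assms(3)] assms(1) Nout_lt by (auto simp: feasible_def)
  have "length (closed_nbs (out_list p)) \<le> length (out_list p) * D"
    using length_closed_nbs out(1) by blast
  also have "\<dots> \<le> K"
    unfolding K_def using out(2) by (intro mult_le_mono1) simp
  finally have "length (closed_nbs (out_list p)) * U (A - Suc (length p)) \<le> K * U (A - Suc (length p))"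
    by simp
  moreover have "A - length p = Suc (A - Suc (length p))"
    using assms(2) by simp
  ultimately show ?thesis
    using qpot_kids[of p "closed_nbs (out_list p)"] by (simp add: qpot_def)
qed

lemma qpot_tl: "unit_cost + qpot ps \<le> qpot (p # ps)"
  using U_ge by (simp add: qpot_Cons)

end

text \<open>The comparison of gaps has its negative terms moved across, as the machine only
  subtracts with truncation; g is the difference of registers 13 and 10. On success the head moves
  past the tail, which ends the loop.\<close>

definition bfs_com :: com where
  "bfs_com = While [Sub 25 6 14] 25
     (Blk [Copy 19 14] ;;
      eval_com ;;
      Cond [] 24 (Blk [])
        (Cond [Add 25 11 23, Add 25 25 13, Add 26 22 12, Add 26 26 10, Sub 25 25 26] 25
           (Cond [Sub 25 4 22] 25 (Blk [Copy 20 14] ;; expand_com) (Blk []))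
           (Blk [Copy 16 14, Sub 17 22 11, Copy 14 6])) ;;
      Blk [Add 14 14 3])"

context vc_instance
begin

definition globals_ok :: "(nat \<Rightarrow> nat) \<Rightarrow> (nat \<Rightarrow> nat \<Rightarrow> nat) \<Rightarrow> bool" where
  "globals_ok R M \<longleftrightarrow> input_ok M \<and> R 0 = n \<and> R 2 = d \<and> R 3 = 1 \<and> R 4 = A \<and> R 5 = B \<and> (\<forall>u. M 6 u \<le> R 9)"

lemma input_ok_cong: "input_ok M \<Longrightarrow> M' 0 = M 0 \<Longrightarrow> M' (Suc 0) = M (Suc 0) \<Longrightarrow> M' 2 = M 2 \<Longrightarrow> input_ok M'"
  by (simp add: input_ok_def)

lemma heap_appendD: "heap (ns @ zs) M \<Longrightarrow> ns \<noteq> [] \<Longrightarrow> heap ns M"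
  unfolding heap_def by (metis length_append nth_append trans_less_add1)

lemma unit_cost_bound:
  assumes "l \<le> A"
  shows "20 * (l + 1) * D + (14 * D * B + 20) + 5 \<le> unit_cost"
proof -
  have "20 * (l + 1) * D \<le> 20 * (A + 1) * D"
    using assms by simp
  moreover have "B * D \<le> (A + 1) * D"
    using A_B(3) by (intro mult_le_mono1) simp
  then have "14 * D * B \<le> 14 * ((A + 1) * D)"
    by (simp add: ac_simps)
  moreover have "1 \<le> (A + 1) * D"
    using D_pos by (simp add: Suc_leI)
  ultimately show ?thesis
    unfolding unit_cost_def by linarith
qed

text \<open>A reached list properly extends \<open>P\<close>, so X is never empty and length 0 in
  register 17 can stand for failure.\<close>

lemma bfs_com:
  assumes g: "globals_ok R M" and hp: "heap (ns @ qs) M" and P: "set P \<subseteq> {..<n}" "feasible P"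
    and R: "R 6 = length (ns @ qs)" "R 14 = length ns" "R 17 = 0" "R 21 = 0"
      "R 11 = length P" "R 12 = length (out_list P)" "R 13 = R 10 + gg"
    and thr: "thr = gap (set P) + int gg"
    and q: "queue P thr (map fst qs)"
  shows "hoare bfs_com (R, M) (qpot (map fst qs) + 2)
    (\<lambda>R' M'. \<exists>zs X. globals_ok R' M' \<and> heap (ns @ zs) M' \<and>
       (\<forall>r<22. r \<notin> {6, 9, 14, 16, 17, 19, 20} \<longrightarrow> R' r = R r) \<and>
       R' 17 = length X \<and> (X = [] \<longrightarrow> (\<forall>Q. \<not> target P thr Q)) \<and>
       (X \<noteq> [] \<longrightarrow> chain M' (R' 16) (X @ P) \<and> found P thr X))"
proof -
  define Inv where "Inv = (\<lambda>(ds, qs, X) R' M'.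
     globals_ok R' M' \<and> heap (ns @ ds @ qs) M' \<and> R' 6 = length (ns @ ds @ qs) \<and>
     (\<forall>r<22. r \<notin> {6, 9, 14, 16, 17, 19, 20} \<longrightarrow> R' r = R r) \<and>
     (X = [] \<longrightarrow> R' 14 = length (ns @ ds) \<and> R' 17 = 0 \<and> queue P thr (map fst qs)) \<and>
     (X \<noteq> [] \<longrightarrow> R' 14 = Suc (R' 6) \<and> R' 17 = length X \<and> chain M' (R' 16) (X @ P) \<and> found P thr X))"
  define pot where "pot = (\<lambda>(ds :: (nat list \<times> nat) list, qs :: (nat list \<times> nat) list, X :: nat list).
     (if X = [] then qpot (map fst qs) else 0) + 2)"
  show ?thesis
    unfolding bfs_com_def
  proof (rule hoare_While[where Inv = Inv and x = "([], qs, [])" and pot = pot], goal_cases)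
    case 2
    show ?case using assms by (simp add: Inv_def)
  next
    case (3 x R' M')
    obtain ds qs' X where x: "x = (ds, qs', X)" by (metis prod_cases3)
    let ?R = "R'(25 := R' 6 - R' 14)"
    have run: "run [Sub 25 6 14] (R', M') = (?R, M')"
      by simp
    have "globals_ok ?R M'"
      using 3(1) by (simp add: Inv_def x globals_ok_def)
    moreover have "heap (ns @ ds @ qs') M'" "\<forall>r<22. r \<notin> {6, 9, 14, 16, 17, 19, 20} \<longrightarrow> ?R r = R r"
      "?R 17 = length X" "X \<noteq> [] \<longrightarrow> chain M' (?R 16) (X @ P) \<and> found P thr X"
      using 3(1) by (auto simp: Inv_def x)
    moreover have "\<not> target P thr Q" if "X = []" for Q
    proof -
      have "qs' = []"
        using 3 that by (cases qs') (auto simp: Inv_def x)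
      then show ?thesis
        using 3(1) that queue_empty by (auto simp: Inv_def x)
    qed
    ultimately show ?case
      unfolding run fst_conv snd_conv by (auto simp: pot_def x)
  next
    case (4 x R' M')
    obtain ds qs' X where x: "x = (ds, qs', X)" by (metis prod_cases3)
    have X: "X = []"
      using 4 by (cases "X = []") (auto simp: Inv_def x)
    have "qs' \<noteq> []"
      using 4 X by (auto simp: Inv_def x)
    then obtain p h qs2 where qs': "qs' = (p, h) # qs2"
      by (metis list.exhaust surj_pair)
    have I: "globals_ok R' M'" "heap (ns @ ds @ (p, h) # qs2) M'" "R' 6 = length (ns @ ds @ (p, h) # qs2)"
      "\<forall>r<22. r \<notin> {6, 9, 14, 16, 17, 19, 20} \<longrightarrow> R' r = R r"
      "R' 14 = length (ns @ ds)" "R' 17 = 0" "queue P thr (p # map fst qs2)"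
      using 4(1) X by (auto simp: Inv_def x qs')
    define ds2 where "ds2 = ds @ [(p, h)]"
    have split: "ns @ ds @ (p, h) # qs2 = ns @ ds2 @ qs2"
      by (simp add: ds2_def)
    have rp: "reach P thr p" "length p \<le> A"
      using I(7) by (auto simp: queue_def)
    have pn: "set p \<subseteq> {..<n}"
      using reach_lt rp P by blast
    have idx: "length (ns @ ds) < length (ns @ ds @ (p, h) # qs2)"
      "(ns @ ds @ (p, h) # qs2) ! length (ns @ ds) = (p, h)"
      by (auto simp: nth_append)
    have ch: "chain M' (R' 14) p"
      using I(2,5) idx unfolding heap_def by (metis fst_conv)
    have bound: "20 * (length p + 1) * D + (14 * D * B + 20) + 5 \<le> unit_cost"
      using unit_cost_bound rp(2) .
    \<comment> \<open>All branches meet before the head advances, so the invariant is stated for the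
      already increased register 14.\<close>
    let ?Q = "\<lambda>R2 M2. \<exists>y. Inv y (R2(14 := Suc (R2 14))) M2 \<and> R2 3 = 1 \<and> unit_cost + pot y \<le> pot x"
    have potx: "pot x = qpot (p # map fst qs2) + 2"
      by (simp add: pot_def x X qs')
    show ?case
    \<comment> \<open>The other 3 steps are the subtraction at the loop head and two jumps.\<close>
    proof (rule exI[of _ "unit_cost - 3"],
        rule hoare_Blk_Seq[where T = "20 * (length p + 1) * D + (14 * D * B + 20) + 1"], goal_cases)
      case 3
      then show ?case using bound by simp
    next
      case (2 R1 M1)
      then have R1: "R1 = R'(25 := R' 6 - R' 14, 19 := R' 14)" and M1: "M1 = M'"
        by auto
      have "hoare eval_com (R1, M1) (20 * (length p + 1) * D)
        (\<lambda>R2 M2. (\<forall>r<22. r \<noteq> 9 \<longrightarrow> R2 r = R1 r) \<and> (\<forall>i. i \<noteq> 6 \<and> i \<noteq> 7 \<longrightarrow> M2 i = M1 i) \<and>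
          (\<forall>u. M2 6 u \<le> R2 9) \<and> R2 22 = length p \<and> (R2 24 = 0 \<longleftrightarrow> feasible p) \<and>
          R2 23 = length (out_list p) \<and> (\<forall>i<length (out_list p). M2 7 i = out_list p ! i))"
        by (rule eval_com) (use I(1) ch pn in \<open>auto simp: globals_ok_def R1 M1\<close>)
      then show ?case
      proof (rule hoare_Seq[where T' = "14 * D * B + 20 + 1"], goal_cases)
        case (1 R2 M2)
        then have R2: "\<forall>r<22. r \<notin> {9, 19} \<longrightarrow> R2 r = R' r" "R2 22 = length p" "R2 24 = 0 \<longleftrightarrow> feasible p"
          "R2 23 = length (out_list p)" "\<forall>i<length (out_list p). M2 7 i = out_list p ! i"
          and M2: "\<forall>i. i \<noteq> 6 \<and> i \<noteq> 7 \<longrightarrow> M2 i = M' i" "\<forall>u. M2 6 u \<le> R2 9"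
          by (auto simp: R1 M1)
        have g2: "globals_ok R2 M2"
          using I(1) R2(1) M2 input_ok_cong[of M' M2] by (auto simp: globals_ok_def)
        have hp2: "heap (ns @ ds2 @ qs2) M2"
          using heap_cong[OF I(2), of M2] M2 unfolding split by simp
        have len2: "R2 6 = length (ns @ ds2 @ qs2)" "R2 14 = length (ns @ ds)" "R2 17 = 0"
          using R2(1) I(3,5,6) by (simp_all add: ds2_def)
        have fr2: "\<forall>r<22. r \<notin> {6, 9, 14, 16, 17, 19, 20} \<longrightarrow> R2 r = R r"
          using R2(1) I(4) by simp
        have skip: "Inv (ds2, qs2, []) (R3(14 := Suc (R3 14))) M2"
          if "queue P thr (map fst qs2)" "\<forall>r. r \<notin> {25, 26} \<longrightarrow> R3 r = R2 r" for R3
          using that g2 hp2 len2 fr2 by (simp add: Inv_def globals_ok_def ds2_def)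
        have skip': "?Q R3 M2"
          if "queue P thr (map fst qs2)" "\<forall>r. r \<notin> {25, 26} \<longrightarrow> R3 r = R2 r" for R3
        proof -
          have "unit_cost + pot (ds2, qs2, []) \<le> pot x"
            unfolding potx using qpot_tl[of "map fst qs2" p] by (simp add: pot_def)
          then show ?thesis
            using skip[OF that] that(2) g2 by (intro exI[of _ "(ds2, qs2, [])"]) (simp add: globals_ok_def)
        qed
        have "hoare (Cond [] 24 (Blk [])
            (Cond [Add 25 11 23, Add 25 25 13, Add 26 22 12, Add 26 26 10, Sub 25 25 26] 25
               (Cond [Sub 25 4 22] 25 (Blk [Copy 20 14] ;; expand_com) (Blk []))
               (Blk [Copy 16 14, Sub 17 22 11, Copy 14 6]))) (R2, M2) (14 * D * B + 20) ?Q"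
        proof (rule hoare_Cond[where T = "14 * D * B + 18"], goal_cases)
          case (2 R3 M3)
          then have "R3 = R2" "M3 = M2" "\<not> feasible p"
            using R2(3) by auto
          moreover have "queue P thr (map fst qs2)"
            using queue_not_feasible[OF I(7) \<open>\<not> feasible p\<close>] .
          ultimately show ?case
            using skip'[of R2] by (intro hoare_Blk) auto
        next
          case (3 R3 M3)
          then have R3: "R3 = R2" "M3 = M2" and ok: "feasible p"
            using R2(3) by auto
          have gp: "gap (set p) = int (length p) - int (length (out_list p))"
            "gap (set P) = int (length P) - int (length (out_list P))"
            using feasible_gap pn ok P by auto
          show ?case
            unfolding R3
          proof (rule hoare_Cond[where T = "14 * D * B + 11"], goal_cases)
            case (2 R4 M4)
            then have R4: "\<forall>r. r \<notin> {25, 26} \<longrightarrow> R4 r = R2 r" "M4 = M2"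
              "length p + length (out_list P) < length P + length (out_list p) + gg"
              using R2(2,4) fr2 R(5,6,7) by auto
            have gless: "gap (set p) < thr"
              using R4(3) gp thr by linarith
            show ?case
            proof (rule hoare_Cond[where T = "14 * D * B + 8"], goal_cases)
              case (2 R5 M5)
              then have R5: "\<forall>r. r \<notin> {25, 26} \<longrightarrow> R5 r = R2 r" "M5 = M2" "length p < A"
                using R4 R2(2) g2 by (auto simp: globals_ok_def)
              show ?case
              proof (rule hoare_Blk_Seq[where T = "14 * D * B + 3"], goal_cases)
                case (2 R6 M6)
                then have R6: "\<forall>r. r \<notin> {20, 25, 26} \<longrightarrow> R6 r = R2 r" "R6 20 = length (ns @ ds)" "M6 = M2"
                  using R5 len2 by auto
                have outn: "set (out_list p) \<subseteq> {..<n}" "length (out_list p) \<le> B"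
                  using eval_path_feasible[OF pn] ok Nout_lt by (auto simp: feasible_def)
                let ?new = "kids p (R6 21) (closed_nbs (out_list p))"
                have "hoare expand_com (R6, M6) (14 * D * length (out_list p) + 3)
                  (\<lambda>R7 M7. heap ((ns @ ds2 @ qs2) @ ?new) M7 \<and> R7 6 = length ((ns @ ds2 @ qs2) @ ?new) \<and>
                    (\<forall>r<25. r \<noteq> 6 \<longrightarrow> R7 r = R6 r) \<and> (\<forall>i. i \<notin> {3, 4, 5} \<longrightarrow> M7 i = M6 i))"
                  by (rule expand_com)
                     (use g2 hp2 len2 R2(4,5) R6 outn in \<open>auto simp: globals_ok_def ds2_def nth_append\<close>)
                then show ?case
                proof (rule hoare_mono, goal_cases)
                  case 1
                  then show ?case using outn(2) by simp
                next
                  case (2 R7 M7)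
                  let ?y = "(ds2, qs2 @ kids p 0 (closed_nbs (out_list p)), [])"
                  have R7: "\<forall>r<25. r \<notin> {6, 20} \<longrightarrow> R7 r = R2 r" "R6 21 = 0"
                    using 2 R6 fr2 R(4) by auto
                  have M7: "\<forall>i. i \<notin> {3, 4, 5} \<longrightarrow> M7 i = M2 i"
                    using 2 R6(3) by simp
                  have g7: "globals_ok R7 M7"
                    using g2 R7(1) M7 input_ok_cong[of M2 M7] by (auto simp: globals_ok_def)
                  have mf: "map fst (qs2 @ kids p 0 (closed_nbs (out_list p))) = map fst qs2 @ map (\<lambda>w. w # p) (closed_nbs (out_list p))"
                    by simp
                  have qe: "queue P thr (map fst (qs2 @ kids p 0 (closed_nbs (out_list p))))"
                    unfolding mf by (rule queue_expand[OF I(7) ok gless R5(3) P(1)])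
                  have "Inv ?y (R7(14 := Suc (R7 14))) M7"
                    using g7 2 R7 qe fr2 len2 by (simp add: Inv_def globals_ok_def ds2_def)
                  moreover have "unit_cost + pot ?y \<le> pot x"
                    unfolding potx using qpot_expand[OF ok R5(3) pn, of "map fst qs2"]
                    unfolding pot_def split_conv mf by simp
                  ultimately show ?case
                    using g7 by (intro exI[of _ ?y]) (simp add: globals_ok_def)
                qed
              qed auto
            next
              case (3 R5 M5)
              then have R5: "\<forall>r. r \<notin> {25, 26} \<longrightarrow> R5 r = R2 r" "M5 = M2" "\<not> length p < A"
                using R4 R2(2) g2 by (auto simp: globals_ok_def)
              then show ?case
                using skip'[OF queue_full[OF I(7) gless R5(3)] R5(1)] by (intro hoare_Blk) auto
            qed auto
          next
            case (3 R4 M4)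
            then have R4: "\<forall>r. r \<notin> {25, 26} \<longrightarrow> R4 r = R2 r" "M4 = M2"
              "\<not> length p + length (out_list P) < length P + length (out_list p) + gg"
              using R2(2,4) fr2 R(5,6,7) by auto
            have gge: "thr \<le> gap (set p)"
              using R4(3) gp thr by linarith
            obtain X where X: "X \<noteq> []" "p = X @ P" "found P thr X"
              using queue_found[OF I(7) ok gge] by blast
            show ?case
            proof (rule hoare_Blk, goal_cases)
              case (2 R5 M5)
              then have R5: "R5 = R4(16 := R2 14, 17 := length p - length P, 14 := R2 6)" "M5 = M2"
                using R4 R2(2) fr2 R(5) by auto
              have "chain M2 (R2 14) p"
                using chain_cong[OF ch, of M2] M2(1) len2(2) I(5) by simp
              then have "Inv (ds2, qs2, X) (R5(14 := Suc (R5 14))) M5"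
                using g2 hp2 len2 fr2 X R4(1) by (simp add: Inv_def R5 globals_ok_def)
              moreover have "unit_cost + pot (ds2, qs2, X) \<le> pot x"
                unfolding potx using qpot_tl[of "map fst qs2" p] X(1) by (simp add: pot_def)
              ultimately show ?case
                using g2 R4(1) by (intro exI[of _ "(ds2, qs2, X)"]) (simp add: R5 globals_ok_def)
            qed auto
          qed auto
        qed auto
        then show ?case
        proof (rule hoare_Seq[where T' = 1], goal_cases)
          case (1 R3 M3)
          then obtain y where y: "Inv y (R3(14 := Suc (R3 14))) M3" "R3 3 = 1" "unit_cost + pot y \<le> pot x"
            by blast
          have "unit_cost - 3 + 3 = unit_cost"
            using bound by simp
          show ?case
          proof (rule hoare_Blk, goal_cases)
            case (2 R4 M4)
            then have "R4 = R3(14 := Suc (R3 14))" "M4 = M3"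
              using y(2) by auto
            then show ?case
              using y \<open>unit_cost - 3 + 3 = unit_cost\<close> by (intro exI[of _ y]) simp
          qed auto
        qed auto
      qed auto
    qed auto
  qed (auto simp: pot_def)
qed

end

definition copy_com :: com where
  "copy_com = While [] 17
     (Blk [Load 25 4 16, Store 7 23 25, Load 16 3 16, Add 23 23 3, Sub 17 17 3])"

text \<open>The breadth-first tree is discarded by resetting register 6 before the vertices close to \<open>X\<close>
  are added to the search tree.\<close>
definition search_com :: com where
  "search_com =
     Blk [Copy 15 6, Copy 14 6, Const 17 0, Copy 20 7, Const 21 0] ;;
     push_all_com ;;
     bfs_com ;;
     Blk [Const 23 0] ;;
     copy_com ;;
     Blk [Copy 6 15, Copy 20 7, Copy 21 13] ;;
     expand_com"

definition starts_com :: com where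
  "starts_com = While [Sub 25 18 13] 25 (search_com ;; Blk [Add 13 13 3])"

context vc_instance
begin

text \<open>\<open>X\<close> is the newest part of the path, and register 17 stops the walk before
  \<open>P\<close>.\<close>

lemma copy_com:
  assumes R: "R 3 = 1" "R 23 = 0" "R 17 = length X"
    and ch: "X \<noteq> [] \<longrightarrow> chain M (R 16) (X @ P)"
  shows "hoare copy_com (R, M) (7 * length X + 1)
    (\<lambda>R' M'. R' 23 = length X \<and> (\<forall>i<length X. M' 7 i = X ! i) \<and>
       (\<forall>r. r \<notin> {16, 17, 23, 25} \<longrightarrow> R' r = R r) \<and> (\<forall>i. i \<noteq> 7 \<longrightarrow> M' i = M i))"
proof -
  define Inv where "Inv = (\<lambda>j R' M'. j \<le> length X \<and> R' 23 = j \<and> R' 17 = length X - j \<and>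
     (j < length X \<longrightarrow> chain M (R' 16) (drop j X @ P)) \<and> (\<forall>i<j. M' 7 i = X ! i) \<and>
     (\<forall>r. r \<notin> {16, 17, 23, 25} \<longrightarrow> R' r = R r) \<and> (\<forall>i. i \<noteq> 7 \<longrightarrow> M' i = M i))"
  show ?thesis
    unfolding copy_com_def
  proof (rule hoare_While[where Inv = Inv and x = 0 and pot = "\<lambda>j. 7 * (length X - j) + 1"], goal_cases)
    case 2
    show ?case using assms by (simp add: Inv_def)
  next
    case (3 j R' M')
    then have "j = length X" by (auto simp: Inv_def)
    with 3 show ?case by (auto simp: Inv_def)
  next
    case (4 j R' M')
    then have j: "j < length X" by (auto simp: Inv_def)
    have dr: "drop j X = X ! j # drop (Suc j) X"
      using j by (simp add: Cons_nth_drop_Suc)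
    have I: "R' 23 = j" "R' 17 = length X - j" "M 4 (R' 16) = X ! j" "chain M (M 3 (R' 16)) (drop (Suc j) X @ P)"
      "\<forall>i<j. M' 7 i = X ! i" "\<forall>r. r \<notin> {16, 17, 23, 25} \<longrightarrow> R' r = R r" "\<forall>i. i \<noteq> 7 \<longrightarrow> M' i = M i"
      using 4(1) j by (auto simp: Inv_def dr)
    show ?case
    proof (rule exI[of _ 5], rule hoare_Blk, goal_cases)
      case (2 R1 M1)
      then have R1: "R1 = R'(25 := X ! j, 16 := M 3 (R' 16), 23 := Suc j, 17 := length X - j - 1)"
        and M1: "M1 = M'(7 := (M' 7)(j := X ! j))"
        using I R(1) by auto
      have "Inv (Suc j) R1 M1"
        using I j by (simp add: Inv_def R1 M1 less_Suc_eq)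
      then show ?case
        using j by (intro exI[of _ "Suc j"]) simp
    qed auto
  qed auto
qed

definition search_result :: "nat list \<Rightarrow> int \<Rightarrow> nat list \<Rightarrow> bool" where
  "search_result P thr X \<longleftrightarrow> (if X = [] then \<forall>Q. \<not> target P thr Q else found P thr X)"

definition search_cost :: "nat \<Rightarrow> nat" where
  "search_cost m = 8 * n + n * U m + unit_cost"

text \<open>\<open>X\<close> has to be copied out first, because the new tree nodes overwrite the
  discarded breadth-first nodes.\<close>

lemma search_com:
  assumes g: "globals_ok R M" and hp: "heap ns M" and P: "set P \<subseteq> {..<n}" "feasible P" "length P < A"
    and R: "R 6 = length ns" "R 7 < length ns" "fst (ns ! R 7) = P"
      "R 11 = length P" "R 12 = length (out_list P)" "R 13 = R 10 + gg"
    and thr: "thr = gap (set P) + int gg"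
  shows "hoare search_com (R, M) (search_cost (A - Suc (length P)))
    (\<lambda>R' M'. \<exists>X. search_result P thr X \<and> globals_ok R' M' \<and> heap (ns @ kids P (R 13) (closed_nbs X)) M' \<and>
       R' 6 = length (ns @ kids P (R 13) (closed_nbs X)) \<and>
       (\<forall>r<22. r \<notin> {6, 9, 14, 15, 16, 17, 19, 20, 21} \<longrightarrow> R' r = R r))"
proof -
  define N where "N = n * U (A - Suc (length P))"
  have bound: "14 * D * A + 7 * A + 18 \<le> unit_cost"
  proof -
    have "14 * D * A \<le> 14 * ((A + 1) * D)" "7 * A \<le> 7 * ((A + 1) * D)" "1 \<le> (A + 1) * D"
      using D_pos by (auto simp: Suc_leI algebra_simps intro: trans_le_add2)
    then show ?thesis
      unfolding unit_cost_def by linarith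
  qed
  have nsne: "ns \<noteq> []"
    using R(2) by auto
  show ?thesis
    unfolding search_com_def
  proof (rule hoare_Blk_Seq[where T = "8 * n + 3 + (N + 2 + (1 + (7 * A + 1 + (3 + (14 * D * A + 3)))))"], goal_cases)
    case 3
    show ?case using bound by (simp add: search_cost_def N_def)
  next
    case (2 R1 M1)
    then have R1: "R1 = R(15 := length ns, 14 := length ns, 17 := 0, 20 := R 7, 21 := 0)" and M1: "M1 = M"
      using R by auto
    define qs where "qs = kids P 0 [0..<n]"
    have qpot: "qpot (map fst qs) = N"
      using qpot_kids[of P "[0..<n]"] by (simp add: qs_def N_def o_def)
    have qs: "map fst qs = map (\<lambda>w. w # P) [0..<n]"
      by (simp add: qs_def)
    have "hoare push_all_com (R1, M1) (8 * n + 3)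
      (\<lambda>R' M'. heap (ns @ kids P (R1 21) [0..<n]) M' \<and> R' 6 = length ns + n \<and>
        (\<forall>r. r \<notin> {6, 27, 28} \<longrightarrow> R' r = R1 r) \<and> (\<forall>i. i \<notin> {3, 4, 5} \<longrightarrow> M' i = M1 i))"
      by (rule push_all_com) (use g hp R in \<open>auto simp: R1 M1 globals_ok_def\<close>)
    then show ?case
    proof (rule hoare_Seq[where T' = "N + 2 + (1 + (7 * A + 1 + (3 + (14 * D * A + 3))))"], goal_cases)
      case (1 R2 M2)
      then have R2: "heap (ns @ qs) M2" "R2 6 = length (ns @ qs)" "\<forall>r. r \<notin> {6, 27, 28} \<longrightarrow> R2 r = R1 r"
        and M2: "\<forall>i. i \<notin> {3, 4, 5} \<longrightarrow> M2 i = M i"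
        by (auto simp: R1 M1 qs_def)
      have g2: "globals_ok R2 M2"
        using g R2(3) M2 input_ok_cong[of M M2] by (auto simp: globals_ok_def R1)
      have "hoare bfs_com (R2, M2) (qpot (map fst qs) + 2)
        (\<lambda>R' M'. \<exists>zs X. globals_ok R' M' \<and> heap (ns @ zs) M' \<and>
           (\<forall>r<22. r \<notin> {6, 9, 14, 16, 17, 19, 20} \<longrightarrow> R' r = R2 r) \<and>
           R' 17 = length X \<and> (X = [] \<longrightarrow> (\<forall>Q. \<not> target P thr Q)) \<and>
           (X \<noteq> [] \<longrightarrow> chain M' (R' 16) (X @ P) \<and> found P thr X))"
        by (rule bfs_com[where gg = gg])
           (use g2 R2 P R thr queue_start[OF P(3)] in \<open>simp_all add: R1 qs\<close>)
      then show ?case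
        unfolding qpot
      proof (rule hoare_Seq[where T' = "1 + (7 * A + 1 + (3 + (14 * D * A + 3)))"], goal_cases)
        case (1 R3 M3)
        then obtain zs X where R3: "globals_ok R3 M3" "heap (ns @ zs) M3"
           "\<forall>r<22. r \<notin> {6, 9, 14, 16, 17, 19, 20} \<longrightarrow> R3 r = R2 r"
           "R3 17 = length X" "X = [] \<longrightarrow> (\<forall>Q. \<not> target P thr Q)"
           "X \<noteq> [] \<longrightarrow> chain M3 (R3 16) (X @ P) \<and> found P thr X"
          by blast
        have X: "search_result P thr X" "length X \<le> A" "set X \<subseteq> {..<n}"
        proof -
          show "search_result P thr X"
            using R3(5,6) by (auto simp: search_result_def)
          show "length X \<le> A"
            using R3(6) by (cases "X = []") (auto simp: found_def)
          show "set X \<subseteq> {..<n}"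
            using R3(6) S_subset by (cases "X = []") (auto simp: found_def feasible_def)
        qed
        have fr3: "\<forall>r<22. r \<notin> {6, 9, 14, 15, 16, 17, 19, 20, 21} \<longrightarrow> R3 r = R r" "R3 15 = length ns"
          using R3(3) R2(3) by (auto simp: R1)
        have hp3: "heap ns M3"
          using heap_appendD[OF R3(2) nsne] .
        show ?case
        proof (rule hoare_Blk_Seq[where T = "7 * A + 1 + (3 + (14 * D * A + 3))"], goal_cases)
          case (2 R4 M4)
          then have R4: "R4 = R3(23 := 0)" "M4 = M3"
            by auto
          have "hoare copy_com (R4, M4) (7 * length X + 1)
            (\<lambda>R' M'. R' 23 = length X \<and> (\<forall>i<length X. M' 7 i = X ! i) \<and>
              (\<forall>r. r \<notin> {16, 17, 23, 25} \<longrightarrow> R' r = R4 r) \<and> (\<forall>i. i \<noteq> 7 \<longrightarrow> M' i = M4 i))"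
            by (rule copy_com[where P = P]) (use R3 in \<open>auto simp: R4 globals_ok_def\<close>)
          then show ?case
          proof (rule hoare_Seq[where T' = "3 + (14 * D * A + 3)"], goal_cases)
            case (1 R5 M5)
            then have R5: "R5 23 = length X" "\<forall>i<length X. M5 7 i = X ! i"
              "\<forall>r. r \<notin> {16, 17, 23, 25} \<longrightarrow> R5 r = R3 r" and M5: "\<forall>i. i \<noteq> 7 \<longrightarrow> M5 i = M3 i"
              by (auto simp: R4)
            show ?case
            proof (rule hoare_Blk_Seq[where T = "14 * D * A + 3"], goal_cases)
              case (2 R6 M6)
              then have R6: "R6 = R5(6 := length ns, 20 := R 7, 21 := R 13)" "M6 = M5"
                using R5(3) fr3 by auto
              have g6: "globals_ok R6 M6"
                using R3(1) R5(3) M5 input_ok_cong[of M3 M5] by (auto simp: globals_ok_def R6)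
              have hp6: "heap ns M6"
                using heap_cong[OF hp3, of M5] M5 by (simp add: R6)
              have "hoare expand_com (R6, M6) (14 * D * length X + 3)
                (\<lambda>R' M'. heap (ns @ kids P (R6 21) (closed_nbs X)) M' \<and> R' 6 = length (ns @ kids P (R6 21) (closed_nbs X)) \<and>
                  (\<forall>r<25. r \<noteq> 6 \<longrightarrow> R' r = R6 r) \<and> (\<forall>i. i \<notin> {3, 4, 5} \<longrightarrow> M' i = M6 i))"
                by (rule expand_com) (use g6 hp6 R R5 X in \<open>auto simp: R6 globals_ok_def\<close>)
              then show ?case
              proof (rule hoare_mono, goal_cases)
                case 1
                then show ?case using X(2) by simp
              next
                case (2 R7 M7)
                have "globals_ok R7 M7"
                  using g6 2 input_ok_cong[of M6 M7] by (auto simp: globals_ok_def)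
                moreover have "\<forall>r<22. r \<notin> {6, 9, 14, 15, 16, 17, 19, 20, 21} \<longrightarrow> R7 r = R r"
                  using 2 R5(3) fr3(1) by (auto simp: R6)
                ultimately show ?case
                  using 2 X(1) by (intro exI[of _ X]) (simp add: R6)
              qed
            qed auto
          qed (use X(2) in auto)
        qed auto
      qed auto
    qed auto
  qed auto
qed

text \<open>\<open>W m q\<close> bounds the total work below a node of the search tree that may still be extended by
  \<open>m\<close> vertices and whose label is \<open>d - q\<close>.\<close>
primrec W :: "nat \<Rightarrow> nat \<Rightarrow> nat" where
  "W 0 q = 2 * unit_cost"
| "W (Suc m) q = 2 * unit_cost + K * W m q +
     (\<Sum>g = 1..<q + 1. search_cost m + 6 + (g + B) * D * W m (q - g))"

definition npot :: "(nat list \<times> nat) list \<Rightarrow> nat" where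
  "npot ns = (\<Sum>(p, h)\<leftarrow>ns. W (A - length p) (d - h))"

definition node_ok :: "nat list \<times> nat \<Rightarrow> bool" where
  "node_ok = (\<lambda>(p, h). set p \<subseteq> {..<n} \<and> length p \<le> A \<and> h \<le> d)"

lemma npot_append: "npot (xs @ ys) = npot xs + npot ys"
  by (simp add: npot_def)

lemma npot_kids: "npot (kids P h ws) = length ws * W (A - Suc (length P)) (d - h)"
  unfolding npot_def by (simp add: o_def sum_list_triv)

text \<open>The right g is unknown, so register 13 runs through all labels \<open>h + g\<close>.
  Each X has at most \<open>g + B\<close> vertices by \<open>reach_length_le\<close>, which gives
  the summands.\<close>

lemma starts_com:
  assumes g: "globals_ok R M" and hp: "heap ns M" and P: "set P \<subseteq> {..<n}" "feasible P" "length P < A"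
    and R: "R 6 = length ns" "R 7 < length ns" "fst (ns ! R 7) = P"
      "R 11 = length P" "R 12 = length (out_list P)" "R 10 = h" "R 13 = h + 1" "R 18 = d + 1"
    and h: "h \<le> d"
  defines "m \<equiv> A - Suc (length P)"
  shows "hoare starts_com (R, M) ((d - h) * (search_cost m + 4) + 2)
    (\<lambda>R' M'. \<exists>zs. globals_ok R' M' \<and> heap (ns @ zs) M' \<and> R' 6 = length (ns @ zs) \<and>
       (\<forall>r<22. r \<notin> {6, 9, 13, 14, 15, 16, 17, 19, 20, 21} \<longrightarrow> R' r = R r) \<and>
       (\<forall>z\<in>set zs. node_ok z) \<and>
       npot zs \<le> (\<Sum>j = h + 1..<d + 1. (j - h + B) * D * W m (d - j)) \<and>
       (\<forall>g. 1 \<le> g \<and> h + g \<le> d \<longrightarrow>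
          (\<exists>X. search_result P (gap (set P) + int g) X \<and> set (kids P (h + g) (closed_nbs X)) \<subseteq> set zs)))"
proof -
  define Inv where "Inv = (\<lambda>(j, zs) R' M'. h + 1 \<le> j \<and> j \<le> d + 1 \<and> R' 13 = j \<and>
       globals_ok R' M' \<and> heap (ns @ zs) M' \<and> R' 6 = length (ns @ zs) \<and>
       (\<forall>r<22. r \<notin> {6, 9, 13, 14, 15, 16, 17, 19, 20, 21} \<longrightarrow> R' r = R r) \<and>
       (\<forall>z\<in>set zs. node_ok z) \<and>
       npot zs \<le> (\<Sum>j = h + 1..<j. (j - h + B) * D * W m (d - j)) \<and>
       (\<forall>g. 1 \<le> g \<and> h + g < j \<longrightarrow>
          (\<exists>X. search_result P (gap (set P) + int g) X \<and> set (kids P (h + g) (closed_nbs X)) \<subseteq> set zs)))"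
  show ?thesis
    unfolding starts_com_def
  proof (rule hoare_While[where Inv = Inv and x = "(h + 1, [])" and pot = "\<lambda>(j, zs). (d + 1 - j) * (search_cost m + 4) + 2"],
      goal_cases)
    case 2
    show ?case using assms by (simp add: Inv_def npot_def)
  next
    case (3 x R' M')
    obtain j zs where x: "x = (j, zs)" by (cases x)
    have j: "j = d + 1"
      using 3 R(8) by (auto simp: Inv_def x)
    let ?R = "R'(25 := R' 18 - R' 13)"
    have run: "run [Sub 25 18 13] (R', M') = (?R, M')"
      by simp
    have "globals_ok ?R M'"
      using 3(1) by (simp add: Inv_def x globals_ok_def)
    moreover have "\<forall>r<22. r \<notin> {6, 9, 13, 14, 15, 16, 17, 19, 20, 21} \<longrightarrow> ?R r = R r"
      using 3(1) by (auto simp: Inv_def x)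
    ultimately show ?case
      unfolding run fst_conv snd_conv using 3(1)
      by (intro conjI exI[of _ zs]) (simp_all add: Inv_def x j)
  next
    case (4 x R' M')
    obtain j zs where x: "x = (j, zs)" by (cases x)
    have I: "h + 1 \<le> j" "j \<le> d" "R' 13 = j" "globals_ok R' M'" "heap (ns @ zs) M'" "R' 6 = length (ns @ zs)"
      "\<forall>r<22. r \<notin> {6, 9, 13, 14, 15, 16, 17, 19, 20, 21} \<longrightarrow> R' r = R r"
      "\<forall>z\<in>set zs. node_ok z"
      "npot zs \<le> (\<Sum>j = h + 1..<j. (j - h + B) * D * W m (d - j))"
      "\<forall>g. 1 \<le> g \<and> h + g < j \<longrightarrow>
          (\<exists>X. search_result P (gap (set P) + int g) X \<and> set (kids P (h + g) (closed_nbs X)) \<subseteq> set zs)"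
      using 4 R(8) by (auto simp: Inv_def x)
    define gg where "gg = j - h"
    have gg: "1 \<le> gg" "j = h + gg"
      using I(1) by (auto simp: gg_def)
    let ?thr = "gap (set P) + int gg"
    let ?R = "R'(25 := R' 18 - R' 13)"
    have run: "run [Sub 25 18 13] (R', M') = (?R, M')"
      by simp
    have sc: "hoare search_com (?R, M') (search_cost m)
      (\<lambda>R2 M2. \<exists>X. search_result P ?thr X \<and> globals_ok R2 M2 \<and> heap ((ns @ zs) @ kids P (?R 13) (closed_nbs X)) M2 \<and>
         R2 6 = length ((ns @ zs) @ kids P (?R 13) (closed_nbs X)) \<and>
         (\<forall>r<22. r \<notin> {6, 9, 14, 15, 16, 17, 19, 20, 21} \<longrightarrow> R2 r = ?R r))"
      unfolding m_def
      by (rule search_com[where gg = gg])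
         (use I(3-7) P R gg in \<open>auto simp: globals_ok_def nth_append\<close>)
    show ?case
      unfolding run
    proof (intro exI[of _ "search_cost m + 1"], rule hoare_Seq[OF sc, where T' = 1], goal_cases)
      case (1 R2 M2)
      then obtain X where X: "search_result P ?thr X" and R2: "globals_ok R2 M2"
        "heap ((ns @ zs) @ kids P j (closed_nbs X)) M2"
        "R2 6 = length ((ns @ zs) @ kids P j (closed_nbs X))"
        "\<forall>r<22. r \<notin> {6, 9, 14, 15, 16, 17, 19, 20, 21} \<longrightarrow> R2 r = R' r"
        using I(3) by auto
      let ?zs = "zs @ kids P j (closed_nbs X)"
      have Xn: "set X \<subseteq> {..<n}" "length X \<le> gg + B"
      proof -
        show "set X \<subseteq> {..<n}"
          using X S_subset by (cases "X = []") (auto simp: search_result_def found_def feasible_def)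
        show "length X \<le> gg + B"
          using X reach_length_le[of P gg X] gg(1) by (cases "X = []") (auto simp: search_result_def found_def)
      qed
      have "\<forall>z\<in>set ?zs. node_ok z"
        using I(2,8) closed_nbs_lt[OF Xn(1)] P by (auto simp: node_ok_def)
      moreover have "npot ?zs \<le> (\<Sum>j = h + 1..<Suc j. (j - h + B) * D * W m (d - j))"
      proof -
        have "length (closed_nbs X) \<le> (gg + B) * D"
          using length_closed_nbs[OF Xn(1)] Xn(2) by (meson le_trans mult_le_mono1)
        then have "npot (kids P j (closed_nbs X)) \<le> (gg + B) * D * W m (d - j)"
          unfolding npot_kids m_def by (intro mult_le_mono1)
        then show ?thesis
          using I(1,9) by (simp add: npot_append gg_def)
      qed
      moreover have "\<exists>X. search_result P (gap (set P) + int g) X \<and> set (kids P (h + g) (closed_nbs X)) \<subseteq> set ?zs"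
        if g: "1 \<le> g" "h + g < Suc j" for g
      proof (cases "h + g < j")
        case True
        then show ?thesis
          using I(10) g(1) by fastforce
      next
        case False
        then have "g = gg" using g gg by simp
        then show ?thesis
          using X gg by (intro exI[of _ X]) auto
      qed
      moreover have "\<forall>r<22. r \<notin> {6, 9, 13, 14, 15, 16, 17, 19, 20, 21} \<longrightarrow> R2 r = R r"
        using R2(4) I(7) by simp
      moreover have "R2 13 = j" "R2 3 = 1"
        using R2(1,4) I(3) by (auto simp: globals_ok_def)
      ultimately have Inv: "Inv (Suc j, ?zs) (R2(13 := Suc j)) M2"
        using R2 I(1,2) by (auto simp: Inv_def globals_ok_def)
      show ?case
      proof (rule hoare_Blk, goal_cases)
        case (2 R3 M3)
        then have "R3 = R2(13 := Suc j)" "M3 = M2"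
          using \<open>R2 13 = j\<close> \<open>R2 3 = 1\<close> by auto
        moreover have "d + 1 - j = Suc (d - j)"
          using I(2) by simp
        ultimately show ?case
          using Inv by (intro exI[of _ "(Suc j, ?zs)"]) (simp add: x)
      qed auto
    qed auto
  qed auto
qed

end

section \<open>The algorithm\<close>

definition node_com :: com where
  "node_com =
     Blk [Copy 19 7, Load 10 5 7] ;;
     eval_com ;;
     Cond [] 24 (Blk [])
       (Cond [Add 25 2 23, Sub 25 25 22] 25
          (Cond [Sub 25 4 22] 25
             (Blk [Copy 11 22, Copy 12 23, Copy 20 7, Copy 21 10] ;;
              expand_com ;;
              Blk [Add 13 10 3] ;;
              starts_com)
             (Blk []))
          (Blk [Const 8 1, Copy 7 6]))"

definition main_com :: com where
  "main_com = While [Sub 25 6 7] 25 (node_com ;; Blk [Add 7 7 3])"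

definition half_com :: com where
  "half_com = While [Sub 26 25 3] 26 (Blk [Add 5 5 3, Sub 25 25 3, Sub 25 25 3])"

definition prog :: com where
  "prog =
     Blk [Const 3 1, Sub 25 1 2, Const 5 0] ;;
     half_com ;;
     Blk [Add 4 5 2, Const 6 1, Add 18 2 3] ;;
     main_com ;;
     Blk [Copy 0 8]"

context vc_instance
begin

text \<open>Completeness of the search tree: growth is covered by the outer neighbours, and for the
  g supplied by \<open>exchange\<close> a target exists, so the search succeeds with an X no longer
  than it.\<close>

lemma good_step:
  assumes good: "good P h" and less: "gap (set P) < int d" and P: "set P \<subseteq> {..<n}"
    and grow: "set (kids P h (closed_nbs (out_list P))) \<subseteq> Z"
    and starts: "\<And>g. 1 \<le> g \<Longrightarrow> h + g \<le> d \<Longrightarrow>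
      \<exists>X. search_result P (gap (set P) + int g) X \<and> set (kids P (h + g) (closed_nbs X)) \<subseteq> Z"
  shows "\<exists>(p', h')\<in>Z. good p' h'"
  using good
proof (cases rule: good_cases)
  case (grow u v)
  have "feasible P"
    using good good_feasible by blast
  then have "set (out_list P) = Nout (set P)" "set (out_list P) \<subseteq> {..<n}"
    using eval_path_feasible(3)[OF P] Nout_lt by auto
  then have "v \<in> set (closed_nbs (out_list P))"
    using set_closed_nbs grow(1,2) by auto
  then have "(v # P, h) \<in> Z"
    using assms(4) by auto
  with grow(3) show ?thesis by auto
next
  case (start J)
  obtain g Q where g: "1 \<le> g" "h + g \<le> d" "target P (gap (set P) + int g) Q"
    "\<And>X. reach P (gap (set P) + int g) (X @ P) \<Longrightarrow> feasible (X @ P) \<Longrightarrow>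
       gap (set P) + int g \<le> gap (set (X @ P)) \<Longrightarrow> length (X @ P) \<le> length Q \<Longrightarrow>
       \<exists>v\<in>set (closed_nbs X). good (v # P) (h + g)"
    using exchange[OF start less] by blast
  obtain X where X: "search_result P (gap (set P) + int g) X" "set (kids P (h + g) (closed_nbs X)) \<subseteq> Z"
    using starts[OF g(1,2)] by blast
  have "found P (gap (set P) + int g) X"
    using X(1) g(3) by (auto simp: search_result_def split: if_splits)
  then have "\<exists>v\<in>set (closed_nbs X). good (v # P) (h + g)"
    using g(3,4) unfolding found_def by blast
  with X(2) show ?thesis by auto
qed

definition node_cost :: "nat list \<Rightarrow> nat \<Rightarrow> nat" where
  "node_cost p h = unit_cost + (if length p < A then (d - h) * (search_cost (A - Suc (length p)) + 6) else 0)"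

lemma unit_cost_ge: "25 \<le> unit_cost"
  using unit_cost_bound[of 0] by simp

text \<open>The 4 pays for the main loop: 3 steps of testing and jumping and 1 for advancing to the
  next node.\<close>

lemma W_step:
  fixes p :: "nat list"
  defines "m \<equiv> A - Suc (length p)"
  assumes "length p < A" "h \<le> d" "length ws \<le> K"
    and "npot zs \<le> (\<Sum>j = h + 1..<d + 1. (j - h + B) * D * W m (d - j))"
  shows "node_cost p h + 4 + npot (kids p h ws @ zs) \<le> W (A - length p) (d - h)"
proof -
  have Am: "A - length p = Suc m"
    using assms(2) by (simp add: m_def)
  have "(\<Sum>j = h + 1..<d + 1. (j - h + B) * D * W m (d - j))
      = (\<Sum>j = 1 + h..<(d - h + 1) + h. (j - h + B) * D * W m (d - j))"
    using assms(3) by simp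
  also have "\<dots> = (\<Sum>g = 1..<d - h + 1. (g + B) * D * W m (d - h - g))"
    by (subst sum.shift_bounds_nat_ivl) (simp add: add.commute)
  finally have "npot zs \<le> (\<Sum>g = 1..<d - h + 1. (g + B) * D * W m (d - h - g))"
    using assms(5) by simp
  moreover have "npot (kids p h ws) \<le> K * W m (d - h)"
    unfolding npot_kids m_def using assms(4) by simp
  moreover have "node_cost p h = unit_cost + (d - h) * (search_cost m + 6)"
    using assms(2) by (simp add: node_cost_def m_def)
  moreover have "W (A - length p) (d - h) = 2 * unit_cost + K * W m (d - h) + (d - h) * (search_cost m + 6)
      + (\<Sum>g = 1..<d - h + 1. (g + B) * D * W m (d - h - g))"
    unfolding Am W.simps by (simp only: sum.distrib) (simp add: algebra_simps)
  ultimately show ?thesis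
    using unit_cost_ge by (simp add: npot_append)
qed

lemma W_leaf:
  assumes "h \<le> d"
  shows "node_cost p h + 4 + npot [] \<le> W (A - length p) (d - h)"
proof (cases "length p < A")
  case False
  then show ?thesis
    using unit_cost_ge by (simp add: node_cost_def npot_def)
next
  case True
  then show ?thesis
    using W_step[of p h "[]" "[]"] assms by (simp add: npot_def)
qed

lemma node_com:
  assumes g: "globals_ok R M" and hp: "heap (ds @ (p, h) # qs) M"
    and R: "R 6 = length (ds @ (p, h) # qs)" "R 7 = length ds" "R 8 = 0" "R 18 = d + 1"
    and ok: "node_ok (p, h)"
  shows "hoare node_com (R, M) (node_cost p h)
    (\<lambda>R' M'. globals_ok R' M' \<and> R' 18 = d + 1 \<and>
       (R' 8 = 1 \<and> R' 7 = R' 6 \<and> (\<exists>J. solution J) \<or>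
        R' 8 = 0 \<and> R' 7 = length ds \<and>
        (\<exists>zs. heap (ds @ (p, h) # qs @ zs) M' \<and> R' 6 = length (ds @ (p, h) # qs @ zs) \<and>
           (\<forall>z\<in>set zs. node_ok z) \<and> (good p h \<longrightarrow> (\<exists>(p', h')\<in>set zs. good p' h')) \<and>
           node_cost p h + 4 + npot zs \<le> W (A - length p) (d - h))))"
    (is "hoare _ _ _ ?Q")
proof -
  let ?ns = "ds @ (p, h) # qs"
  have pn: "set p \<subseteq> {..<n}" and pA: "length p \<le> A" and hd: "h \<le> d"
    using ok by (auto simp: node_ok_def)
  have bound: "20 * (length p + 1) * D + (14 * D * B + 20) + 5 \<le> unit_cost"
    using unit_cost_bound pA .
  have idx: "length ds < length ?ns" "?ns ! length ds = (p, h)"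
    by (auto simp: nth_append)
  have ch: "chain M (length ds) p" "M 5 (length ds) = h"
    using hp idx unfolding heap_def by (metis fst_conv, metis snd_conv)
  let ?T = "if length p < A then (d - h) * (search_cost (A - Suc (length p)) + 6) else 0"
  show ?thesis
    unfolding node_com_def
  proof (rule hoare_Blk_Seq[where T = "20 * (length p + 1) * D + (14 * D * B + ?T + 21)"], goal_cases)
    case 3
    show ?case using bound by (simp add: node_cost_def)
  next
    case (2 R1 M1)
    then have R1: "R1 = R(19 := length ds, 10 := h)" and M1: "M1 = M"
      using ch R by auto
    have "hoare eval_com (R1, M1) (20 * (length p + 1) * D)
      (\<lambda>R2 M2. (\<forall>r<22. r \<noteq> 9 \<longrightarrow> R2 r = R1 r) \<and> (\<forall>i. i \<noteq> 6 \<and> i \<noteq> 7 \<longrightarrow> M2 i = M1 i) \<and>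
        (\<forall>u. M2 6 u \<le> R2 9) \<and> R2 22 = length p \<and> (R2 24 = 0 \<longleftrightarrow> feasible p) \<and>
        R2 23 = length (out_list p) \<and> (\<forall>i<length (out_list p). M2 7 i = out_list p ! i))"
      by (rule eval_com) (use g ch pn in \<open>auto simp: globals_ok_def R1 M1\<close>)
    then show ?case
    proof (rule hoare_Seq[where T' = "14 * D * B + ?T + 21"], goal_cases)
      case (1 R2 M2)
      then have R2: "\<forall>r<22. r \<notin> {9, 10, 19} \<longrightarrow> R2 r = R r" "R2 10 = h" "R2 22 = length p" "R2 24 = 0 \<longleftrightarrow> feasible p"
        "R2 23 = length (out_list p)" "\<forall>i<length (out_list p). M2 7 i = out_list p ! i"
        and M2: "\<forall>i. i \<noteq> 6 \<and> i \<noteq> 7 \<longrightarrow> M2 i = M i" "\<forall>u. M2 6 u \<le> R2 9"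
        by (auto simp: R1 M1)
      have g2: "globals_ok R2 M2"
        using g R2(1) M2 input_ok_cong[of M M2] by (auto simp: globals_ok_def)
      have hp2: "heap ?ns M2"
        using heap_cong[OF hp, of M2] M2 by simp
      have skip: "?Q R3 M2" if "\<not> good p h" "\<forall>r. r \<noteq> 25 \<longrightarrow> R3 r = R2 r" for R3
        using that g2 hp2 R2(1) R W_leaf[OF hd, of p]
        by (auto simp: globals_ok_def intro!: exI[of _ "[]"])
      show ?case
      proof (rule hoare_Cond[where T = "14 * D * B + ?T + 19"], goal_cases)
        case (2 R3 M3)
        then have "R3 = R2" "M3 = M2" "\<not> good p h"
          using R2(4) good_feasible by auto
        then show ?case
          using skip[of R2] by (intro hoare_Blk) simp_all
      next
        case (3 R3 M3)
        then have R3: "R3 = R2" "M3 = M2" and feasible: "feasible p"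
          using R2(4) by auto
        have gp: "gap (set p) = int (length p) - int (length (out_list p))"
          using feasible_gap pn feasible by auto
        show ?case
          unfolding R3
        proof (rule hoare_Cond[where T = "14 * D * B + ?T + 15"], goal_cases)
          case (2 R4 M4)
          then have R4: "\<forall>r. r \<noteq> 25 \<longrightarrow> R4 r = R2 r" "M4 = M2" "length p < d + length (out_list p)"
            using R2(3,5) g2 by (auto simp: globals_ok_def)
          have gless: "gap (set p) < int d"
            using R4(3) gp by linarith
          show ?case
          proof (rule hoare_Cond[where T = "14 * D * B + ?T + 12"], goal_cases)
            case (2 R5 M5)
            then have R5: "\<forall>r. r \<noteq> 25 \<longrightarrow> R5 r = R2 r" "M5 = M2" and lA: "length p < A"
              using R4 R2(3) g2 by (auto simp: globals_ok_def)
            define m where "m = A - Suc (length p)"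
            have T: "?T = (d - h) * (search_cost m + 6)"
              using lA by (simp add: m_def)
            show ?case
            proof (rule hoare_Blk_Seq[where T = "14 * D * B + 3 + (1 + ((d - h) * (search_cost m + 4) + 2))"], goal_cases)
              case 3
              show ?case
                unfolding T by (simp add: distrib_left)
            next
              case (2 R6 M6)
              then have R6: "R6 = R5(11 := length p, 12 := length (out_list p), 20 := length ds, 21 := h)" "M6 = M2"
                using R5 R2 R(2) by auto
              have outn: "set (out_list p) \<subseteq> {..<n}" "length (out_list p) \<le> B"
                using eval_path_feasible[OF pn] feasible Nout_lt by (auto simp: feasible_def)
              let ?new = "kids p (R6 21) (closed_nbs (out_list p))"
              let ?new' = "kids p h (closed_nbs (out_list p))"
              have ex: "hoare expand_com (R6, M6) (14 * D * length (out_list p) + 3)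
                (\<lambda>R7 M7. heap (?ns @ ?new) M7 \<and> R7 6 = length (?ns @ ?new) \<and>
                  (\<forall>r<25. r \<noteq> 6 \<longrightarrow> R7 r = R6 r) \<and> (\<forall>i. i \<notin> {3, 4, 5} \<longrightarrow> M7 i = M6 i))"
                by (rule expand_com)
                   (use g2 hp2 R R2 R5(1) outn in \<open>auto simp: R6 globals_ok_def nth_append\<close>)
              show ?case
              proof (rule hoare_Seq[OF ex, where T' = "1 + ((d - h) * (search_cost m + 4) + 2)"], goal_cases)
                case (1 R7 M7)
                then have R7: "heap (?ns @ ?new') M7" "R7 6 = length (?ns @ ?new')"
                  "\<forall>r<25. r \<notin> {6, 11, 12, 20, 21} \<longrightarrow> R7 r = R2 r"
                  "R7 11 = length p" "R7 12 = length (out_list p)" and M7: "\<forall>i. i \<notin> {3, 4, 5} \<longrightarrow> M7 i = M2 i"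
                  using R5(1) by (auto simp: R6)
                have g7: "globals_ok R7 M7"
                  using g2 R7(3) M7 input_ok_cong[of M2 M7] by (auto simp: globals_ok_def)
                show ?case
                proof (rule hoare_Blk_Seq[where T = "(d - h) * (search_cost m + 4) + 2"], goal_cases)
                  case (2 R8 M8)
                  then have R8: "R8 = R7(13 := h + 1)" "M8 = M7"
                    using R7(3) R2(2) g7 by (auto simp: globals_ok_def)
                  have st: "hoare starts_com (R8, M8) ((d - h) * (search_cost (A - Suc (length p)) + 4) + 2)
                    (\<lambda>R' M'. \<exists>zs. globals_ok R' M' \<and> heap ((?ns @ ?new') @ zs) M' \<and> R' 6 = length ((?ns @ ?new') @ zs) \<and>
                       (\<forall>r<22. r \<notin> {6, 9, 13, 14, 15, 16, 17, 19, 20, 21} \<longrightarrow> R' r = R8 r) \<and>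
                       (\<forall>z\<in>set zs. node_ok z) \<and>
                       npot zs \<le> (\<Sum>j = h + 1..<d + 1. (j - h + B) * D * W (A - Suc (length p)) (d - j)) \<and>
                       (\<forall>g. 1 \<le> g \<and> h + g \<le> d \<longrightarrow>
                          (\<exists>X. search_result p (gap (set p) + int g) X \<and> set (kids p (h + g) (closed_nbs X)) \<subseteq> set zs)))"
                    by (rule starts_com)
                       (use g7 R7 R2 R pn feasible lA hd in \<open>auto simp: R8 globals_ok_def nth_append\<close>)
                  show ?case
                    unfolding m_def
                  proof (rule hoare_mono[OF st], goal_cases)
                    case (2 R9 M9)
                    then obtain zs where zs: "globals_ok R9 M9" "heap ((?ns @ ?new') @ zs) M9"
                      "R9 6 = length ((?ns @ ?new') @ zs)"
                      "\<forall>r<22. r \<notin> {6, 9, 13, 14, 15, 16, 17, 19, 20, 21} \<longrightarrow> R9 r = R8 r"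
                      "\<forall>z\<in>set zs. node_ok z"
                      "npot zs \<le> (\<Sum>j = h + 1..<d + 1. (j - h + B) * D * W (A - Suc (length p)) (d - j))"
                      "\<forall>g. 1 \<le> g \<and> h + g \<le> d \<longrightarrow>
                          (\<exists>X. search_result p (gap (set p) + int g) X \<and> set (kids p (h + g) (closed_nbs X)) \<subseteq> set zs)"
                      by blast
                    let ?zs = "?new' @ zs"
                    have "length (closed_nbs (out_list p)) \<le> length (out_list p) * D"
                      using length_closed_nbs outn(1) by blast
                    also have "\<dots> \<le> K"
                      unfolding K_def using outn(2) by (intro mult_le_mono1) simp
                    finally have "node_cost p h + 4 + npot ?zs \<le> W (A - length p) (d - h)"
                      using W_step[OF lA hd _ zs(6)] by blast
                    moreover have "\<forall>z\<in>set ?zs. node_ok z"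
                      using zs(5) closed_nbs_lt[OF outn(1)] lA hd pn by (auto simp: node_ok_def)
                    moreover have "\<exists>(p', h')\<in>set ?zs. good p' h'" if "good p h"
                    proof (rule good_step[OF that gless pn])
                      fix g :: nat
                      assume "1 \<le> g" "h + g \<le> d"
                      then obtain X where "search_result p (gap (set p) + int g) X" "set (kids p (h + g) (closed_nbs X)) \<subseteq> set zs"
                        using zs(7) by blast
                      then show "\<exists>X. search_result p (gap (set p) + int g) X \<and> set (kids p (h + g) (closed_nbs X)) \<subseteq> set ?zs"
                        by (intro exI[of _ X]) auto
                    qed auto
                    moreover have "R9 8 = 0" "R9 7 = length ds" "R9 18 = d + 1"
                      using zs(4) R7(3) R2(1) R by (auto simp: R8)
                    moreover have "heap (ds @ (p, h) # qs @ ?zs) M9" "R9 6 = length (ds @ (p, h) # qs @ ?zs)"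
                      using zs(2,3) by auto
                    ultimately show ?case
                      using zs(1) by blast
                  qed auto
                qed auto
              qed (use outn(2) in auto)
            qed auto
          next
            case (3 R5 M5)
            then have R5: "\<forall>r. r \<noteq> 25 \<longrightarrow> R5 r = R2 r" "M5 = M2" "\<not> length p < A"
              using R4 R2(3) g2 by (auto simp: globals_ok_def)
            then have "\<not> good p h"
              using good_length_less gless by blast
            then show ?case
              using skip[OF _ R5(1)] R5(2) by (intro hoare_Blk) simp_all
          qed auto
        next
          case (3 R4 M4)
          then have R4: "\<forall>r. r \<noteq> 25 \<longrightarrow> R4 r = R2 r" "M4 = M2" "d + length (out_list p) \<le> length p"
            using R2(3,5) g2 by (auto simp: globals_ok_def)
          have "solution (set p)"
            using feasible R4(3) gp pA by (auto simp: solution_def feasible_def distinct_card)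
          then show ?case
            using R4(1,2) g2 R2(1) R(4) by (intro hoare_Blk) (auto simp: globals_ok_def)
        qed auto
      qed auto
    qed auto
  qed auto
qed

text \<open>If a solution exists, some waiting node is good until one is reported; running out of
  nodes therefore refutes existence.\<close>

lemma main_com:
  assumes g: "globals_ok R M" and hp: "heap [([], 0)] M"
    and R: "R 6 = 1" "R 7 = 0" "R 8 = 0" "R 18 = d + 1"
  shows "hoare main_com (R, M) (W A d + 2) (\<lambda>R' M'. R' 8 = of_bool (\<exists>J. solution J))"
proof -
  define Inv where "Inv = (\<lambda>(ds, qs, b) R' M'. globals_ok R' M' \<and> R' 18 = d + 1 \<and>
     (if b then R' 8 = 1 \<and> R' 7 = Suc (R' 6) \<and> (\<exists>J. solution J)
      else R' 8 = 0 \<and> R' 7 = length ds \<and> heap (ds @ qs) M' \<and> R' 6 = length (ds @ qs) \<and>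
        (\<forall>z\<in>set qs. node_ok z) \<and> ((\<exists>J. solution J) \<longrightarrow> (\<exists>(p, h)\<in>set qs. good p h))))"
  define pot where "pot = (\<lambda>(ds :: (nat list \<times> nat) list, qs, b). (if b then 0 else npot qs) + 2)"
  show ?thesis
    unfolding main_com_def
  proof (rule hoare_While[where Inv = Inv and x = "([], [([], 0)], False)" and pot = pot], goal_cases)
    case 2
    show ?case
      using assms good_Nil by (auto simp: Inv_def node_ok_def)
  next
    case (3 x R' M')
    obtain ds qs b where x: "x = (ds, qs, b)" by (metis prod_cases3)
    have "R' 8 = of_bool (\<exists>J. solution J)"
    proof (cases b)
      case True
      then show ?thesis using 3(1) by (auto simp: Inv_def x)
    next
      case False
      then have "qs = []"
        using 3 by (cases qs) (auto simp: Inv_def x)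
      then show ?thesis
        using 3(1) False by (auto simp: Inv_def x)
    qed
    then show ?case
      by (auto simp: x pot_def)
  next
    case (4 x R' M')
    obtain ds qs' b where x: "x = (ds, qs', b)" by (metis prod_cases3)
    have b: "\<not> b"
      using 4 by (auto simp: Inv_def x)
    have "qs' \<noteq> []"
      using 4 b by (auto simp: Inv_def x)
    then obtain p h qs where qs': "qs' = (p, h) # qs"
      by (metis list.exhaust surj_pair)
    have I: "globals_ok R' M'" "R' 18 = d + 1" "R' 8 = 0" "R' 7 = length ds" "heap (ds @ (p, h) # qs) M'"
      "R' 6 = length (ds @ (p, h) # qs)" "node_ok (p, h)" "\<forall>z\<in>set qs. node_ok z"
      "(\<exists>J. solution J) \<longrightarrow> good p h \<or> (\<exists>(p, h)\<in>set qs. good p h)"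
      using 4(1) b by (auto simp: Inv_def x qs')
    let ?R = "R'(25 := R' 6 - R' 7)"
    have run: "run [Sub 25 6 7] (R', M') = (?R, M')"
      by simp
    have potx: "pot x = W (A - length p) (d - h) + npot qs + 2"
      using b by (simp add: pot_def x qs' npot_def)
    have leaf: "node_cost p h + 4 \<le> W (A - length p) (d - h)"
      using W_leaf[of h p] I(7) by (simp add: npot_def node_ok_def)
    have nc: "hoare node_com (?R, M') (node_cost p h)
      (\<lambda>R' M'. globals_ok R' M' \<and> R' 18 = d + 1 \<and>
       (R' 8 = 1 \<and> R' 7 = R' 6 \<and> (\<exists>J. solution J) \<or>
        R' 8 = 0 \<and> R' 7 = length ds \<and>
        (\<exists>zs. heap (ds @ (p, h) # qs @ zs) M' \<and> R' 6 = length (ds @ (p, h) # qs @ zs) \<and>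
           (\<forall>z\<in>set zs. node_ok z) \<and> (good p h \<longrightarrow> (\<exists>(p', h')\<in>set zs. good p' h')) \<and>
           node_cost p h + 4 + npot zs \<le> W (A - length p) (d - h))))"
      by (rule node_com) (use I in \<open>auto simp: globals_ok_def\<close>)
    show ?case
      unfolding run
    proof (intro exI[of _ "node_cost p h + 1"], rule hoare_Seq[OF nc, where T' = 1], goal_cases)
      case (1 R2 M2)
      then have g2: "globals_ok R2 M2" and R18: "R2 18 = d + 1"
        by auto
      have R3: "R2 3 = 1"
        using g2 by (simp add: globals_ok_def)
      let ?R3 = "R2(7 := Suc (R2 7))"
      have g3: "globals_ok ?R3 M2"
        using g2 by (simp add: globals_ok_def)
      have "\<exists>y. Inv y ?R3 M2 \<and> node_cost p h + 4 + pot y \<le> pot x"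
      proof (cases "R2 8 = 0")
        case False
        then have "Inv ([], [], True) ?R3 M2"
          using 1 g3 by (auto simp: Inv_def)
        moreover have "node_cost p h + 4 + pot ([], [], True) \<le> pot x"
          using leaf unfolding potx by (simp add: pot_def)
        ultimately show ?thesis by blast
      next
        case True
        then obtain zs where zs: "R2 7 = length ds" "heap (ds @ (p, h) # qs @ zs) M2"
          "R2 6 = length (ds @ (p, h) # qs @ zs)" "\<forall>z\<in>set zs. node_ok z"
          "good p h \<longrightarrow> (\<exists>(p', h')\<in>set zs. good p' h')"
          "node_cost p h + 4 + npot zs \<le> W (A - length p) (d - h)"
          using 1 by auto
        let ?y = "(ds @ [(p, h)], qs @ zs, False)"
        have "(\<exists>J. solution J) \<longrightarrow> (\<exists>(p, h)\<in>set (qs @ zs). good p h)"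
          using I(9) zs(5) by (metis (no_types, lifting) Un_iff set_append)
        then have "Inv ?y ?R3 M2"
          using zs(1-4) g3 R18 True I(8) by (auto simp: Inv_def)
        moreover have "node_cost p h + 4 + pot ?y \<le> pot x"
          unfolding potx using zs(6) by (simp add: pot_def npot_append)
        ultimately show ?thesis by blast
      qed
      then obtain y where "Inv y ?R3 M2" "node_cost p h + 4 + pot y \<le> pot x"
        by blast
      then show ?case
        using R3 by (intro hoare_Blk exI[of _ y]) auto
    qed auto
  qed (auto simp: pot_def npot_def)
qed

text \<open>Halving by repeated subtraction. The tested value is one less than the remainder, so the
  loop runs while at least 2 remain.\<close>

lemma half_com:
  assumes R: "R 3 = 1" "R 25 = k - d" "R 5 = 0"
  shows "hoare half_com (R, M) (6 * k + 2)
    (\<lambda>R' M'. R' 5 = B \<and> (\<forall>r. r \<notin> {5, 25, 26} \<longrightarrow> R' r = R r) \<and> M' = M)"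
proof -
  define Inv where "Inv = (\<lambda>j R' M'. R' 5 = j \<and> R' 25 = k - d - 2 * j \<and> 2 * j \<le> k - d \<and>
    (\<forall>r. r \<notin> {5, 25, 26} \<longrightarrow> R' r = R r) \<and> M' = M)"
  show ?thesis
    unfolding half_com_def
  proof (rule hoare_While[where Inv = Inv and x = 0 and pot = "\<lambda>j. 6 * (k - j) + 2"], goal_cases)
    case 2
    show ?case using assms by (simp add: Inv_def)
  next
    case (3 j R' M')
    then have "j = B"
      using R(1) by (auto simp: Inv_def B_def)
    with 3 show ?case by (auto simp: Inv_def)
  next
    case (4 j R' M')
    then have I: "R' 5 = j" "R' 25 = k - d - 2 * j" "2 * j + 2 \<le> k - d" "R' 3 = 1"
      "\<forall>r. r \<notin> {5, 25, 26} \<longrightarrow> R' r = R r" "M' = M"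
      using R(1) by (auto simp: Inv_def)
    show ?case
    proof (rule exI[of _ 3], rule hoare_Blk, goal_cases)
      case (2 R1 M1)
      then have "Inv (Suc j) R1 M1"
        using I by (auto simp: Inv_def)
      then show ?case
        using I(3) by (intro exI[of _ "Suc j"]) simp
    qed auto
  qed auto
qed

lemma prog:
  "hoare prog (input_registers (card V) k d, input_arrays adj S) (W A d + 6 * k + 11)
     (\<lambda>R M. R 0 = of_bool (gap_ls_vc V E S k d))"
proof -
  let ?R = "input_registers (card V) k d" and ?M = "input_arrays adj S"
  have R0: "?R 0 = n" "?R 1 = k" "?R 2 = d" "\<And>r. 3 \<le> r \<Longrightarrow> ?R r = 0"
    by (auto simp: input_registers_def nth_default_def card_V nth_Cons' numeral_2_eq_2)
  have M0: "?M a = (\<lambda>_. 0)" if "3 \<le> a" for a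
    using that by (auto simp: input_arrays_def nth_default_def fun_eq_iff)
  show ?thesis
    unfolding prog_def
  proof (rule hoare_Blk_Seq[where T = "6 * k + 2 + (3 + (W A d + 2 + 1))"], goal_cases)
    case (2 R1 M1)
    then have R1: "R1 = ?R(3 := 1, 25 := k - d, 5 := 0)" "M1 = ?M"
      using R0 by auto
    have hc: "hoare half_com (R1, M1) (6 * k + 2)
      (\<lambda>R' M'. R' 5 = B \<and> (\<forall>r. r \<notin> {5, 25, 26} \<longrightarrow> R' r = R1 r) \<and> M' = M1)"
      by (rule half_com) (auto simp: R1)
    show ?case
    proof (rule hoare_Seq[OF hc, where T' = "3 + (W A d + 2 + 1)"], goal_cases)
      case (1 R2 M2)
      show ?case
      proof (rule hoare_Blk_Seq[where T = "W A d + 2 + 1"], goal_cases)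
        case (2 R3 M3)
        then have R3: "R3 = R2(4 := A, 6 := 1, 18 := d + 1)" "M3 = ?M"
          using 1 R0 by (auto simp: R1 A_def)
        have "globals_ok R3 M3"
          using 1 R0 M0 input_ok_input_arrays by (auto simp: globals_ok_def R3 R1)
        \<comment> \<open>Zero-initialised memory already represents the root with label 0.\<close>
        moreover have "heap [([], 0)] M3"
          using M0[of 5] by (simp add: heap_def R3)
        ultimately have "hoare main_com (R3, M3) (W A d + 2) (\<lambda>R' M'. R' 8 = of_bool (gap_ls_vc V E S k d))"
          unfolding gap_ls_vc_iff_solution by (rule main_com) (use 1 R0 in \<open>auto simp: R3 R1\<close>)
        then show ?case
          by (rule hoare_Seq[where T' = 1]) (auto intro!: hoare_Blk)
      qed auto
    qed auto
  qed auto
qed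

end

section \<open>Estimating the running time\<close>

text \<open>A single term of the exponential series is at most its sum.\<close>

lemma power_le_fact_exp:
  fixes x :: real
  assumes "0 \<le> x"
  shows "x ^ m \<le> fact m * exp x"
proof -
  have "(\<lambda>n. x ^ n / fact n) sums exp x"
    using exp_converges[of x] by (simp add: scaleR_conv_of_real divide_inverse mult.commute)
  then have "sum (\<lambda>n. x ^ n / fact n) {m} \<le> exp x"
    using sum_le_suminf[of "\<lambda>n. x ^ n / fact n" "{m}"] assms by (simp add: sums_iff)
  then show ?thesis
    by (simp add: field_simps)
qed

lemma fact_mult_fact_le: "fact a * fact b \<le> (fact (a + b) :: real)"
proof -
  have "fact a * fact b \<le> (fact (a + b) :: nat)"
    using dvd_imp_le[OF fact_fact_dvd_fact[of a b]] by simp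
  then show ?thesis
    by (metis (mono_tags) of_nat_fact of_nat_le_iff of_nat_mult)
qed

text \<open>Since \<open>b \<le> a\<close>, the factor \<open>L ^ a\<close> gained by applying \<open>x ^ m \<le> fact m * exp x\<close> to
  \<open>x = L * (b + 1)\<close> absorbs \<open>c ^ k\<close>, and what remains is \<open>fact a\<close> times an exponential in \<open>b\<close>,
  which is at most a constant times \<open>fact b\<close>.\<close>
lemma power_le_const_fact:
  fixes c :: real
  assumes "1 \<le> c"
  shows "\<exists>C>0. \<forall>a b k. a + b \<le> k \<and> k \<le> a + b + 1 \<and> b \<le> a \<longrightarrow> c ^ k * (real b + 1) ^ a \<le> C * fact k"
proof -
  define L where "L = c\<^sup>2"
  define C where "C = c * exp L * exp (exp L)"
  have "c ^ k * (real b + 1) ^ a \<le> C * fact k" if "a + b \<le> k" "k \<le> a + b + 1" "b \<le> a" for a b k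
  proof -
    have "c ^ k \<le> c ^ (2 * a + 1)"
      using assms that by (intro power_increasing) auto
    also have "\<dots> = c * L ^ a"
      by (simp add: L_def power_mult)
    finally have "c ^ k * (real b + 1) ^ a \<le> c * L ^ a * (real b + 1) ^ a"
      by (intro mult_right_mono) auto
    also have "\<dots> = c * (L * (real b + 1)) ^ a"
      by (simp add: power_mult_distrib)
    also have "\<dots> \<le> c * (fact a * exp (L * (real b + 1)))"
      using assms by (intro mult_left_mono power_le_fact_exp) (auto simp: L_def)
    also have "exp (L * (real b + 1)) = exp L ^ b * exp L"
      by (simp add: distrib_left exp_add mult.commute flip: exp_of_nat_mult)
    \<comment> \<open>A second use of \<open>power_le_fact_exp\<close>, now with
      \<open>x = exp L\<close> and exponent \<open>b\<close>.\<close>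
    also have "c * (fact a * (exp L ^ b * exp L)) \<le> c * (fact a * ((fact b * exp (exp L)) * exp L))"
      using assms by (intro mult_left_mono mult_right_mono power_le_fact_exp) auto
    also have "\<dots> = C * (fact a * fact b)"
      by (simp add: C_def)
    also have "\<dots> \<le> C * fact k"
    proof (rule mult_left_mono)
      have "fact a * fact b \<le> (fact (a + b) :: real)"
        by (rule fact_mult_fact_le)
      also have "\<dots> \<le> fact k"
        using that by (intro fact_mono) auto
      finally show "fact a * fact b \<le> (fact k :: real)" .
      show "0 \<le> C"
        using assms by (simp add: C_def)
    qed
    finally show ?thesis .
  qed
  moreover have "0 < C"
    using assms by (simp add: C_def)
  ultimately show ?thesis by blast
qed

text \<open>Used as \<open>2 * sum \<le> 4 ^ q\<close>: the series of \<open>g / 4 ^ g\<close> is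
  4/9, below one half, whereas base 3 would give 3/4.\<close>

lemma sum_weighted_powers: "9 * (\<Sum>g = 1..<q + 1. g * 4 ^ (q - g)) + 3 * q + 4 = 4 * 4 ^ (q :: nat)"
proof (induction q)
  case (Suc q)
  have "(\<Sum>g = 1..<Suc q + 1. g * 4 ^ (Suc q - g)) = (\<Sum>g = 1..<q + 1. g * 4 ^ (Suc q - g)) + Suc q"
    by simp
  also have "(\<Sum>g = 1..<q + 1. g * 4 ^ (Suc q - g)) = (\<Sum>g = 1..<q + 1. 4 * (g * 4 ^ (q - g)))"
    by (intro sum.cong) (auto simp: Suc_diff_le)
  also have "\<dots> = 4 * (\<Sum>g = 1..<q + 1. g * 4 ^ (q - g))"
    by (simp add: sum_distrib_left)
  finally show ?case
    using Suc.IH by simp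
qed simp

context vc_instance
begin

lemma K_ge: "1 \<le> K" "D \<le> K"
  using D_pos by (auto simp: K_def)

text \<open>Each of the \<open>r + 1\<close> levels costs at most the last one; unlike a geometric
  sum this also covers \<open>K = 1\<close>.\<close>

lemma U_le: "U r \<le> unit_cost * (r + 1) * K ^ r"
proof (induction r)
  case (Suc r)
  have "unit_cost \<le> unit_cost * K ^ Suc r"
    using K_ge(1) by (simp add: Suc_leI)
  moreover have "K * U r \<le> K * (unit_cost * (r + 1) * K ^ r)"
    using Suc.IH by simp
  ultimately have "U (Suc r) \<le> unit_cost * K ^ Suc r + K * (unit_cost * (r + 1) * K ^ r)"
    unfolding U.simps by (rule add_mono)
  then show ?case
    by (simp add: algebra_simps)
qed simp

text \<open>134 is 60 for the searches plus 74 for the rest. One factor \<open>A + 1\<close> comes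
  from evaluating a path, the other from the levels in \<open>U_le\<close>.\<close>

definition G :: nat where "G = 134 * max 1 n * (A + 1)\<^sup>2"

lemma unit_cost_le: "2 * unit_cost \<le> G" and search_cost_le: "m \<le> A \<Longrightarrow> search_cost m + 6 \<le> G * K ^ (m + 1)"
proof -
  let ?N = "max 1 n"
  let ?H = "?N * (A + 1)\<^sup>2"
  have unit_cost: "unit_cost \<le> 60 * ((A + 1) * ?N)"
    unfolding unit_cost_def using mult_le_mono2[OF D_le, of "60 * (A + 1)"] by (simp only: mult.assoc)
  have NA: "(A + 1) * ?N \<le> ?H"
    by (simp add: power2_eq_square)
  show "2 * unit_cost \<le> G"
    using unit_cost NA by (simp add: G_def)
  assume m: "m \<le> A"
  \<comment> \<open>Here \<open>n\<close> is spent on the start vertices, so \<open>D\<close> goes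
    into one more power of \<open>K\<close>.\<close>
  have "unit_cost * K ^ m = 60 * (A + 1) * (D * K ^ m)"
    by (simp add: unit_cost_def)
  also have "\<dots> \<le> 60 * (A + 1) * K ^ (m + 1)"
    using K_ge(2) by (intro mult_le_mono2) simp
  finally have 1: "unit_cost * K ^ m \<le> 60 * (A + 1) * K ^ (m + 1)" .
  have "n * U m \<le> ?N * (unit_cost * (m + 1) * K ^ m)"
    using U_le by (intro mult_le_mono) auto
  also have "\<dots> = ?N * (m + 1) * (unit_cost * K ^ m)"
    by (simp only: ac_simps)
  also have "\<dots> \<le> ?N * (A + 1) * (60 * (A + 1) * K ^ (m + 1))"
    by (rule mult_le_mono[OF _ 1]) (use m in simp)
  also have "\<dots> = 60 * ?H * K ^ (m + 1)"
    by (simp only: power2_eq_square ac_simps)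
  finally have 2: "n * U m \<le> 60 * ?H * K ^ (m + 1)" .
  have "1 \<le> (A + 1)\<^sup>2"
    by (simp add: Suc_leI)
  then have NH: "?N \<le> ?H"
    using mult_le_mono2[of 1 "(A + 1)\<^sup>2" ?N] by simp
  have "8 * n + unit_cost + 6 \<le> 8 * ?N + 60 * ((A + 1) * ?N) + 6 * ?N"
    using unit_cost by (intro add_mono) auto
  also have "\<dots> \<le> 8 * ?H + 60 * ?H + 6 * ?H"
    using NA NH by (intro add_mono mult_le_mono2)
  also have "\<dots> = 74 * ?H"
    by simp
  also have "\<dots> \<le> 74 * ?H * K ^ (m + 1)"
    using K_ge(1) by simp
  finally have "search_cost m + 6 \<le> 74 * ?H * K ^ (m + 1) + 60 * ?H * K ^ (m + 1)"
    using 2 by (simp only: search_cost_def)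
  then show "search_cost m + 6 \<le> G * K ^ (m + 1)"
    by (simp add: G_def algebra_simps)
qed

text \<open>One more level doubles \<open>X\<close>: growing takes at most \<open>X\<close>, the
  guessed starts half of it, and local work with the searches the other half.\<close>

lemma W_le: "m \<le> A \<Longrightarrow> W m q \<le> 4 * G * (2 * K) ^ m * 4 ^ q"
proof (induction m arbitrary: q)
  case 0
  have "2 * unit_cost \<le> 4 * G * 1"
    using unit_cost_le by simp
  also have "\<dots> \<le> 4 * G * 4 ^ q"
    by (intro mult_le_mono2) simp
  finally show ?case by simp
next
  case (Suc m)
  define X where "X = 4 * G * (2 * K) ^ m * 4 ^ q * K"
  have m: "m \<le> A"
    using Suc.prems by simp
  have "K * W m q \<le> K * (4 * G * (2 * K) ^ m * 4 ^ q)"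
    using Suc.IH[OF m] by (intro mult_le_mono2)
  then have 1: "K * W m q \<le> X"
    by (simp only: X_def ac_simps)
  have "(\<Sum>g = 1..<q + 1. (g + B) * D * W m (q - g))
      \<le> (\<Sum>g = 1..<q + 1. K * (4 * G * (2 * K) ^ m) * (g * 4 ^ (q - g)))"
  proof (rule sum_mono)
    fix g assume "g \<in> {1..<q + 1}"
    then have "g + B \<le> g * (B + 1)"
      by (cases g) auto
    then have "(g + B) * D * W m (q - g) \<le> g * (B + 1) * D * (4 * G * (2 * K) ^ m * 4 ^ (q - g))"
      using Suc.IH[OF m] by (intro mult_le_mono) auto
    then show "(g + B) * D * W m (q - g) \<le> K * (4 * G * (2 * K) ^ m) * (g * 4 ^ (q - g))"
      by (simp only: K_def ac_simps)
  qed
  also have "\<dots> = K * (4 * G * (2 * K) ^ m) * (\<Sum>g = 1..<q + 1. g * 4 ^ (q - g))"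
    by (simp only: sum_distrib_left)
  finally have "2 * (\<Sum>g = 1..<q + 1. (g + B) * D * W m (q - g))
      \<le> 2 * (K * (4 * G * (2 * K) ^ m) * (\<Sum>g = 1..<q + 1. g * 4 ^ (q - g)))"
    by (rule mult_le_mono2)
  also have "\<dots> = K * (4 * G * (2 * K) ^ m) * (2 * (\<Sum>g = 1..<q + 1. g * 4 ^ (q - g)))"
    by (simp only: ac_simps)
  also have "\<dots> \<le> K * (4 * G * (2 * K) ^ m) * 4 ^ q"
    using sum_weighted_powers[of q] by (intro mult_le_mono2) simp
  finally have 2: "2 * (\<Sum>g = 1..<q + 1. (g + B) * D * W m (q - g)) \<le> X"
    by (simp only: X_def ac_simps)
  \<comment> \<open>The exponential in \<open>q\<close> absorbs the number of guesses, each with its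
    own search.\<close>
  have "q + 1 \<le> 4 ^ q"
    by (induction q) auto
  have "2 * unit_cost + q * (search_cost m + 6) \<le> G * K ^ (m + 1) + q * (G * K ^ (m + 1))"
    using unit_cost_le search_cost_le[OF m] K_ge(1) by (intro add_mono mult_le_mono2) (auto intro: le_trans)
  also have "\<dots> = (q + 1) * (G * K ^ (m + 1))"
    by simp
  also have "\<dots> \<le> 4 ^ q * (G * K ^ (m + 1))"
    using \<open>q + 1 \<le> 4 ^ q\<close> by (intro mult_le_mono1)
  finally have "2 * (2 * unit_cost + q * (search_cost m + 6)) \<le> 2 * (4 ^ q * (G * K ^ (m + 1)))"
    by simp
  also have "\<dots> \<le> 4 * 2 ^ m * (4 ^ q * (G * K ^ (m + 1)))"
    by (intro mult_le_mono1) (simp add: Suc_leI)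
  also have "\<dots> = X"
    by (simp add: X_def power_mult_distrib)
  finally have 3: "2 * (2 * unit_cost + q * (search_cost m + 6)) \<le> X" .
  have eq: "W (Suc m) q = 2 * unit_cost + K * W m q + (q * (search_cost m + 6) + (\<Sum>g = 1..<q + 1. (g + B) * D * W m (q - g)))"
    unfolding W.simps by (simp only: sum.distrib) (simp add: algebra_simps)
  have "a + b + (c + s) \<le> 2 * X" if "b \<le> X" "2 * s \<le> X" "2 * (a + c) \<le> X" for a b c s :: nat
    using that by arith
  from this[OF 1 2 3] have "W (Suc m) q \<le> 2 * X"
    unfolding eq .
  then show ?case
    by (simp add: X_def ac_simps)
qed

text \<open>The worst case for 3 is \<Delta> = 2. A base of at least 1 allows raising the exponent
  from \<open>A\<close>.\<close>

lemma D_power_le: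
  "real D ^ A \<le> 3 ^ A * max 1 (real (max_degree V E) - 1) powr (real (k + d) / 2)"
proof -
  let ?x = "max 1 (real (max_degree V E) - 1)"
  have "real D \<le> 3 * ?x"
    by (auto simp: D_def max_def)
  then have "real D ^ A \<le> (3 * ?x) ^ A"
    by (intro power_mono) auto
  also have "\<dots> = 3 ^ A * ?x powr real A"
    by (simp add: power_mult_distrib powr_realpow)
  also have "?x powr real A \<le> ?x powr (real (k + d) / 2)"
    using A_B(6) by (intro powr_mono) auto
  finally show ?thesis
    by simp
qed

text \<open>536 is 4 times 134, and 553 adds 6 and 11 since \<open>k\<close> is positive. In 96, the
  factors are 4 from \<open>(A + 1)\<^sup>2\<close>, 2 from \<open>2 * K\<close>, 3 from
  \<open>D\<close> and 4 from the guesses.\<close>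

lemma time_le:
  "real (W A d + 6 * k + 11) \<le> 553 * (96 ^ k * (real B + 1) ^ A) *
     max 1 (real (max_degree V E) - 1) powr (real (k + d) / 2) * max 1 (real (card V))"
proof -
  let ?p = "max 1 (real (max_degree V E) - 1) powr (real (k + d) / 2)"
  let ?N = "max 1 (real n)"
  let ?Y = "96 ^ k * (real B + 1) ^ A * ?p * ?N"
  have N: "real (max (Suc 0) n) = ?N"
    by (simp add: max_def)
  have "real (W A d) \<le> real (4 * G * (2 * K) ^ A * 4 ^ d)"
    using W_le[of A d] by (simp only: of_nat_le_iff)
  also have "\<dots> = 536 * (real A + 1)\<^sup>2 * (2 * (real B + 1) * real D) ^ A * 4 ^ d * ?N"
    by (simp add: G_def K_def N algebra_simps)
  also have "\<dots> = 536 * ((real A + 1)\<^sup>2 * 2 ^ A * 4 ^ d) * (real B + 1) ^ A * real D ^ A * ?N"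
    by (simp only: power_mult_distrib ac_simps)
  also have "\<dots> \<le> 536 * (4 ^ A * 2 ^ A * 4 ^ d) * (real B + 1) ^ A * (3 ^ A * ?p) * ?N"
  proof -
    have "a + 1 \<le> 2 ^ a" for a :: nat
      by (induction a) auto
    from this[of A] have "real (A + 1) \<le> real (2 ^ A)"
      by (simp only: of_nat_le_iff)
    then have "real A + 1 \<le> 2 ^ A"
      by simp
    then have "(real A + 1)\<^sup>2 \<le> (2 ^ A)\<^sup>2"
      by (intro power_mono) auto
    also have "\<dots> = (4 :: real) ^ A"
      by (simp add: power2_eq_square flip: power_mult_distrib)
    finally show ?thesis
      using D_power_le by (intro mult_mono) auto
  qed
  also have "\<dots> = 536 * (24 ^ A * 4 ^ d) * (real B + 1) ^ A * ?p * ?N"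
    by (simp add: flip: power_mult_distrib)
  also have "\<dots> \<le> 536 * (24 ^ k * 4 ^ k) * (real B + 1) ^ A * ?p * ?N"
    using A_B(1) d_bounds by (intro mult_mono power_increasing) auto
  also have "\<dots> = 536 * ?Y"
    by (simp flip: power_mult_distrib)
  finally have 1: "real (W A d) \<le> 536 * ?Y" .
  have "j + 1 \<le> 96 ^ j" for j :: nat
    by (induction j) auto
  from this[of k] have "real (k + 1) \<le> real (96 ^ k)"
    by (simp only: of_nat_le_iff)
  then have "real k \<le> 96 ^ k"
    by simp
  also have "96 ^ k * 1 * 1 * 1 \<le> ?Y"
    by (intro mult_mono one_le_power ge_one_powr_ge_zero) auto
  finally have 2: "real k \<le> ?Y"
    by simp
  have "real (W A d + 6 * k + 11) \<le> real (W A d) + 17 * real k"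
    using d_bounds by simp
  also have "\<dots> \<le> 553 * ?Y"
    using 1 2 by linarith
  finally show ?thesis
    by (simp add: card_V)
qed

end

theorem theorem20:
  shows "\<exists>(P :: instr list) (C :: real).
    \<forall>(V :: nat set) (E :: nat set set) (S :: nat set) (k :: nat) (d :: nat) (adj :: nat list list).
      gap_ls_vc_instance V E S k d \<and> adjacency_lists V E adj \<longrightarrow>
      (\<exists>t :: nat.
        real t \<le> C * fact k * max 1 (real (max_degree V E) - 1) powr (real (k + d) / 2)
                   * max 1 (real (card V)) \<and>
        decides_within P (input_registers (card V) k d) (input_arrays adj S) t
          (gap_ls_vc V E S k d))"
proof -
  obtain C :: real where C: "\<And>a b k. a + b \<le> k \<Longrightarrow> k \<le> a + b + 1 \<Longrightarrow> b \<le> a \<Longrightarrow>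
      96 ^ k * (real b + 1) ^ a \<le> C * fact k"
    using power_le_const_fact[of 96] by auto
  show ?thesis
  proof (intro exI[of _ "compile 0 prog"] exI[of _ "553 * C"] allI impI)
    fix V :: "nat set" and E :: "nat set set" and S :: "nat set" and k d :: nat and adj :: "nat list list"
    assume "gap_ls_vc_instance V E S k d \<and> adjacency_lists V E adj"
    then interpret vc_instance V E S k d adj
      by unfold_locales auto
    let ?p = "max 1 (real (max_degree V E) - 1) powr (real (k + d) / 2)"
    obtain t where t: "t \<le> W A d + 6 * k + 11"
      "decides_within (compile 0 prog) (input_registers (card V) k d) (input_arrays adj S) t
         (gap_ls_vc V E S k d)"
      using hoare_decides[OF prog] by blast
    have "real t \<le> real (W A d + 6 * k + 11)"
      using t(1) by (simp only: of_nat_le_iff)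
    also have "\<dots> \<le> 553 * (96 ^ k * (real B + 1) ^ A) * ?p * max 1 (real (card V))"
      by (rule time_le)
    also have "\<dots> \<le> 553 * (C * fact k) * ?p * max 1 (real (card V))"
      using C[OF A_B(1-3)] by (intro mult_right_mono mult_left_mono) auto
    finally show "\<exists>t. real t \<le> 553 * C * fact k * ?p * max 1 (real (card V)) \<and>
        decides_within (compile 0 prog) (input_registers (card V) k d) (input_arrays adj S) t
          (gap_ls_vc V E S k d)"
      using t(2) by (auto simp: mult.assoc)
  qed
qed

end
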